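(* Let $m\in\mathbb{N}$, $1\le p\le\infty$ and $X=\ell^p(\mathbb{C}^m)$. Let $T_0,T_1$ be complex $m\times m$ matrices with $T_1\neq 0$, and suppose there exist $\alpha\in(0,1)$ and $k\in\mathbb{N}$ such that $\sigma(T_0)=\{1-\alpha\}$ and $$T_1R(\lambda,T_0)T_1=\phi_T(\lambda)T_1,\qquad \phi_T(\lambda)=\frac{\alpha^k}{(\lambda-1+\alpha)^k},\qquad \lambda\in\mathbb{C}\setminus\{1-\alpha\}.$$ Let $T\in\mathcal{B}(X)$ be given by $T(x_j)_{j\in\mathbb{Z}}=(T_0x_j+T_1x_{j-1})_{j\in\mathbb{Z}}$ and, for $x_0\in X$, let $x(n)=T^nx_0$, $n\ge0$, be the solution of $x(n+1)=Tx(n)$, $n\ge 0$, $x(0)=x_0$. Let $M\in\mathcal{B}(X)$ be given by $M(x_j)=(T_1R(1,T_0)x_j)$, let $L:\operatorname{Ran}(T_1)\to\operatorname{Ran}(R(1,T_0)T_1)$ be the inverse of the isomorphism from $\operatorname{Ran}(R(1,T_0)T_1)$ onto $\operatorname{Ran}(T_1)$ obtained by restricting $T_1R(1,T_0)$, and let $Y=\{x_0\in X:\lim_{n\to\infty}x(n)\text{ exists in the norm of }X\}$. Let $S$ be the right shift on $X$. Then the following hold. (a) Given $x_0\in X$, we have $x_0\in Y$ if and only if there exists $y_0\in\operatorname{Ran}(T_1)$ such that the constant sequence $y$ with entry $y_0$ is an element of $X$ and $$\bigg\|\frac1n\sum_{j=1}^nS^jMx_0-y\bigg\|_X\to0,\qquad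 n\to\infty.\tag{$*$}$$ Moreover, if this is the case then $\|x(n)-z\|_X\to0$ as $n\to\infty$, where $z\in X$ is the constant sequence with entry $Ly_0$. In particular, $Y=X$ if and only if $1<p<\infty$, and if $1\le p<\infty$ the only possible candidate for $y$ and $z$ is $0$. (b) If $x_0\in X$ is such that the convergence in $( * )$ holds with rate $O(n^{-1})$ as $n\to\infty$ (for some $y$ as in (a)), then, with $z$ as in (a), $\|x(n)-z\|_X=O(n^{-1/2})$ as $n\to\infty$. (c) For all $x_0\in X$ we have $\|x(n+1)-x(n)\|_X=O(n^{-1/2})$ as $n\to\infty$. Furthermore, the rates in (b) and (c) are optimal, in the sense that if in (b) or in (c) the rate $n^{-1/2}$ were replaced by $r_n$ for some sequence $r_n>0$, $n\ge1$, with $r_n=o(n^{-1/2})$ as $n\to\infty$, then the corresponding statement would become false.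
   Context: $\ell^p(\mathbb{C}^m)$ denotes the Banach space of doubly infinite sequences $x=(x_j)_{j\in\mathbb{Z}}$ with $x_j\in\mathbb{C}^m$ (Euclidean norm) and norm $\|x\|=(\sum_{j\in\mathbb{Z}}\|x_j\|^p)^{1/p}$ if $1\le p<\infty$, $\|x\|=\sup_{j\in\mathbb{Z}}\|x_j\|$ if $p=\infty$. $\mathcal{B}(X)$ is the space of bounded linear operators on $X$, $\sigma(\cdot)$ denotes the spectrum, $\operatorname{Ran}$ the range, and $R(\lambda,T_0)=(\lambda-T_0)^{-1}$ for $\lambda\notin\sigma(T_0)$. The right shift $S\in\mathcal{B}(X)$ is defined by $S(x_j)=(x_{j-1})$. Under the stated assumptions, $T_1R(1,T_0)$ does restrict to an isomorphism from $\operatorname{Ran}(R(1,T_0)T_1)$ onto $\operatorname{Ran}(T_1)$, so $L$ is well defined. *)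

theory Defs
  imports "HOL-Analysis.Analysis" "HOL-Library.Landau_Symbols"
begin

text \<open>Since \<open>\<ell>\<^sup>p\<close> depends on the value \<open>p\<close>, it is rendered as a carrier set of functions on
  the integers. Outside this carrier \<open>lp_norm\<close> is meaningless.\<close>

definition lp_space :: "ennreal \<Rightarrow> (int \<Rightarrow> 'a::real_normed_vector) set" where
  "lp_space p = {x. if p = \<infinity> then bounded (range x)
                    else (\<lambda>j. norm (x j) powr enn2real p) summable_on UNIV}"

definition lp_norm :: "ennreal \<Rightarrow> (int \<Rightarrow> 'a::real_normed_vector) \<Rightarrow> real" where
  "lp_norm p x = (if p = \<infinity> then (SUP j. norm (x j))
                  else (\<Sum>\<^sub>\<infinity>j. norm (x j) powr enn2real p) powr (1 / enn2real p))"

definition lp_dist :: "ennreal \<Rightarrow> (int \<Rightarrow> 'a::real_normed_vector) \<Rightarrow> (int \<Rightarrow> 'a) \<Rightarrow> real" where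
  "lp_dist p x y = lp_norm p (\<lambda>j. x j - y j)"

definition lp_tendsto ::
    "ennreal \<Rightarrow> (nat \<Rightarrow> int \<Rightarrow> 'a::real_normed_vector) \<Rightarrow> (int \<Rightarrow> 'a) \<Rightarrow> bool" where
  "lp_tendsto p x z \<longleftrightarrow> (\<forall>n. x n \<in> lp_space p) \<and> z \<in> lp_space p \<and>
     (\<lambda>n. lp_dist p (x n) z) \<longlonglongrightarrow> 0"

definition lp_bounded_op ::
    "ennreal \<Rightarrow> ((int \<Rightarrow> complex^'m) \<Rightarrow> (int \<Rightarrow> complex^'m)) \<Rightarrow> bool" where
  "lp_bounded_op p A \<longleftrightarrow> (\<forall>x\<in>lp_space p. A x \<in> lp_space p) \<and>
     (\<forall>x\<in>lp_space p. \<forall>y\<in>lp_space p. \<forall>c. A (\<lambda>j. c *s x j + y j) = (\<lambda>j. c *s A x j + A y j)) \<and>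
     (\<exists>C. \<forall>x\<in>lp_space p. lp_norm p (A x) \<le> C * lp_norm p x)"

definition const_seq :: "'a \<Rightarrow> int \<Rightarrow> 'a" where
  "const_seq v = (\<lambda>_. v)"

definition right_shift :: "(int \<Rightarrow> 'a) \<Rightarrow> int \<Rightarrow> 'a" where
  "right_shift x = (\<lambda>j. x (j - 1))"

definition mat_spectrum :: "complex^'m^'m \<Rightarrow> complex set" where
  "mat_spectrum A = {\<mu>. \<not> invertible (mat \<mu> - A)}"

definition resolvent :: "complex \<Rightarrow> complex^'m^'m \<Rightarrow> complex^'m^'m" where
  "resolvent \<mu> A = matrix_inv (mat \<mu> - A)"

definition mat_range :: "complex^'m^'m \<Rightarrow> (complex^'m) set" where
  "mat_range A = range (\<lambda>v. A *v v)"

definition T_op :: "complex^'m^'m \<Rightarrow> complex^'m^'m \<Rightarrow> (int \<Rightarrow> complex^'m) \<Rightarrow> int \<Rightarrow> complex^'m" where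
  "T_op T0 T1 x = (\<lambda>j. T0 *v x j + T1 *v x (j - 1))"

definition solution ::
    "complex^'m^'m \<Rightarrow> complex^'m^'m \<Rightarrow> (int \<Rightarrow> complex^'m) \<Rightarrow> nat \<Rightarrow> int \<Rightarrow> complex^'m" where
  "solution T0 T1 x0 n = (T_op T0 T1 ^^ n) x0"

definition M_op :: "complex^'m^'m \<Rightarrow> complex^'m^'m \<Rightarrow> (int \<Rightarrow> complex^'m) \<Rightarrow> int \<Rightarrow> complex^'m" where
  "M_op T0 T1 x = (\<lambda>j. (T1 ** resolvent 1 T0) *v x j)"

text \<open>Junk outside \<open>mat_range T1\<close>; under the standing assumptions \<open>T1 R(1, T0)\<close> maps
  \<open>Ran (R(1, T0) T1)\<close> bijectively onto \<open>Ran T1\<close>, and \<open>L_map\<close> is the inverse of that bijection.\<close>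

definition L_map :: "complex^'m^'m \<Rightarrow> complex^'m^'m \<Rightarrow> complex^'m \<Rightarrow> complex^'m" where
  "L_map T0 T1 = inv_into (mat_range (resolvent 1 T0 ** T1)) (\<lambda>v. (T1 ** resolvent 1 T0) *v v)"

definition Y_space :: "ennreal \<Rightarrow> complex^'m^'m \<Rightarrow> complex^'m^'m \<Rightarrow> (int \<Rightarrow> complex^'m) set" where
  "Y_space p T0 T1 = {x0 \<in> lp_space p. \<exists>z. lp_tendsto p (solution T0 T1 x0) z}"

definition shift_mean ::
    "complex^'m^'m \<Rightarrow> complex^'m^'m \<Rightarrow> (int \<Rightarrow> complex^'m) \<Rightarrow> nat \<Rightarrow> int \<Rightarrow> complex^'m" where
  "shift_mean T0 T1 x0 n =
     (\<lambda>i. (1 / real n) *\<^sub>R (\<Sum>j=1..n. (right_shift ^^ j) (M_op T0 T1 x0) i))"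

definition mean_limit ::
    "ennreal \<Rightarrow> complex^'m^'m \<Rightarrow> complex^'m^'m \<Rightarrow> (int \<Rightarrow> complex^'m) \<Rightarrow> complex^'m \<Rightarrow> bool" where
  "mean_limit p T0 T1 x0 y0 \<longleftrightarrow> y0 \<in> mat_range T1 \<and> const_seq y0 \<in> lp_space p \<and>
     lp_tendsto p (shift_mean T0 T1 x0) (const_seq y0)"

text \<open>The two rate statements take the rate \<open>r\<close> as a parameter, so that optimality is the failure of
  the same statement for every faster \<open>r\<close>.\<close>

definition limit_rate ::
    "ennreal \<Rightarrow> complex^'m^'m \<Rightarrow> complex^'m^'m \<Rightarrow> (nat \<Rightarrow> real) \<Rightarrow> bool" where
  "limit_rate p T0 T1 r \<longleftrightarrow> (\<forall>x0\<in>lp_space p. \<forall>y0.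
     mean_limit p T0 T1 x0 y0 \<and>
     (\<lambda>n. lp_dist p (shift_mean T0 T1 x0 n) (const_seq y0)) \<in> O(\<lambda>n. 1 / real n) \<longrightarrow>
     (\<lambda>n. lp_dist p (solution T0 T1 x0 n) (const_seq (L_map T0 T1 y0))) \<in> O(r))"

definition increment_rate ::
    "ennreal \<Rightarrow> complex^'m^'m \<Rightarrow> complex^'m^'m \<Rightarrow> (nat \<Rightarrow> real) \<Rightarrow> bool" where
  "increment_rate p T0 T1 r \<longleftrightarrow> (\<forall>x0\<in>lp_space p.
     (\<lambda>n. lp_dist p (solution T0 T1 x0 (Suc n)) (solution T0 T1 x0 n)) \<in> O(r))"

lemma lp_dominated:
  fixes x :: "int \<Rightarrow> 'a::real_normed_vector" and y :: "int \<Rightarrow> 'b::real_normed_vector"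
  assumes p: "1 \<le> p" and y: "y \<in> lp_space p" and C: "0 \<le> C"
    and le: "\<And>j. norm (x j) \<le> C * norm (y j)"
  shows "x \<in> lp_space p" "lp_norm p x \<le> C * lp_norm p y"
proof -
  have "x \<in> lp_space p \<and> lp_norm p x \<le> C * lp_norm p y"
  proof (cases "p = \<infinity>")
    case True
    with y have b: "bounded (range y)" by (simp add: lp_space_def)
    then obtain B where B: "\<And>j. norm (y j) \<le> B" by (auto simp: bounded_iff)
    have "norm (x j) \<le> C * B" for j
      using le[of j] mult_left_mono[OF B C, of j] by linarith
    then have "bounded (range x)" by (auto simp: bounded_iff)
    moreover have "(SUP j. norm (x j)) \<le> C * (SUP j. norm (y j))"
    proof (rule cSUP_least)
      fix j
      have "norm (y j) \<le> (SUP j. norm (y j))"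
        using B by (intro cSUP_upper) (auto simp: bdd_above_def)
      from mult_left_mono[OF this C] le[of j] show "norm (x j) \<le> C * (SUP j. norm (y j))"
        by linarith
    qed simp
    ultimately show ?thesis using True by (simp add: lp_space_def lp_norm_def)
  next
    case False
    define q where "q = enn2real p"
    have q: "q \<ge> 1"
      unfolding q_def using p False
      by (metis enn2real_1 enn2real_mono infinity_ennreal_def top.not_eq_extremum)
    have sy: "(\<lambda>j. norm (y j) powr q) summable_on UNIV"
      using y False by (simp add: lp_space_def q_def)
    have pw: "norm (x j) powr q \<le> C powr q * norm (y j) powr q" for j
      using powr_mono2[OF _ _ le[of j], of q] q C by (simp add: powr_mult)
    have sCy: "(\<lambda>j. C powr q * norm (y j) powr q) summable_on UNIV"
      using sy by (rule summable_on_cmult_right)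
    have sx: "(\<lambda>j. norm (x j) powr q) summable_on UNIV"
      by (rule summable_on_comparison_test[OF sCy]) (use pw in auto)
    have "infsum (\<lambda>j. norm (x j) powr q) UNIV \<le> infsum (\<lambda>j. C powr q * norm (y j) powr q) UNIV"
      by (rule infsum_mono[OF sx sCy]) (use pw in auto)
    also have "\<dots> = C powr q * infsum (\<lambda>j. norm (y j) powr q) UNIV"
      by (rule infsum_cmult_right) (use sy in auto)
    finally have "infsum (\<lambda>j. norm (x j) powr q) UNIV powr (1/q)
        \<le> (C powr q * infsum (\<lambda>j. norm (y j) powr q) UNIV) powr (1/q)"
      using q by (intro powr_mono2) (auto intro: infsum_nonneg)
    also have "\<dots> = C * infsum (\<lambda>j. norm (y j) powr q) UNIV powr (1/q)"
      using q C by (simp add: powr_mult powr_powr infsum_nonneg)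
    finally show ?thesis
      using False sx by (simp add: lp_space_def lp_norm_def q_def)
  qed
  then show "x \<in> lp_space p" "lp_norm p x \<le> C * lp_norm p y" by auto
qed

lemma lp_norm_nonneg: "lp_norm p (x :: int \<Rightarrow> 'a::real_normed_vector) \<ge> 0"
  if "x \<in> lp_space p"
proof (cases "p = \<infinity>")
  case True
  with that obtain B where B: "\<And>j. norm (x j) \<le> B" by (auto simp: lp_space_def bounded_iff)
  have "norm (x 0) \<le> (SUP j. norm (x j))"
    using B by (intro cSUP_upper) (auto simp: bdd_above_def)
  from order_trans[OF norm_ge_zero this] show ?thesis using True by (simp add: lp_norm_def)
qed (simp add: lp_norm_def)

text \<open>The constant 4 is crude (Minkowski gives 1) but enough for boundedness of operators.\<close>

lemma lp_add:
  fixes x y :: "int \<Rightarrow> 'a::real_normed_vector"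
  assumes p: "1 \<le> p" and x: "x \<in> lp_space p" and y: "y \<in> lp_space p"
  shows "(\<lambda>j. x j + y j) \<in> lp_space p"
    and "lp_norm p (\<lambda>j. x j + y j) \<le> 4 * (lp_norm p x + lp_norm p y)"
proof -
  have "(\<lambda>j. x j + y j) \<in> lp_space p \<and> lp_norm p (\<lambda>j. x j + y j) \<le> 4 * (lp_norm p x + lp_norm p y)"
  proof (cases "p = \<infinity>")
    case True
    with x y obtain B B' where B: "\<And>j. norm (x j) \<le> B" and B': "\<And>j. norm (y j) \<le> B'"
      by (fastforce simp: lp_space_def bounded_iff)
    define a b where "a = (SUP j. norm (x j))" and "b = (SUP j. norm (y j))"
    have nx: "norm (x j) \<le> a" for j
      unfolding a_def using B by (intro cSUP_upper) (auto simp: bdd_above_def)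
    have ny: "norm (y j) \<le> b" for j
      unfolding b_def using B' by (intro cSUP_upper) (auto simp: bdd_above_def)
    have "norm (x j + y j) \<le> B + B'" for j
      using norm_triangle_ineq[of "x j" "y j"] B[of j] B'[of j] by linarith
    then have "bounded (range (\<lambda>j. x j + y j))" by (auto simp: bounded_iff)
    moreover have "(SUP j. norm (x j + y j)) \<le> 4 * (a + b)"
    proof (rule cSUP_least)
      fix j
      show "norm (x j + y j) \<le> 4 * (a + b)"
        using norm_triangle_mono[OF nx[of j] ny[of j]] order_trans[OF norm_ge_zero nx[of j]]
          order_trans[OF norm_ge_zero ny[of j]] unfolding distrib_left by linarith
    qed simp
    ultimately show ?thesis using True by (simp add: lp_space_def lp_norm_def a_def b_def)
  next
    case False
    define q where "q = enn2real p"
    have q: "q \<ge> 1"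
      unfolding q_def using p False
      by (metis enn2real_1 enn2real_mono infinity_ennreal_def top.not_eq_extremum)
    define a b where "a = (\<lambda>j. norm (x j) powr q)" and "b = (\<lambda>j. norm (y j) powr q)"
    have sa: "a summable_on UNIV" and sb: "b summable_on UNIV"
      using x y False by (simp_all add: lp_space_def q_def a_def b_def)
    have pw: "norm (x j + y j) powr q \<le> 2 powr q * (a j + b j)" for j
    proof -
      have "norm (x j + y j) \<le> 2 * max (norm (x j)) (norm (y j))"
        using norm_triangle_ineq[of "x j" "y j"] by linarith
      then have "norm (x j + y j) powr q \<le> (2 * max (norm (x j)) (norm (y j))) powr q"
        using q by (intro powr_mono2) auto
      also have "\<dots> = 2 powr q * max (norm (x j)) (norm (y j)) powr q"
        by (simp add: powr_mult)
      also have "\<dots> \<le> 2 powr q * (a j + b j)"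
        by (intro mult_left_mono) (auto simp: max_def a_def b_def)
      finally show ?thesis .
    qed
    have sab: "(\<lambda>j. 2 powr q * (a j + b j)) summable_on UNIV"
      using sa sb by (intro summable_on_cmult_right summable_on_add)
    have s: "(\<lambda>j. norm (x j + y j) powr q) summable_on UNIV"
      by (rule summable_on_comparison_test[OF sab]) (use pw in auto)
    define N where "N = lp_norm p x + lp_norm p y"
    have N: "lp_norm p x \<le> N" "lp_norm p y \<le> N" "N \<ge> 0"
      using lp_norm_nonneg[OF x] lp_norm_nonneg[OF y] by (auto simp: N_def)
    have Ia: "infsum a UNIV = lp_norm p x powr q" and Ib: "infsum b UNIV = lp_norm p y powr q"
      using False q by (simp_all add: lp_norm_def a_def b_def powr_powr infsum_nonneg flip: q_def)
    have "infsum (\<lambda>j. norm (x j + y j) powr q) UNIV \<le> infsum (\<lambda>j. 2 powr q * (a j + b j)) UNIV"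
      by (rule infsum_mono[OF s sab]) (use pw in auto)
    also have "\<dots> = 2 powr q * (infsum a UNIV + infsum b UNIV)"
      using sa sb by (simp add: infsum_cmult_right summable_on_add infsum_add)
    also have "\<dots> \<le> 2 powr q * (N powr q + N powr q)"
      unfolding Ia Ib using N q lp_norm_nonneg[OF x] lp_norm_nonneg[OF y]
      by (intro mult_left_mono add_mono powr_mono2) auto
    also have "\<dots> = 2 powr q * (2 powr 1 * N powr q)" by simp
    also have "\<dots> \<le> 2 powr q * (2 powr q * N powr q)"
      using q by (intro mult_left_mono mult_right_mono powr_mono) auto
    also have "\<dots> = (4 * N) powr q"
    proof -
      have "(4 * N) powr q = (2 * (2 * N)) powr q" by simp
      also have "\<dots> = 2 powr q * (2 powr q * N powr q)"
        using N by (simp only: powr_mult)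
      finally show ?thesis by simp
    qed
    finally have "infsum (\<lambda>j. norm (x j + y j) powr q) UNIV powr (1/q) \<le> ((4 * N) powr q) powr (1/q)"
      using q by (intro powr_mono2) (auto intro: infsum_nonneg)
    also have "\<dots> = 4 * N" using q N by (simp add: powr_powr)
    finally show ?thesis using False s by (simp add: lp_space_def lp_norm_def q_def N_def)
  qed
  then show "(\<lambda>j. x j + y j) \<in> lp_space p"
    "lp_norm p (\<lambda>j. x j + y j) \<le> 4 * (lp_norm p x + lp_norm p y)" by auto
qed

lemma lp_shift:
  fixes x :: "int \<Rightarrow> 'a::real_normed_vector"
  shows "right_shift x \<in> lp_space p \<longleftrightarrow> x \<in> lp_space p"
    and "lp_norm p (right_shift x) = lp_norm p x"
proof -
  have bij: "bij_betw (\<lambda>j::int. j - 1) UNIV UNIV"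
    by (rule bij_betwI[where g = "\<lambda>j. j + 1"]) auto
  have r: "range (\<lambda>j. f (j - 1 :: int)) = range f" for f :: "int \<Rightarrow> 'b"
    using bij_betw_imp_surj_on[OF bij] by (metis image_image)
  show "right_shift x \<in> lp_space p \<longleftrightarrow> x \<in> lp_space p"
    unfolding lp_space_def right_shift_def
    using r[of x] summable_on_reindex_bij_betw[OF bij, of "\<lambda>j. norm (x j) powr enn2real p"] by simp
  show "lp_norm p (right_shift x) = lp_norm p x"
    unfolding lp_norm_def right_shift_def
    using r[of "\<lambda>j. norm (x j)"] infsum_reindex_bij_betw[OF bij, of "\<lambda>j. norm (x j) powr enn2real p"]
    by simp
qed

lemma lp_bounded_op_shift: "lp_bounded_op p (right_shift :: (int \<Rightarrow> complex^'m) \<Rightarrow> _)"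
  unfolding lp_bounded_op_def
  by (auto simp: lp_shift) (auto simp: right_shift_def intro!: exI[of _ 1])

lemma matrix_norm_bound:
  fixes A :: "complex^'m^'m"
  obtains C where "C \<ge> 0" "\<And>v. norm (A *v v) \<le> C * norm v"
proof -
  have "bounded_linear (\<lambda>v. A *v v)"
    by (intro linear_conv_bounded_linear[THEN iffD1] linearI)
       (simp_all add: matrix_vector_right_distrib matrix_vector_mult_def vec_eq_iff
         scaleR_sum_right distrib_left sum.distrib)
  then obtain K where "K \<ge> 0" "\<And>v. norm (A *v v) \<le> norm v * K"
    using bounded_linear.nonneg_bounded by blast
  then show thesis using that[of K] by (simp add: mult.commute)
qed

lemma lp_bounded_op_matrix:
  fixes A :: "complex^'m^'m"
  assumes "1 \<le> p"
  shows "lp_bounded_op p (\<lambda>x j. A *v x j)"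
proof -
  obtain C where C: "C \<ge> 0" "\<And>v. norm (A *v v) \<le> C * norm v"
    using matrix_norm_bound by blast
  have "(\<lambda>j. A *v x j) \<in> lp_space p" "lp_norm p (\<lambda>j. A *v x j) \<le> C * lp_norm p x"
    if "x \<in> lp_space p" for x
    using lp_dominated[OF assms that C] by auto
  then show ?thesis
    unfolding lp_bounded_op_def
    by (auto simp: matrix_vector_right_distrib vector_scalar_commute)
qed

lemma lp_bounded_op_M: "1 \<le> p \<Longrightarrow> lp_bounded_op p (M_op T0 T1)"
  unfolding M_op_def by (rule lp_bounded_op_matrix)

lemma lp_bounded_op_T:
  assumes p: "1 \<le> p"
  shows "lp_bounded_op p (T_op T0 T1)"
proof -
  obtain C where C: "\<And>x. x \<in> lp_space p \<Longrightarrow> (\<lambda>j. T0 *v x j) \<in> lp_space p"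
      "\<And>x. x \<in> lp_space p \<Longrightarrow> lp_norm p (\<lambda>j. T0 *v x j) \<le> C * lp_norm p x"
    using lp_bounded_op_matrix[OF p, of T0] unfolding lp_bounded_op_def by blast
  obtain D where D: "\<And>x. x \<in> lp_space p \<Longrightarrow> (\<lambda>j. T1 *v x j) \<in> lp_space p"
      "\<And>x. x \<in> lp_space p \<Longrightarrow> lp_norm p (\<lambda>j. T1 *v x j) \<le> D * lp_norm p x"
    using lp_bounded_op_matrix[OF p, of T1] unfolding lp_bounded_op_def by blast
  have T: "T_op T0 T1 x = (\<lambda>j. T0 *v x j + T1 *v right_shift x j)" for x
    by (simp add: T_op_def right_shift_def)
  have mem: "T_op T0 T1 x \<in> lp_space p" if "x \<in> lp_space p" for x
    unfolding T using that by (intro lp_add p C D) (auto simp: lp_shift)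
  have "lp_norm p (T_op T0 T1 x) \<le> (4 * (C + D)) * lp_norm p x" if x: "x \<in> lp_space p" for x
  proof -
    have x': "right_shift x \<in> lp_space p" using x by (simp add: lp_shift)
    from lp_add(2)[OF p C(1)[OF x] D(1)[OF x']] C(2)[OF x] D(2)[OF x']
    show ?thesis unfolding T by (simp add: lp_shift algebra_simps)
  qed
  moreover have "T_op T0 T1 (\<lambda>j. c *s x j + y j) = (\<lambda>j. c *s T_op T0 T1 x j + T_op T0 T1 y j)" for c x y
    by (simp add: T_op_def matrix_vector_right_distrib vector_scalar_commute algebra_simps
        vector_add_ldistrib)
  ultimately show ?thesis
    using mem unfolding lp_bounded_op_def by blast
qed

end

theory Submission
  imports Defs "HOL-Computational_Algebra.Fundamental_Theorem_Algebra"
begin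

text \<open>Since \<open>T1 T0\<^sup>j T1\<close> is a multiple of \<open>T1\<close>, expanding \<open>T\<^sup>n = (T0 + S T1)\<^sup>n\<close> gives a scalar renewal
  equation whose solution has the negative binomial weights of the \<open>k l\<close>-th success as coefficients of
  \<open>S\<^sup>l\<close>. The binomial distribution has total mass 1 and total variation \<open>O(n\<^sup>-\<^sup>1\<^sup>/\<^sup>2)\<close>, hence
  \<open>T\<close> is power bounded and \<open>T\<^sup>n (1 - T) = O(n\<^sup>-\<^sup>1\<^sup>/\<^sup>2)\<close>. The identity \<open>M (1 - T) = (1 - S) T1\<close>, together
  with the fact that \<open>1 - T\<close> is onto the kernel of \<open>M\<close>, translates mean ergodicity of \<open>S\<close> on \<open>M x\<close>
  into convergence of \<open>T\<^sup>n x\<close> and back. Optimality comes from truncated eigenvectors for eigenvalues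
  \<open>1 - \<alpha> + \<alpha> w\<close> with \<open>w\<close> on the unit circle at distance \<open>n\<^sup>-\<^sup>1\<^sup>/\<^sup>2\<close> from 1, and a gliding hump.\<close>

subsection \<open>Sequence spaces\<close>

text \<open>The exponent 1/2 has one source in both directions. The circle
  \<open>1 - \<alpha> + \<alpha> w\<close>, \<open>cmod w = 1\<close>, touches the unit circle only
  at 1 and to second order, so its points at distance of order \<open>n^(-1/2)\<close> from 1 still
  have \<open>n\<close>-th powers bounded away from 0; in the upper bound the same fact appears as a
  variance of order \<open>n\<close>. The multiples of \<open>T1\<close> come from the hypothesis by
  substituting \<open>\<mu> = 1/s\<close> and comparing power series in \<open>s\<close>.
  Convergence and rate rest on one estimate of \<open>T^n x\<close> through means of length
  \<open>N\<close>, where \<open>N\<close> is independent of the time \<open>n\<close>: a fixed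
  large \<open>N\<close> gives the limit, letting \<open>N\<close> tend to infinity gives the rate.
  The increment statement is the limit statement for \<open>x - T x\<close>, so a single
  counterexample, for increments, settles both optimality claims. It must be one vector that defeats
  an arbitrary faster rate, hence a superposition of humps with amplitudes \<open>2^(-i)\<close> in
  disjoint windows, observed at times where the rate has already lost a factor
  \<open>4^(-i)\<close>.\<close>

definition lp_le :: "ennreal \<Rightarrow> (int \<Rightarrow> 'a::real_normed_vector) \<Rightarrow> real \<Rightarrow> bool" where
  "lp_le p x B \<longleftrightarrow> x \<in> lp_space p \<and> lp_norm p x \<le> B"

text \<open>Membership is bundled with the bound because \<open>lp_norm\<close> is meaningless
  outside the carrier, so a bare inequality would carry no information.\<close>

lemma lp_leD:
  assumes "lp_le p x B"
  shows "x \<in> lp_space p" "lp_norm p x \<le> B" "0 \<le> B"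
  using assms lp_norm_nonneg[of x p] by (auto simp: lp_le_def)

lemma lp_le_self: "x \<in> lp_space p \<Longrightarrow> lp_le p x (lp_norm p x)"
  by (simp add: lp_le_def)

lemma lp_le_mono: "lp_le p x B \<Longrightarrow> B \<le> C \<Longrightarrow> lp_le p x C"
  by (auto simp: lp_le_def)

lemma lp_le_dominated:
  fixes x :: "int \<Rightarrow> 'a::real_normed_vector" and y :: "int \<Rightarrow> 'b::real_normed_vector"
  assumes "1 \<le> p" "lp_le p y B" "0 \<le> C" "\<And>j. norm (x j) \<le> C * norm (y j)"
  shows "lp_le p x (C * B)"
  using lp_dominated[OF assms(1) lp_leD(1)[OF assms(2)] assms(3,4)]
    mult_left_mono[OF lp_leD(2)[OF assms(2)] assms(3)]
  by (auto simp: lp_le_def)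

lemma enn2real_ge_1: "1 \<le> p \<Longrightarrow> p \<noteq> \<infinity> \<Longrightarrow> 1 \<le> enn2real p"
  by (metis enn2real_1 enn2real_mono infinity_ennreal_def top.not_eq_extremum)

lemma lp_zero [simp]: "(\<lambda>_. 0) \<in> lp_space p" "lp_norm p (\<lambda>_. 0) = 0"
  by (auto simp: lp_space_def lp_norm_def)

lemma lp_le_zero: "lp_le p (\<lambda>_. 0) 0"
  by (simp add: lp_le_def)

lemma norm_le_lp_norm:
  fixes x :: "int \<Rightarrow> 'a::real_normed_vector"
  assumes p: "1 \<le> p" and x: "x \<in> lp_space p"
  shows "norm (x i) \<le> lp_norm p x"
proof (cases "p = \<infinity>")
  case True
  with x obtain B where "\<And>j. norm (x j) \<le> B" by (auto simp: lp_space_def bounded_iff)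
  then have "norm (x i) \<le> (SUP j. norm (x j))"
    by (intro cSUP_upper) (auto simp: bdd_above_def)
  then show ?thesis using True by (simp add: lp_norm_def)
next
  case False
  define q where "q = enn2real p"
  have q: "q \<ge> 1" unfolding q_def using p False by (rule enn2real_ge_1)
  have s: "(\<lambda>j. norm (x j) powr q) summable_on UNIV"
    using x False by (simp add: lp_space_def q_def)
  have "(\<Sum>j\<in>{i}. norm (x j) powr q) \<le> infsum (\<lambda>j. norm (x j) powr q) UNIV"
    by (rule finite_sum_le_infsum[OF s]) auto
  then have "(norm (x i) powr q) powr (1/q) \<le> infsum (\<lambda>j. norm (x j) powr q) UNIV powr (1/q)"
    using q by (intro powr_mono2) auto
  then show ?thesis using q False by (simp add: lp_norm_def q_def powr_powr)
qed

lemma lp_norm_eq_0D: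
  assumes "1 \<le> p" "x \<in> lp_space p" "lp_norm p x \<le> 0"
  shows "x = (\<lambda>_. 0)"
proof
  show "x i = 0" for i using norm_le_lp_norm[OF assms(1,2), of i] assms(3)
    by (metis norm_le_zero_iff order_trans)
qed

text \<open>Coordinates of a sequence may vanish, so convexity is wanted on the closed half-line;
  with a vanishing endpoint it reduces to \<open>s powr q \<le> s\<close> for \<open>s\<close>
  between 0 and 1.\<close>

lemma convex_on_powr_nonneg:
  assumes q: "1 \<le> q"
  shows "convex_on {0..} (\<lambda>x::real. x powr q)"
proof (rule convex_onI)
  fix t x y :: real
  assume t: "0 < t" "t < 1" and xy: "x \<in> {0..}" "y \<in> {0..}"
  have scale: "(s * z) powr q \<le> s * z powr q" if "0 < s" "s < 1" "0 \<le> z" for s z :: real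
  proof -
    have "s powr q \<le> s powr 1" using that q by (intro powr_mono') auto
    then show ?thesis using that by (simp add: powr_mult mult_right_mono)
  qed
  show "((1 - t) *\<^sub>R x + t *\<^sub>R y) powr q \<le> (1 - t) * x powr q + t * y powr q"
  proof (cases "x = 0 \<or> y = 0")
    case True
    then show ?thesis using scale[of t y] scale[of "1 - t" x] t xy q by auto
  next
    case False
    then show ?thesis using convex_onD[OF powr_convex[OF q], of t x y] t xy by auto
  qed
qed simp

text \<open>Minkowski's inequality. The constant 1 matters because sums of \<open>n\<close> terms
  are estimated by iteration, where any larger constant would compound. Both sequences are
  normalised, and convexity of the power is applied with weights \<open>A / (A + B)\<close> and
  \<open>B / (A + B)\<close>.\<close>

lemma lp_triangle:
  fixes x y :: "int \<Rightarrow> 'a::real_normed_vector"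
  assumes p: "1 \<le> p" and x: "x \<in> lp_space p" and y: "y \<in> lp_space p"
  shows "lp_norm p (\<lambda>j. x j + y j) \<le> lp_norm p x + lp_norm p y"
proof (cases "p = \<infinity>")
  case True
  have "norm (x j + y j) \<le> lp_norm p x + lp_norm p y" for j
    using norm_le_lp_norm[OF p x, of j] norm_le_lp_norm[OF p y, of j]
      norm_triangle_ineq[of "x j" "y j"] by linarith
  then show ?thesis using True unfolding lp_norm_def[of p "\<lambda>j. x j + y j"]
    by (auto intro!: cSUP_least)
next
  case False
  define q where "q = enn2real p"
  have q: "q \<ge> 1" unfolding q_def using p False by (rule enn2real_ge_1)
  define A B where "A = lp_norm p x" and "B = lp_norm p y"
  have A0: "A \<ge> 0" and B0: "B \<ge> 0" using lp_norm_nonneg x y by (auto simp: A_def B_def)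
  show ?thesis
  proof (cases "A = 0 \<or> B = 0")
    case True
    then have "x = (\<lambda>_. 0) \<or> y = (\<lambda>_. 0)"
      using lp_norm_eq_0D[OF p x] lp_norm_eq_0D[OF p y] by (auto simp: A_def B_def)
    then show ?thesis using lp_norm_nonneg x y by auto
  next
    case AB: False
    with A0 B0 have A: "A > 0" and B: "B > 0" by auto
    define a b where "a = (\<lambda>j. norm (x j) powr q)" and "b = (\<lambda>j. norm (y j) powr q)"
    have sa: "a summable_on UNIV" and sb: "b summable_on UNIV"
      using x y False by (simp_all add: lp_space_def q_def a_def b_def)
    have Ia: "infsum a UNIV = A powr q" and Ib: "infsum b UNIV = B powr q"
      using False q
      by (simp_all add: lp_norm_def a_def b_def powr_powr infsum_nonneg A_def B_def flip: q_def)
    \<comment> \<open>After summation these factors meet \<open>A powr q\<close> and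
      \<open>B powr q\<close>, leaving \<open>(A + B) powr q\<close> times weights that add up to
      1.\<close>
    define l m where "l = A / (A + B) * (A + B) powr q / A powr q"
      and "m = B / (A + B) * (A + B) powr q / B powr q"
    have pw: "norm (x j + y j) powr q \<le> l * a j + m * b j" for j
    proof -
      have lm: "A / (A + B) + B / (A + B) = 1" using A B by (simp add: add_divide_distrib [symmetric])
      then have lm': "1 - B / (A + B) = A / (A + B)" by (simp add: diff_eq_eq)
      have "norm (x j + y j) \<le> norm (x j) + norm (y j)" by (rule norm_triangle_ineq)
      also have "\<dots> = (A + B) * (A / (A + B) * (norm (x j) / A) + B / (A + B) * (norm (y j) / B))"
        using A B add_pos_pos[OF A B] by (simp add: distrib_left)
      finally have "norm (x j + y j) powr q
          \<le> ((A + B) * (A / (A + B) * (norm (x j) / A) + B / (A + B) * (norm (y j) / B))) powr q"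
        using q by (intro powr_mono2) auto
      also have "\<dots> = (A + B) powr q *
          (A / (A + B) * (norm (x j) / A) + B / (A + B) * (norm (y j) / B)) powr q"
        using A B by (intro powr_mult) 
      also have "\<dots> \<le> (A + B) powr q *
          (A / (A + B) * (norm (x j) / A) powr q + B / (A + B) * (norm (y j) / B) powr q)"
      proof (rule mult_left_mono)
        show "(A / (A + B) * (norm (x j) / A) + B / (A + B) * (norm (y j) / B)) powr q
          \<le> A / (A + B) * (norm (x j) / A) powr q + B / (A + B) * (norm (y j) / B) powr q"
          using convex_onD[OF convex_on_powr_nonneg[OF q], of "B / (A + B)" "norm (x j) / A" "norm (y j) / B"]
            A B lm' by simp
      qed simp
      also have "\<dots> = l * a j + m * b j"
        using A B by (simp add: l_def m_def a_def b_def powr_divide field_simps)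
      finally show ?thesis .
    qed
    have sab: "(\<lambda>j. l * a j + m * b j) summable_on UNIV"
      using sa sb by (intro summable_on_cmult_right summable_on_add)
    have s: "(\<lambda>j. norm (x j + y j) powr q) summable_on UNIV"
      by (rule summable_on_comparison_test[OF sab]) (use pw in auto)
    have "infsum (\<lambda>j. norm (x j + y j) powr q) UNIV \<le> infsum (\<lambda>j. l * a j + m * b j) UNIV"
      by (rule infsum_mono[OF s sab]) (use pw in auto)
    also have "\<dots> = l * A powr q + m * B powr q"
      using sa sb by (simp add: infsum_cmult_right infsum_add summable_on_cmult_right Ia Ib)
    also have "\<dots> = (A + B) powr q"
    proof -
      have "l * A powr q + m * B powr q = (A / (A + B) + B / (A + B)) * (A + B) powr q"
        using nonzero_eq_divide_eq[THEN iffD1, OF _ l_def] nonzero_eq_divide_eq[THEN iffD1, OF _ m_def] A B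
        by (simp only: distrib_right powr_eq_0_iff)
      then show ?thesis using A B by (simp add: add_divide_distrib [symmetric])
    qed
    finally have "infsum (\<lambda>j. norm (x j + y j) powr q) UNIV powr (1/q) \<le> ((A + B) powr q) powr (1/q)"
      using q by (intro powr_mono2) (auto intro: infsum_nonneg)
    also have "\<dots> = A + B" using q A B by (simp add: powr_powr)
    finally show ?thesis using False by (simp add: lp_norm_def[of p "\<lambda>j. x j + y j"] q_def A_def B_def)
  qed
qed

section \<open>Norm bounds for sums, multiples, translates and limits of sequences\<close>

lemma lp_le_add: "1 \<le> p \<Longrightarrow> lp_le p x B \<Longrightarrow> lp_le p y C \<Longrightarrow> lp_le p (\<lambda>j. x j + y j) (B + C)"
  using lp_triangle[of p x y] lp_add(1)[of p x y] by (auto simp: lp_le_def)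

lemma lp_le_uminus:
  fixes x :: "int \<Rightarrow> 'a::real_normed_vector"
  shows "1 \<le> p \<Longrightarrow> lp_le p x B \<Longrightarrow> lp_le p (\<lambda>j. - x j) B"
  using lp_le_dominated[of p x B 1 "\<lambda>j. - x j"] by auto

lemma lp_le_diff: "1 \<le> p \<Longrightarrow> lp_le p x B \<Longrightarrow> lp_le p y C \<Longrightarrow> lp_le p (\<lambda>j. x j - y j) (B + C)"
  using lp_le_add[of p x B "\<lambda>j. - y j" C] lp_le_uminus[of p y C] by auto

lemma lp_le_sum:
  assumes p: "1 \<le> p" and "\<And>i. i \<in> I \<Longrightarrow> lp_le p (f i) (B i)"
  shows "lp_le p (\<lambda>j. \<Sum>i\<in>I. f i j) (\<Sum>i\<in>I. B i)"
  using assms(2)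
  by (induction I rule: infinite_finite_induct) (auto simp: lp_le_zero intro: lp_le_add[OF p])

lemma lp_le_scaleR:
  fixes x :: "int \<Rightarrow> 'a::real_normed_vector"
  shows "1 \<le> p \<Longrightarrow> lp_le p x B \<Longrightarrow> lp_le p (\<lambda>j. c *\<^sub>R x j) (\<bar>c\<bar> * B)"
  by (rule lp_le_dominated) auto

lemma lp_le_shift: "lp_le p x B \<Longrightarrow> lp_le p (\<lambda>j. x (j - 1)) B"
  using lp_shift[where x = x and p = p] by (simp add: lp_le_def right_shift_def)

lemma right_shift_funpow: "(right_shift ^^ n) x = (\<lambda>j. x (j - int n))"
  by (induction n) (auto simp: right_shift_def algebra_simps)

lemma lp_le_shift_n: "lp_le p x B \<Longrightarrow> lp_le p (\<lambda>j. x (j - int n)) B"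
proof (induction n)
  case (Suc n)
  from lp_le_shift[OF Suc.IH[OF Suc.prems]] show ?case by (simp add: algebra_simps)
qed simp

lemma lp_shift_int:
  shows "(\<lambda>j. x (j - a)) \<in> lp_space p \<longleftrightarrow> x \<in> lp_space p"
    and "lp_norm p (\<lambda>j. x (j - a)) = lp_norm p x"
proof -
  have nat: "((\<lambda>j. x (j - int n)) \<in> lp_space p \<longleftrightarrow> x \<in> lp_space p)
      \<and> lp_norm p (\<lambda>j. x (j - int n)) = lp_norm p x" for n and x :: "int \<Rightarrow> 'a"
  proof (induction n)
    case (Suc n)
    show ?case using lp_shift[where x = "\<lambda>j. x (j - int n)" and p = p] Suc
      by (simp add: right_shift_def algebra_simps)
  qed simp
  have "((\<lambda>j. x (j - a)) \<in> lp_space p \<longleftrightarrow> x \<in> lp_space p)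
      \<and> lp_norm p (\<lambda>j. x (j - a)) = lp_norm p x"
  proof (cases a)
    case (nonneg n)
    then show ?thesis using nat[of x n] by simp
  next
    case (neg n)
    then show ?thesis using nat[of "\<lambda>j. x (j - a)" "Suc n"] by (simp add: algebra_simps)
  qed
  then show "(\<lambda>j. x (j - a)) \<in> lp_space p \<longleftrightarrow> x \<in> lp_space p"
    and "lp_norm p (\<lambda>j. x (j - a)) = lp_norm p x" by auto
qed

text \<open>Fatou's lemma for sequences: pointwise limits pass through finite partial sums, and
  bounds on these control the whole series. It plays the part of completeness when the
  counterexample is built as an infinite series.\<close>

lemma lp_le_pointwise_limit:
  fixes x :: "int \<Rightarrow> 'a::real_normed_vector"
  assumes p: "1 \<le> p" and X: "\<And>n. lp_le p (X n) B" and lim: "\<And>j. (\<lambda>n. X n j) \<longlonglongrightarrow> x j"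
  shows "lp_le p x B"
proof (cases "p = \<infinity>")
  case True
  have b: "norm (x j) \<le> B" for j
  proof (rule tendsto_upperbound[OF tendsto_norm[OF lim]])
    show "\<forall>\<^sub>F n in sequentially. norm (X n j) \<le> B"
      using norm_le_lp_norm[OF p lp_leD(1)[OF X]] lp_leD(2)[OF X] order_trans by (intro always_eventually) blast
  qed simp
  then show ?thesis using True unfolding lp_le_def lp_space_def lp_norm_def
    by (auto simp: bounded_iff intro!: cSUP_least)
next
  case False
  define q where "q = enn2real p"
  have q: "q \<ge> 1" unfolding q_def using p False by (rule enn2real_ge_1)
  have B0: "B \<ge> 0" using lp_leD(3)[OF X[of 0]] .
  have X': "(\<Sum>j\<in>F. norm (X n j) powr q) \<le> B powr q" if "finite F" for F n
  proof -
    have s: "(\<lambda>j. norm (X n j) powr q) summable_on UNIV"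
      using lp_leD(1)[OF X[of n]] False by (simp add: lp_space_def q_def)
    have "(\<Sum>j\<in>F. norm (X n j) powr q) \<le> infsum (\<lambda>j. norm (X n j) powr q) UNIV"
      by (rule finite_sum_le_infsum[OF s that]) auto
    also have "\<dots> = lp_norm p (X n) powr q"
      using False q by (simp add: lp_norm_def powr_powr infsum_nonneg flip: q_def)
    also have "\<dots> \<le> B powr q"
      using lp_leD(2)[OF X] lp_norm_nonneg[OF lp_leD(1)[OF X]] q by (intro powr_mono2) auto
    finally show ?thesis .
  qed
  have F: "(\<Sum>j\<in>F. norm (x j) powr q) \<le> B powr q" if "finite F" for F
  proof (rule tendsto_upperbound)
    show "(\<lambda>n. \<Sum>j\<in>F. norm (X n j) powr q) \<longlonglongrightarrow> (\<Sum>j\<in>F. norm (x j) powr q)"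
      using q by (intro tendsto_sum tendsto_powr' tendsto_norm lim tendsto_const) auto
  qed (use X'[OF that] in auto)
  have s: "(\<lambda>j. norm (x j) powr q) summable_on UNIV"
    by (rule nonneg_bounded_partial_sums_imp_summable_on[where C = "B powr q"])
       (auto intro!: eventually_finite_subsets_at_top_weakI F)
  have "infsum (\<lambda>j. norm (x j) powr q) UNIV \<le> B powr q"
    by (rule infsum_le_finite_sums[OF s]) (use F in auto)
  then have "infsum (\<lambda>j. norm (x j) powr q) UNIV powr (1/q) \<le> (B powr q) powr (1/q)"
    using q by (intro powr_mono2) (auto intro: infsum_nonneg)
  then show ?thesis using False s q B0 by (simp add: lp_le_def lp_space_def lp_norm_def q_def powr_powr)
qed

subsection \<open>Negative binomial weights\<close>

text \<open>The probability that the \<open>n\<close>-th of a sequence of independent trials with success probability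
  \<open>a\<close> is the \<open>j\<close>-th success (the value 1 at \<open>n = j = 0\<close> makes this a convolution semigroup
  in \<open>j\<close>).\<close>

fun hit :: "real \<Rightarrow> nat \<Rightarrow> nat \<Rightarrow> real" where
  "hit a 0 j = (if j = 0 then 1 else 0)"
| "hit a (Suc n) 0 = 0"
| "hit a (Suc n) (Suc j) = a * hit a n j + (1 - a) * hit a n (Suc j)"

lemma hit_nonneg: "0 \<le> a \<Longrightarrow> a \<le> 1 \<Longrightarrow> 0 \<le> hit a n j"
  by (induction a n j rule: hit.induct) auto

lemma hit_eq_0: "n < j \<Longrightarrow> hit a n j = 0"
  by (induction a n j rule: hit.induct) auto

lemma sum_hit_le_1:
  assumes "0 \<le> a" "a \<le> 1"
  shows "(\<Sum>j\<le>m. hit a n j) \<le> 1"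
proof (induction n arbitrary: m)
  case (Suc n)
  show ?case
  proof (cases m)
    case (Suc m')
    have "(\<Sum>j\<le>m. hit a (Suc n) j) = a * (\<Sum>j\<le>m'. hit a n j) + (1 - a) * (\<Sum>j\<le>m'. hit a n (Suc j))"
      unfolding Suc sum.atMost_Suc_shift by (simp add: sum.distrib sum_distrib_left)
    also have "(\<Sum>j\<le>m'. hit a n (Suc j)) \<le> (\<Sum>j\<le>Suc m'. hit a n j)"
      unfolding sum.atMost_Suc_shift using hit_nonneg[OF assms] by simp
    also have "\<dots> \<le> 1" by (rule Suc.IH)
    finally have "(\<Sum>j\<le>m. hit a (Suc n) j) \<le> a * (\<Sum>j\<le>m'. hit a n j) + (1 - a) * 1"
      using assms by (simp add: mult_left_mono)
    also have "\<dots> \<le> a * 1 + (1 - a) * 1"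
      using assms Suc.IH[of m'] by (intro add_right_mono mult_left_mono) auto
    finally show ?thesis by simp
  qed simp
qed (simp add: sum.delta)

text \<open>Generating function of the waiting time for the first success. At
  \<open>s = 1/\<mu>\<close> its \<open>k\<close>-th power is the characteristic function
  \<open>\<alpha>^k / (\<mu> - 1 + \<alpha>)^k\<close>.\<close>

definition hit_fps :: "real \<Rightarrow> complex fps" where
  "hit_fps a = fps_const (of_real a) * fps_X * inverse (1 - fps_const (of_real (1 - a)) * fps_X)"

lemma hit_fps_rec: "hit_fps a = fps_X * (fps_const (of_real a) + fps_const (of_real (1 - a)) * hit_fps a)"
proof -
  define G :: "complex fps" where "G = 1 - fps_const (of_real (1 - a)) * fps_X"
  have "inverse G * G = 1" by (rule inverse_mult_eq_1) (simp add: G_def)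
  then have "hit_fps a * G = fps_const (of_real a) * fps_X"
    unfolding hit_fps_def G_def[symmetric] mult.assoc by simp
  then show ?thesis by (simp add: G_def algebra_simps)
qed

text \<open>The recursion of \<open>hit\<close> conditions on the outcome of the first trial; for
  generating functions this is \<open>hit_fps_rec\<close>.\<close>

lemma hit_fps_nth: "fps_nth (hit_fps a ^ j) n = of_real (hit a n j)"
proof (induction a n j rule: hit.induct)
  case (1 a j)
  have "fps_nth (hit_fps a) 0 = 0" by (subst hit_fps_rec) simp
  then show ?case by (simp add: fps_power_zeroth power_0_left)
next
  case (3 a n j)
  have "hit_fps a ^ Suc j = fps_X * (fps_const (of_real a) * hit_fps a ^ j
      + fps_const (of_real (1 - a)) * hit_fps a ^ Suc j)"
    by (subst (1) power_Suc, subst (1) hit_fps_rec) (simp add: algebra_simps)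
  then have "fps_nth (hit_fps a ^ Suc j) (Suc n) = fps_nth (fps_X * (fps_const (of_real a) * hit_fps a ^ j
      + fps_const (of_real (1 - a)) * hit_fps a ^ Suc j)) (Suc n)"
    by (rule arg_cong)
  also have "\<dots> = of_real a * fps_nth (hit_fps a ^ j) n + of_real (1 - a) * fps_nth (hit_fps a ^ Suc j) n"
    by (simp del: power_Suc of_real_diff)
  finally show ?case using 3 by simp
qed simp

text \<open>Independence of successive waiting times: powers of the generating function
  multiply.\<close>

lemma hit_add: "hit a n (j + l) = (\<Sum>i\<le>n. hit a i j * hit a (n - i) l)"
proof -
  have "complex_of_real (hit a n (j + l)) = fps_nth (hit_fps a ^ j * hit_fps a ^ l) n"
    by (simp only: hit_fps_nth flip: power_add)
  also have "\<dots> = complex_of_real (\<Sum>i\<le>n. hit a i j * hit a (n - i) l)"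
    by (simp add: fps_mult_nth hit_fps_nth atLeast0AtMost)
  finally show ?thesis using of_real_eq_iff by blast
qed

section \<open>Binomial probabilities: deviation from the mean and total variation\<close>

lemma Bernstein_Suc_Suc:
  "Bernstein (Suc n) (Suc j) a = a * Bernstein n j a + (1 - a) * Bernstein n (Suc j) a"
proof (cases "j < n")
  case True
  then obtain d where "n = Suc (j + d)" using less_imp_Suc_add by blast
  then show ?thesis by (simp add: Bernstein_def algebra_simps)
next
  case False
  then show ?thesis by (auto simp: Bernstein_def not_less le_less binomial_eq_0)
qed

text \<open>The last trial must be a success, and the \<open>n\<close> trials before it contain
  exactly \<open>j\<close> successes.\<close>

lemma hit_Suc_Suc: "hit a (Suc n) (Suc j) = a * Bernstein n j a"
proof (induction n arbitrary: j)
  case 0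
  then show ?case by (simp add: Bernstein_def binomial_eq_0)
next
  case (Suc n)
  show ?case
  proof (cases j)
    case 0
    have "hit a (Suc (Suc n)) (Suc 0) = (1 - a) * hit a (Suc n) (Suc 0)" by simp
    also have "\<dots> = a * Bernstein (Suc n) 0 a"
      unfolding Suc.IH by (simp add: Bernstein_def)
    finally show ?thesis using 0 by simp
  next
    case (Suc i)
    have "hit a (Suc (Suc n)) (Suc (Suc i)) = a * hit a (Suc n) (Suc i) + (1 - a) * hit a (Suc n) (Suc (Suc i))"
      by (rule hit.simps)
    then show ?thesis
      unfolding Suc Bernstein_Suc_Suc Suc.IH by (simp add: algebra_simps)
  qed
qed

lemma Bernstein_absorb:
  "real (Suc n) * (1 - a) * Bernstein n j a = (real (Suc n) - real j) * Bernstein (Suc n) j a"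
proof (cases "j \<le> n")
  case True
  have "(Suc n - j) * (Suc n choose j) = Suc n * (n choose j)"
    using binomial_absorb_comp[of "Suc n" j] by simp
  then have "real (Suc n - j) * real (Suc n choose j) = real (Suc n) * real (n choose j)"
    by (metis of_nat_mult)
  moreover have "(1 - a) ^ (Suc n - j) = (1 - a) * (1 - a) ^ (n - j)"
    using True by (simp add: Suc_diff_le)
  ultimately have "(real (Suc n) * real (n choose j)) * a ^ j * ((1 - a) * (1 - a) ^ (n - j))
      = (real (Suc n - j) * real (Suc n choose j)) * a ^ j * (1 - a) ^ (Suc n - j)"
    by (simp only:)
  then have "real (Suc n) * (1 - a) * Bernstein n j a
      = real (Suc n - j) * (real (Suc n choose j) * a ^ j * (1 - a) ^ (Suc n - j))"
    by (simp only: Bernstein_def mult_ac)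
  then show ?thesis using True by (simp add: Bernstein_def of_nat_diff)
next
  case False
  then show ?thesis by (cases "j = Suc n") (simp_all add: Bernstein_def binomial_eq_0)
qed

text \<open>A difference in the number of trials becomes a multiple of the deviation from the mean,
  so that the total variation turns into a first absolute moment.\<close>

lemma Bernstein_diff:
  "real (Suc n) * (1 - a) * (Bernstein (Suc n) j a - Bernstein n j a)
     = (real j - real (Suc n) * a) * Bernstein (Suc n) j a"
  using Bernstein_absorb[of n a j] by (simp only: right_diff_distrib) (simp add: algebra_simps)

lemma Bernstein_variance:
  "(\<Sum>j\<le>n. (real j - real n * a)\<^sup>2 * Bernstein n j a) = real n * a * (1 - a)"
proof -
  have "(\<Sum>j\<le>n. (real j - real n * a)\<^sup>2 * Bernstein n j a)
    = (\<Sum>j\<le>n. real j * (real j - 1) * Bernstein n j a + (1 - 2 * (real n * a)) * (real j * Bernstein n j a)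
        + (real n * a)\<^sup>2 * Bernstein n j a)"
    by (intro sum.cong) (auto simp: power2_eq_square algebra_simps)
  also have "\<dots> = real n * a * (1 - a)"
    by (simp add: sum.distrib flip: sum_distrib_left) (simp add: power2_eq_square algebra_simps)
  finally show ?thesis .
qed

lemma Bernstein_mean_deviation:
  assumes a: "0 \<le> a" "a \<le> 1" and n: "0 < n"
  shows "(\<Sum>j\<le>n. \<bar>real j - real n * a\<bar> * Bernstein n j a) \<le> sqrt (real n)"
proof -
  have s: "sqrt (real n) > 0" using n by simp
  \<comment> \<open>Constants of the inequality \<open>2 d sqrt n \<le> d^2 + n\<close>. It balances
    a variance of at most \<open>n\<close> against a total mass of 1, so each of the two parts
    contributes at most \<open>sqrt n / 2\<close>.\<close>
  define c e where "c = 1 / (2 * sqrt (real n))" and "e = sqrt (real n) / 2"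
  have "\<bar>d\<bar> \<le> c * d\<^sup>2 + e" for d :: real
  proof -
    have "0 \<le> (\<bar>d\<bar> - sqrt (real n))\<^sup>2" by simp
    then have "2 * \<bar>d\<bar> * sqrt (real n) \<le> d\<^sup>2 + (sqrt (real n))\<^sup>2"
      by (simp add: power2_diff)
    then show ?thesis using s by (simp add: c_def e_def field_simps power2_eq_square)
  qed
  then have "(\<Sum>j\<le>n. \<bar>real j - real n * a\<bar> * Bernstein n j a)
      \<le> (\<Sum>j\<le>n. (c * (real j - real n * a)\<^sup>2 + e) * Bernstein n j a)"
    by (intro sum_mono mult_right_mono Bernstein_nonneg a)
  also have "\<dots> = c * (\<Sum>j\<le>n. (real j - real n * a)\<^sup>2 * Bernstein n j a)
      + e * (\<Sum>j\<le>n. Bernstein n j a)"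
    by (simp only: distrib_right sum.distrib sum_distrib_left mult.assoc)
  also have "\<dots> = c * real n * (a * (1 - a)) + e"
    by (simp add: Bernstein_variance)
  also have "\<dots> \<le> c * real n * 1 + e"
    using a s mult_mono[of a 1 "1 - a" 1] by (intro add_right_mono mult_left_mono) (auto simp: c_def)
  also have "c * real n = sqrt (real n) / 2"
    using s real_sqrt_mult_self[of "real n"] by (simp add: c_def field_simps)
  finally show ?thesis by (simp add: e_def)
qed

lemma Bernstein_variation:
  assumes a: "0 \<le> a" "a < 1"
  shows "(\<Sum>j\<le>m. \<bar>Bernstein (Suc n) j a - Bernstein n j a\<bar>) \<le> 1 / ((1 - a) * sqrt (real (Suc n)))"
proof -
  let ?N = "real (Suc n)"
  have pos: "?N * (1 - a) > 0" using a by simp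
  have eq: "\<bar>Bernstein (Suc n) j a - Bernstein n j a\<bar> = \<bar>real j - ?N * a\<bar> * Bernstein (Suc n) j a / (?N * (1 - a))" for j
  proof -
    have "?N * (1 - a) * \<bar>Bernstein (Suc n) j a - Bernstein n j a\<bar> = \<bar>real j - ?N * a\<bar> * Bernstein (Suc n) j a"
      using arg_cong[OF Bernstein_diff[of n a j], of abs] pos Bernstein_nonneg[of a "Suc n" j] a
      by (simp add: abs_mult del: of_nat_Suc)
    then show ?thesis using pos by (simp add: field_simps del: of_nat_Suc)
  qed
  have "(\<Sum>j\<le>m. \<bar>Bernstein (Suc n) j a - Bernstein n j a\<bar>)
      \<le> (\<Sum>j\<le>max m (Suc n). \<bar>Bernstein (Suc n) j a - Bernstein n j a\<bar>)"
    by (intro sum_mono2) auto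
  also have "\<dots> = (\<Sum>j\<le>Suc n. \<bar>Bernstein (Suc n) j a - Bernstein n j a\<bar>)"
    by (intro sum.mono_neutral_right) (auto simp: Bernstein_def binomial_eq_0)
  also have "\<dots> = (\<Sum>j\<le>Suc n. \<bar>real j - ?N * a\<bar> * Bernstein (Suc n) j a) / (?N * (1 - a))"
    unfolding eq sum_divide_distrib ..
  also have "\<dots> \<le> sqrt ?N / (?N * (1 - a))"
    using a pos by (intro divide_right_mono Bernstein_mean_deviation) auto
  also have "\<dots> = 1 / ((1 - a) * sqrt ?N)"
    using a real_sqrt_mult_self[of ?N] by (simp add: divide_simps)
  finally show ?thesis .
qed

text \<open>Fixing the last trial leaves a binomial law with one trial fewer, so the bound arrives
  with its index lowered by one. The factor 2 absorbs this; for \<open>n = 0\<close> the total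
  masses suffice.\<close>

lemma hit_variation:
  assumes a: "0 \<le> a" "a < 1"
  shows "(\<Sum>j\<le>m. \<bar>hit a (Suc n) j - hit a n j\<bar>) \<le> 2 / (1 - a) / sqrt (real (Suc n))"
proof (cases n)
  case 0
  have "(\<Sum>j\<le>m. \<bar>hit a (Suc n) j - hit a n j\<bar>) \<le> (\<Sum>j\<le>m. hit a (Suc n) j + hit a n j)"
    using hit_nonneg[of a] a by (intro sum_mono) (auto intro!: abs_leI simp: add_nonneg_nonneg)
  also have "\<dots> \<le> 2" using sum_hit_le_1[of a "Suc n" m] sum_hit_le_1[of a n m] a by (simp add: sum.distrib)
  also have "\<dots> \<le> 2 / (1 - a)" using a by (simp add: field_simps)
  finally show ?thesis using 0 by simp
next
  case (Suc n')
  have "(\<Sum>j\<le>m. \<bar>hit a (Suc n) j - hit a n j\<bar>) \<le> (\<Sum>j\<le>Suc m. \<bar>hit a (Suc n) j - hit a n j\<bar>)"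
    by simp
  also have "\<dots> = (\<Sum>j\<le>m. a * \<bar>Bernstein (Suc n') j a - Bernstein n' j a\<bar>)"
    unfolding sum.atMost_Suc_shift Suc hit_Suc_Suc using a
    by (simp add: abs_mult flip: right_diff_distrib)
  also have "\<dots> \<le> (\<Sum>j\<le>m. 1 * \<bar>Bernstein (Suc n') j a - Bernstein n' j a\<bar>)"
    using a by (intro sum_mono mult_right_mono) auto
  also have "\<dots> \<le> 1 / ((1 - a) * sqrt (real (Suc n')))"
    using Bernstein_variation[OF a] by simp
  also have "\<dots> \<le> 2 / (1 - a) / sqrt (real (Suc n))"
  proof -
    have "sqrt (real (Suc n)) \<le> sqrt (4 * real (Suc n'))" using Suc by (intro real_sqrt_le_mono) auto
    also have "\<dots> = 2 * sqrt (real (Suc n'))" by (simp add: real_sqrt_mult del: of_nat_Suc)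
    finally have "1 / sqrt (real (Suc n')) \<le> 2 / sqrt (real (Suc n))"
      by (simp add: field_simps del: of_nat_Suc)
    from mult_left_mono[OF this, of "1 / (1 - a)"] show ?thesis using a by simp
  qed
  finally show ?thesis .
qed

subsection \<open>Powers of a matrix\<close>

lemma norm_cvec_mult: "norm (c *s (v :: complex^'m)) = cmod c * norm v"
  by (simp add: norm_vec_def norm_mult L2_set_right_distrib)

lemma bounded_linear_cmatrix: "bounded_linear ((*v) (A :: complex^'m^'m))"
  by (simp add: linear_conv_bounded_linear [symmetric])

lemma cmatrix_scaleR: "(A :: complex^'m^'m) *v (c *\<^sub>R v) = c *\<^sub>R (A *v v)"
  by (rule linear_scale) simp

lemmas cmatrix_simps = matrix_vector_right_distrib matrix_vector_mult_diff_distrib cmatrix_scaleR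
  vec.scale vec.neg vec.sum

lemma cmatrix_mat: "mat c *v (v :: complex^'m) = c *s v"
  by (simp add: mat_def matrix_vector_mult_def vec_eq_iff if_distrib if_distribR cong: if_cong)

lemma matrix_inv_inverse:
  fixes A :: "complex^'m^'m"
  assumes "invertible A"
  shows "A ** matrix_inv A = mat 1" "matrix_inv A ** A = mat 1"
proof -
  have "A ** matrix_inv A = mat 1 \<and> matrix_inv A ** A = mat 1"
    unfolding matrix_inv_def using assms unfolding invertible_def by (rule someI_ex)
  then show "A ** matrix_inv A = mat 1" "matrix_inv A ** A = mat 1" by auto
qed

lemma resolvent_right:
  assumes "\<mu> \<notin> mat_spectrum A"
  shows "\<mu> *s (resolvent \<mu> A *v v) - A *v (resolvent \<mu> A *v v) = v"
proof -
  have "(mat \<mu> - A) ** resolvent \<mu> A = mat 1"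
    using assms unfolding mat_spectrum_def resolvent_def by (simp add: matrix_inv_inverse(1))
  then have "(mat \<mu> - A) *v (resolvent \<mu> A *v v) = v"
    by (simp add: matrix_vector_mul_assoc)
  then show ?thesis by (simp add: matrix_vector_mult_diff_rdistrib cmatrix_mat)
qed

lemma resolvent_left:
  assumes "\<mu> \<notin> mat_spectrum A"
  shows "resolvent \<mu> A *v (\<mu> *s v - A *v v) = v"
proof -
  have "resolvent \<mu> A ** (mat \<mu> - A) = mat 1"
    using assms unfolding mat_spectrum_def resolvent_def by (simp add: matrix_inv_inverse(2))
  then have "resolvent \<mu> A *v ((mat \<mu> - A) *v v) = v"
    by (simp add: matrix_vector_mul_assoc)
  then show ?thesis by (simp add: matrix_vector_mult_diff_rdistrib cmatrix_mat)
qed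

lemma resolvent_commute:
  assumes "\<mu> \<notin> mat_spectrum A"
  shows "resolvent \<mu> A *v (A *v v) = A *v (resolvent \<mu> A *v v)"
proof -
  have "A *v (resolvent \<mu> A *v v) = \<mu> *s (resolvent \<mu> A *v v) - v"
    using resolvent_right[OF assms, of v] by (simp add: algebra_simps)
  moreover have "resolvent \<mu> A *v (A *v v) = \<mu> *s (resolvent \<mu> A *v v) - v"
    using resolvent_left[OF assms, of v] by (simp add: cmatrix_simps algebra_simps)
  ultimately show ?thesis by simp
qed

section \<open>Polynomials in a matrix and geometric decay of its powers\<close>

abbreviation mpow :: "complex^'m^'m \<Rightarrow> nat \<Rightarrow> complex^'m \<Rightarrow> complex^'m" where
  "mpow A n \<equiv> ((*v) A) ^^ n"

lemma mpow_Suc2: "mpow A (Suc n) v = mpow A n (A *v v)"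
  by (simp add: funpow_Suc_right del: funpow.simps)

lemma mpow_add: "mpow A n (v + w) = mpow A n v + mpow A n w"
  by (induction n) (simp_all add: cmatrix_simps)

lemma mpow_diff: "mpow A n (v - w) = mpow A n v - mpow A n w"
  by (induction n) (simp_all add: cmatrix_simps)

lemma mpow_scale: "mpow A n (c *s v) = c *s mpow A n v"
  by (induction n) (simp_all add: cmatrix_simps)

lemma mpow_0 [simp]: "mpow A n 0 = 0"
  by (induction n) simp_all

lemma mpow_sum: "mpow A n (\<Sum>i\<in>I. f i) = (\<Sum>i\<in>I. mpow A n (f i))"
  by (induction I rule: infinite_finite_induct) (simp_all add: mpow_add)

text \<open>Horner's scheme for \<open>q(A) v\<close>. Working with one vector at a time suffices,
  since decay is first proved vector by vector.\<close>

definition poly_vec :: "complex^'m^'m \<Rightarrow> complex poly \<Rightarrow> complex^'m \<Rightarrow> complex^'m" where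
  "poly_vec A q v = fold_coeffs (\<lambda>a w. a *s v + A *v w) q 0"

lemma poly_vec_0 [simp]: "poly_vec A 0 v = 0"
  by (simp add: poly_vec_def)

lemma poly_vec_pCons [simp]: "poly_vec A (pCons a q) v = a *s v + A *v poly_vec A q v"
  by (cases "q = 0 \<and> a = 0") (auto simp: poly_vec_def)

lemma poly_vec_add: "poly_vec A (q + r) v = poly_vec A q v + poly_vec A r v"
  by (induction q r rule: poly_induct2) (simp_all add: cmatrix_simps vec.scale_left_distrib algebra_simps)

lemma poly_vec_smult: "poly_vec A (smult c q) v = c *s poly_vec A q v"
  by (induction q) (simp_all add: cmatrix_simps vec.scale_right_distrib)

lemma poly_vec_diff: "poly_vec A q (v - w) = poly_vec A q v - poly_vec A q w"
  by (induction q) (simp_all add: cmatrix_simps vec.scale_right_diff_distrib)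

lemma poly_vec_scale: "poly_vec A q (c *s v) = c *s poly_vec A q v"
  by (induction q) (simp_all add: cmatrix_simps vec.scale_right_distrib mult.commute)

lemma poly_vec_commute: "poly_vec A q (A *v v) = A *v poly_vec A q v"
  by (induction q) (simp_all add: cmatrix_simps)

lemma poly_vec_root_factor: "poly_vec A ([:-z, 1:] * q) v = poly_vec A q (A *v v - z *s v)"
proof -
  have "[:-z, 1:] * q = smult (- z) q + pCons 0 q" by simp
  then show ?thesis
    by (simp add: poly_vec_add poly_vec_smult poly_vec_diff poly_vec_scale poly_vec_commute del: smult_minus_left)
qed

lemma poly_vec_sum: "poly_vec A (\<Sum>i\<in>I. f i) v = (\<Sum>i\<in>I. poly_vec A (f i) v)"
  by (induction I rule: infinite_finite_induct) (simp_all add: poly_vec_add)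

lemma poly_vec_monom: "poly_vec A (monom c n) v = c *s mpow A n v"
  by (induction n) (simp_all add: monom_0 monom_Suc cmatrix_simps)

text \<open>The Krylov vectors \<open>A^i v\<close> with \<open>i\<close> up to the dimension are
  too many to be independent. If two of them coincide they collapse in the image set and dependence
  of that set says nothing; then a difference of two monomials annihilates \<open>v\<close>.\<close>

lemma annihilating_polynomial:
  fixes A :: "complex^'m^'m"
  obtains q where "q \<noteq> 0" "poly_vec A q v = 0"
proof -
  define f where "f = (\<lambda>i. mpow A i v)"
  define N where "N = vec.dim (UNIV :: (complex^'m) set)"
  show thesis
  proof (cases "inj_on f {..N}")
    case True
    have "vec.dependent (f ` {..N})"
    proof (rule vec.dependent_biggerset_general)
      show "finite (f ` {..N}) \<Longrightarrow> card (f ` {..N}) > vec.dim (f ` {..N})"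
        using vec.dim_subset[of "f ` {..N}" UNIV] True
        by (simp add: card_image less_Suc_eq_le) (simp add: N_def)
    qed
    then obtain u where u: "\<exists>w\<in>f ` {..N}. u w \<noteq> 0" "(\<Sum>w\<in>f ` {..N}. u w *s w) = 0"
      by (auto simp: vec.dependent_finite)
    define q where "q = (\<Sum>i\<le>N. monom (u (f i)) i)"
    have co: "coeff q i = u (f i)" if "i \<le> N" for i
      using that by (simp add: q_def coeff_sum if_distrib cong: if_cong)
    have "q \<noteq> 0" using u(1) co by force
    moreover have "poly_vec A q v = 0"
      using u(2) True by (simp add: q_def poly_vec_sum poly_vec_monom sum.reindex f_def)
    ultimately show ?thesis by (rule that)
  next
    case False
    then obtain i j where ij: "i \<noteq> j" "f i = f j" by (auto simp: inj_on_def)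
    have "monom 1 i + monom (- 1) j \<noteq> (0 :: complex poly)"
    proof
      assume "monom 1 i + monom (- 1) j = (0 :: complex poly)"
      then have "coeff (monom 1 i + monom (- 1) j) i = (0 :: complex)" by simp
      then show False using ij by simp
    qed
    moreover have "poly_vec A (monom 1 i + monom (- 1) j) v = 0"
      using ij by (simp add: poly_vec_add poly_vec_monom f_def vec.scale_minus_left)
    ultimately show ?thesis by (rule that)
  qed
qed

text \<open>Stands in for the spectral radius formula. A root \<open>z\<close> of the annihilator is
  split off, and \<open>w = A v - z v\<close> decays by induction. If \<open>z = b\<close>, the
  recursion \<open>A^(n+1) v = A^n w + b A^n v\<close> preserves decay because
  \<open>cmod b < r\<close>. If \<open>z\<close> lies off the spectrum, \<open>v\<close> is
  recovered from \<open>w\<close> by the resolvent at \<open>z\<close>, which commutes with powers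
  of \<open>A\<close>.\<close>

lemma mpow_decay_annihilated:
  fixes A :: "complex^'m^'m"
  assumes spec: "mat_spectrum A = {b}" and b: "cmod b < r"
  shows "q \<noteq> 0 \<Longrightarrow> poly_vec A q v = 0 \<Longrightarrow> \<exists>C. \<forall>n. norm (mpow A n v) \<le> C * r ^ n"
proof (induction "degree q" arbitrary: q v rule: less_induct)
  case less
  have r: "r > 0" using b norm_ge_zero[of b] by linarith
  show ?case
  proof (cases "degree q = 0")
    case True
    then obtain a where "q = [:a:]" by (rule degree_eq_zeroE)
    then have "v = 0" using less.prems by simp
    then show ?thesis by (intro exI[of _ 0]) simp
  next
    case False
    then obtain z where "poly q z = 0"
      using fundamental_theorem_of_algebra[of q] by (auto simp: constant_degree)
    then obtain q' where q': "q = [:-z, 1:] * q'" by (auto simp: poly_eq_0_iff_dvd dvd_def)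
    define w where "w = A *v v - z *s v"
    have nz: "q' \<noteq> 0" using less.prems(1) q' by auto
    have "degree q = Suc (degree q')" using nz unfolding q' by (subst degree_mult_eq) auto
    moreover have "poly_vec A q' w = 0" using less.prems(2) unfolding q' poly_vec_root_factor w_def .
    ultimately obtain C where C: "\<And>n. norm (mpow A n w) \<le> C * r ^ n"
      using less.hyps[of q' w] nz by auto
    have C0: "C \<ge> 0" using order_trans[OF norm_ge_zero C[of 0]] by simp
    show ?thesis
    proof (cases "z = b")
      case True
      \<comment> \<open>Chosen such that \<open>C + cmod b * D \<le> D * r\<close>, which closes the
        recursion.\<close>
      define D where "D = max (norm v) (C / (r - cmod b))"
      have D: "C \<le> D * (r - cmod b)" "norm v \<le> D"
        using b by (simp_all add: D_def pos_divide_le_eq [symmetric])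
      have "norm (mpow A n v) \<le> D * r ^ n" for n
      proof (induction n)
        case (Suc n)
        have "mpow A (Suc n) v = mpow A n w + b *s mpow A n v"
          unfolding mpow_Suc2 w_def True by (simp add: mpow_diff mpow_scale)
        then have "norm (mpow A (Suc n) v) \<le> norm (mpow A n w) + cmod b * norm (mpow A n v)"
          using norm_triangle_ineq[of "mpow A n w" "b *s mpow A n v"] by (simp add: norm_cvec_mult)
        also have "\<dots> \<le> C * r ^ n + cmod b * (D * r ^ n)"
          using C Suc.IH by (intro add_mono mult_left_mono) auto
        also have "\<dots> = (C + cmod b * D) * r ^ n" by (simp add: algebra_simps)
        also have "\<dots> \<le> (D * r) * r ^ n"
          using D r by (intro mult_right_mono) (auto simp: algebra_simps)
        finally show ?case by simp
      qed (use D in simp)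
      then show ?thesis by blast
    next
      case False
      then have z: "z \<notin> mat_spectrum A" using spec by simp
      obtain K where K: "K \<ge> 0" "\<And>v. norm (resolvent z A *v v) \<le> K * norm v"
        using matrix_norm_bound by blast
      have comm: "mpow A n (resolvent z A *v u) = resolvent z A *v mpow A n u" for n u
        by (induction n) (simp_all add: resolvent_commute[OF z])
      have "norm (mpow A n v) \<le> K * C * r ^ n" for n
      proof -
        have "mpow A n v = - (resolvent z A *v mpow A n w)"
          using resolvent_left[OF z, of "mpow A n v"] 
          unfolding w_def by (simp add: mpow_diff mpow_scale cmatrix_simps flip: mpow_Suc2)
        then have "norm (mpow A n v) \<le> K * norm (mpow A n w)" using K(2) by simp
        also have "\<dots> \<le> K * (C * r ^ n)" by (intro mult_left_mono C K)
        finally show ?thesis by simp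
      qed
      then show ?thesis by blast
    qed
  qed
qed

text \<open>Finite dimension makes the constant uniform: it is the sum of the constants of the
  standard basis vectors.\<close>

lemma mpow_decay:
  fixes A :: "complex^'m^'m"
  assumes spec: "mat_spectrum A = {b}" and b: "cmod b < r"
  obtains C where "C \<ge> 0" "\<And>n v. norm (mpow A n v) \<le> C * r ^ n * norm v"
proof -
  have r: "r > 0" using b norm_ge_zero[of b] by linarith
  have "\<exists>C. \<forall>n. norm (mpow A n v) \<le> C * r ^ n" for v
    using annihilating_polynomial[of A v] mpow_decay_annihilated[OF assms] by metis
  then obtain c where c: "\<And>v n. norm (mpow A n v) \<le> c v * r ^ n" by metis
  define C where "C = (\<Sum>i\<in>UNIV. c (axis i 1))"
  have cpos: "c v \<ge> 0" for v using order_trans[OF norm_ge_zero c[of 0 v]] by simp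
  have "norm (mpow A n v) \<le> C * r ^ n * norm v" for n v
  proof -
    have "mpow A n v = (\<Sum>i\<in>UNIV. v $ i *s mpow A n (axis i 1))"
      by (subst basis_expansion[of v, symmetric]) (simp add: mpow_sum mpow_scale)
    then have "norm (mpow A n v) \<le> (\<Sum>i\<in>UNIV. cmod (v $ i) * norm (mpow A n (axis i 1)))"
      using norm_sum[of "\<lambda>i. v $ i *s mpow A n (axis i 1)" UNIV] by (simp add: norm_cvec_mult)
    also have "\<dots> \<le> (\<Sum>i\<in>UNIV. norm v * (c (axis i 1) * r ^ n))"
      using Finite_Cartesian_Product.norm_nth_le[of v] c by (intro sum_mono mult_mono) auto
    also have "\<dots> = C * r ^ n * norm v"
      by (simp add: C_def sum_distrib_left sum_distrib_right mult_ac)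
    finally show ?thesis .
  qed
  moreover have "C \<ge> 0" unfolding C_def by (intro sum_nonneg cpos)
  ultimately show thesis by (rule that[rotated])
qed

text \<open>The Neumann series in the variable \<open>s = 1/\<mu>\<close>, with its exact
  remainder.\<close>

lemma resolvent_partial_sum:
  assumes s: "s \<noteq> 0" and spec: "inverse s \<notin> mat_spectrum A"
  shows "(\<Sum>j<n. s ^ Suc j *s mpow A j u) = resolvent (inverse s) A *v (u - s ^ n *s mpow A n u)"
proof (induction n)
  case (Suc n)
  have "resolvent (inverse s) A *v (u - s ^ Suc n *s mpow A (Suc n) u)
      = resolvent (inverse s) A *v (u - s ^ n *s mpow A n u)
        + resolvent (inverse s) A *v (s ^ n *s mpow A n u - s ^ Suc n *s mpow A (Suc n) u)"
    by (simp add: cmatrix_simps)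
  also have "s ^ n *s mpow A n u - s ^ Suc n *s mpow A (Suc n) u
      = s ^ Suc n *s (inverse s *s mpow A n u - A *v mpow A n u)"
    using s by (simp add: vec.scale_right_diff_distrib)
  also have "resolvent (inverse s) A *v \<dots> = s ^ Suc n *s mpow A n u"
    by (simp only: vec.scale resolvent_left[OF spec])
  finally show ?case by (simp only: Suc.IH sum.lessThan_Suc)
qed simp

lemma resolvent_sums:
  assumes s: "s \<noteq> 0" "cmod s \<le> 1" and spec: "inverse s \<notin> mat_spectrum A"
    and C: "\<And>n v. norm (mpow A n v) \<le> C * r ^ n * norm v" and r: "0 \<le> r" "r < 1" and C0: "C \<ge> 0"
  shows "(\<lambda>j. s ^ Suc j *s mpow A j u) sums (resolvent (inverse s) A *v u)"
proof -
  have "(\<lambda>n. s ^ n *s mpow A n u) \<longlonglongrightarrow> 0"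
  proof (rule Lim_null_comparison)
    show "\<forall>\<^sub>F n in sequentially. norm (s ^ n *s mpow A n u) \<le> C * norm u * r ^ n"
    proof (rule always_eventually, rule allI)
      fix n
      have "cmod s ^ n * norm (mpow A n u) \<le> 1 * norm (mpow A n u)"
        using s by (intro mult_right_mono power_le_one) auto
      then show "norm (s ^ n *s mpow A n u) \<le> C * norm u * r ^ n"
        using C[of n u] by (simp add: norm_cvec_mult norm_power mult_ac)
    qed
    show "(\<lambda>n. C * norm u * r ^ n) \<longlonglongrightarrow> 0"
      using r by (intro tendsto_mult_right_zero LIMSEQ_power_zero) auto
  qed
  then have "(\<lambda>n. u - s ^ n *s mpow A n u) \<longlonglongrightarrow> u - 0"
    by (intro tendsto_diff tendsto_const)
  then have "(\<lambda>n. resolvent (inverse s) A *v (u - s ^ n *s mpow A n u)) \<longlonglongrightarrow> resolvent (inverse s) A *v (u - 0)"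
    by (rule bounded_linear.tendsto[OF bounded_linear_cmatrix])
  then show ?thesis unfolding sums_def resolvent_partial_sum[OF s(1) spec] by simp
qed

subsection \<open>The coupled system\<close>

locale coupled_system =
  fixes p :: ennreal and T0 T1 :: "complex^'m^'m" and \<alpha> :: real and k :: nat
  assumes p: "1 \<le> p"
    and T1_nonzero: "T1 \<noteq> 0"
    and \<alpha>: "0 < \<alpha>" "\<alpha> < 1" and k: "1 \<le> k"
    and spectrum: "mat_spectrum T0 = {1 - complex_of_real \<alpha>}"
    and characteristic: "\<forall>\<mu>. \<mu> \<noteq> 1 - complex_of_real \<alpha> \<longrightarrow>
           T1 ** resolvent \<mu> T0 ** T1
             = mat (complex_of_real \<alpha> ^ k / (\<mu> - 1 + complex_of_real \<alpha>) ^ k) ** T1"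
begin

abbreviation R :: "complex^'m^'m" where "R \<equiv> resolvent 1 T0"

lemma not_spectrum: "\<mu> \<noteq> 1 - complex_of_real \<alpha> \<Longrightarrow> \<mu> \<notin> mat_spectrum T0"
  using spectrum by simp

lemma one_not_spectrum: "1 \<notin> mat_spectrum T0"
  using \<alpha> by (intro not_spectrum) simp

lemma characteristic_vec:
  assumes "\<mu> \<noteq> 1 - complex_of_real \<alpha>"
  shows "T1 *v (resolvent \<mu> T0 *v (T1 *v v)) = (complex_of_real \<alpha> ^ k / (\<mu> - 1 + complex_of_real \<alpha>) ^ k) *s (T1 *v v)"
  using arg_cong[OF characteristic[rule_format, OF assms], of "\<lambda>A. A *v v"]
  by (simp add: cmatrix_mat flip: matrix_vector_mul_assoc)

lemma R_right: "R *v v - T0 *v (R *v v) = v"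
  using resolvent_right[OF one_not_spectrum, of v] by simp

lemma R_left: "R *v (v - T0 *v v) = v"
  using resolvent_left[OF one_not_spectrum, of v] by simp

lemma T1_R_T1: "T1 *v (R *v (T1 *v v)) = T1 *v v"
  using characteristic_vec[of 1 v] \<alpha> by simp

lemma T1_nonzero_vec: obtains v where "T1 *v v \<noteq> 0"
proof -
  have "\<not> (\<forall>v. T1 *v v = 0 *v v)"
    using T1_nonzero by (subst matrix_eq[symmetric]) simp
  then show thesis using that by auto
qed

lemma mpow_T0_decay:
  obtains C r where "C \<ge> 0" "0 < r" "r < 1" "\<And>n v. norm (mpow T0 n v) \<le> C * r ^ n * norm v"
proof -
  have b: "cmod (1 - complex_of_real \<alpha>) = 1 - \<alpha>"
    using \<alpha> norm_of_real[of "1 - \<alpha>", where 'a = complex] by simp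
  then have "cmod (1 - complex_of_real \<alpha>) < 1 - \<alpha> / 2" using \<alpha> by simp
  from mpow_decay[OF spectrum this] obtain C
    where "C \<ge> 0" "\<And>n v. norm (mpow T0 n v) \<le> C * (1 - \<alpha> / 2) ^ n * norm v" by blast
  then show thesis using that[of C "1 - \<alpha> / 2"] \<alpha> by simp
qed

lemma resolvent_T0_sums:
  assumes "s \<noteq> 0" "cmod s \<le> 1"
  shows "(\<lambda>j. s ^ Suc j *s mpow T0 j u) sums (resolvent (inverse s) T0 *v u)"
proof -
  obtain C r where C: "C \<ge> 0" "0 < r" "r < 1" "\<And>n v. norm (mpow T0 n v) \<le> C * r ^ n * norm v"
    by (rule mpow_T0_decay) blast
  have "inverse s \<noteq> 1 - complex_of_real \<alpha>"
  proof
    assume "inverse s = 1 - complex_of_real \<alpha>"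
    then have "inverse (cmod s) = 1 - \<alpha>"
      using \<alpha> norm_of_real[of "1 - \<alpha>", where 'a = complex] by (simp flip: norm_inverse)
    moreover have "1 \<le> inverse (cmod s)" using assms by (simp add: one_le_inverse_iff)
    ultimately show False using \<alpha> by simp
  qed
  from resolvent_sums[OF assms not_spectrum[OF this] C(4)] C show ?thesis by simp
qed

text \<open>Both sides are coefficients of the same power series. In the open unit disc the Neumann
  series expands \<open>T1 R(1/s, T0) T1 v\<close> with coefficients \<open>T1 T0^j T1 v\<close>,
  while the hypothesis identifies it with the \<open>k\<close>-th power of the generating function
  \<open>hit_fps\<close>. The series of \<open>R(1/s, T0)\<close> starts with \<open>s\<close>, not
  1, which is why \<open>T0^j\<close> goes with the time \<open>Suc j\<close>.\<close>

lemma T1_mpow_T1: "T1 *v mpow T0 j (T1 *v v) = hit \<alpha> (Suc j) k *\<^sub>R (T1 *v v)"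
proof -
  have "(T1 *v mpow T0 j (T1 *v v)) $ a = of_real (hit \<alpha> (Suc j) k) * (T1 *v v) $ a" for a
  proof -
    define G where "G = Abs_fps (\<lambda>n. case n of 0 \<Rightarrow> 0 | Suc j \<Rightarrow> (T1 *v mpow T0 j (T1 *v v)) $ a)"
    define H where "H = hit_fps \<alpha> ^ k * fps_const ((T1 *v v) $ a)"
    define h where "h = (\<lambda>s. (of_real \<alpha> * s * inverse (1 - of_real (1 - \<alpha>) * s)) ^ k * (T1 *v v) $ a)"
    have G: "(\<lambda>n. fps_nth G n * s ^ n) sums h s" if s: "cmod s < 1" for s
    proof -
      have "(\<lambda>j. (T1 *v mpow T0 j (T1 *v v)) $ a * s ^ Suc j) sums h s"
      \<comment> \<open>At \<open>s = 0\<close> there is no resolvent at \<open>1/s\<close>; both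
        sides vanish there because \<open>k\<close> is positive.\<close>
      proof (cases "s = 0")
        case True
        then show ?thesis using k by (simp add: h_def power_0_left)
      next
        case False
        have "inverse s - 1 + of_real \<alpha> = inverse s * (1 - of_real (1 - \<alpha>) * s)"
          using False by (simp add: field_simps)
        then have hs: "h s = (complex_of_real \<alpha> ^ k / (inverse s - 1 + of_real \<alpha>) ^ k) * (T1 *v v) $ a"
          using False by (simp only: h_def) (simp add: field_simps power_mult_distrib)
        have ne: "inverse s \<noteq> 1 - complex_of_real \<alpha>"
        proof
          assume "inverse s = 1 - complex_of_real \<alpha>"
          then have "inverse (cmod s) = 1 - \<alpha>"
            using \<alpha> norm_of_real[of "1 - \<alpha>", where 'a = complex] by (simp flip: norm_inverse)
          moreover have "1 \<le> inverse (cmod s)" using s False by (simp add: one_le_inverse_iff)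
          ultimately show False using \<alpha> by simp
        qed
        have "(\<lambda>j. (T1 *v (s ^ Suc j *s mpow T0 j (T1 *v v))) $ a) sums
            ((T1 *v (resolvent (inverse s) T0 *v (T1 *v v))) $ a)"
          by (intro bounded_linear.sums[OF bounded_linear_vec_nth]
              bounded_linear.sums[OF bounded_linear_cmatrix] resolvent_T0_sums) (use False s in auto)
        then show ?thesis
          unfolding characteristic_vec[OF ne] hs by (simp add: vec.scale mult.commute)
      qed
      then show ?thesis
        using sums_Suc_iff[of "\<lambda>n. fps_nth G n * s ^ n" "h s"] by (simp add: G_def)
    qed
    have G_pos: "fps_conv_radius G > 0"
    proof -
      have "ereal (norm (1/2 :: complex)) \<le> conv_radius (fps_nth G)"
        using sums_summable[OF G[of "1/2"]] by (intro conv_radius_geI) auto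
      then show ?thesis unfolding fps_conv_radius_def
        by (rule less_le_trans[rotated]) (simp add: zero_ereal_def)
    qed
    have base: "(\<lambda>s. of_real \<alpha> * s * inverse (1 - of_real (1 - \<alpha>) * s)) has_fps_expansion hit_fps \<alpha>"
      unfolding hit_fps_def by (intro fps_expansion_intros) auto
    have "(\<lambda>s. (of_real \<alpha> * s * inverse (1 - of_real (1 - \<alpha>) * s)) ^ n) has_fps_expansion hit_fps \<alpha> ^ n" for n
      by (induction n) (simp_all add: has_fps_expansion_mult[OF base] del: of_real_diff)
    then have "h has_fps_expansion H"
      unfolding h_def H_def by (intro fps_expansion_intros)
    then have H: "fps_conv_radius H > 0" "\<forall>\<^sub>F s in nhds 0. eval_fps H s = h s"
      by (auto simp: has_fps_expansion_def)
    have "\<forall>\<^sub>F s in nhds (0::complex). cmod s < 1"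
      using eventually_nhds_ball[of 1 "0::complex"] by (simp add: dist_norm)
    then have "\<forall>\<^sub>F s in nhds 0. eval_fps G s = eval_fps H s"
      using H(2) by eventually_elim (simp add: eval_fps_def G sums_unique[symmetric])
    then have "G = H" using G_pos H(1) by (intro eval_fps_eqD)
    then have "fps_nth G (Suc j) = fps_nth H (Suc j)" by simp
    then show ?thesis by (simp add: G_def H_def hit_fps_nth del: hit.simps)
  qed
  then show ?thesis
    unfolding vec_eq_iff vector_scaleR_component by (simp add: scaleR_conv_of_real del: hit.simps)
qed

text \<open>The sum of \<open>(j + 1) T0\<^sup>j\<close> is \<open>R\<^sup>2\<close>; sandwiched between two copies of \<open>T1\<close> it becomes a
  multiple of \<open>T1\<close>, and the multiple is at least the total mass of the weights, which is 1.\<close>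

lemma T1_R_R_T1:
  obtains \<kappa> where "\<kappa> \<ge> 1" "\<And>v. T1 *v (R *v (R *v (T1 *v v))) = \<kappa> *\<^sub>R (T1 *v v)"
proof -
  obtain C r where C: "C \<ge> 0" "0 < r" "r < 1" "\<And>n v. norm (mpow T0 n v) \<le> C * r ^ n * norm v"
    by (rule mpow_T0_decay) blast
  define Q where "Q = (\<lambda>n u. \<Sum>j<n. real (Suc j) *\<^sub>R mpow T0 j u)"
  have R_sum: "(\<lambda>n. \<Sum>j<n. mpow T0 j u) \<longlonglongrightarrow> R *v u" for u
    using resolvent_T0_sums[of 1 u] by (simp add: sums_def)
  \<comment> \<open>Abel summation: applying \<open>1 - T0\<close> to the weighted sum leaves the
    plain Neumann sum up to a vanishing remainder, so a further factor \<open>R\<close> yields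
    \<open>R^2\<close> in the limit.\<close>
  have Q_rec: "Q n u - T0 *v Q n u = (\<Sum>j<n. mpow T0 j u) - real n *\<^sub>R mpow T0 n u" for n u
  proof (induction n)
    case (Suc n)
    have "Q (Suc n) u = Q n u + real (Suc n) *\<^sub>R mpow T0 n u"
      by (simp add: Q_def)
    then have "Q (Suc n) u - T0 *v Q (Suc n) u
        = (Q n u - T0 *v Q n u) + real (Suc n) *\<^sub>R mpow T0 n u - real (Suc n) *\<^sub>R mpow T0 (Suc n) u"
      by (simp add: cmatrix_simps del: of_nat_Suc)
    then show ?case unfolding Suc.IH by (simp add: scaleR_add_left)
  qed (simp add: Q_def)
  have Q_lim: "(\<lambda>n. Q n u) \<longlonglongrightarrow> R *v (R *v u)" for u
  proof -
    have "(\<lambda>n. real n *\<^sub>R mpow T0 n u) \<longlonglongrightarrow> 0"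
    proof (rule Lim_null_comparison)
      show "\<forall>\<^sub>F n in sequentially. norm (real n *\<^sub>R mpow T0 n u) \<le> C * norm u * (real n * r ^ n)"
      proof (intro always_eventually allI)
        show "norm (real n *\<^sub>R mpow T0 n u) \<le> C * norm u * (real n * r ^ n)" for n
          using mult_left_mono[OF C(4)[of n u], of "real n"] by (simp add: mult_ac)
      qed
      show "(\<lambda>n. C * norm u * (real n * r ^ n)) \<longlonglongrightarrow> 0"
        using C by (intro tendsto_mult_right_zero powser_times_n_limit_0) auto
    qed
    from tendsto_diff[OF R_sum this]
    have "(\<lambda>n. Q n u - T0 *v Q n u) \<longlonglongrightarrow> R *v u" by (simp add: Q_rec)
    from bounded_linear.tendsto[OF bounded_linear_cmatrix[of R] this]
    show ?thesis by (simp add: R_left)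
  qed
  define q where "q = (\<lambda>n. \<Sum>j<n. real (Suc j) * hit \<alpha> (Suc j) k)"
  define h where "h = (\<lambda>n. \<Sum>j<n. hit \<alpha> (Suc j) k)"
  have q_lim: "(\<lambda>n. q n *\<^sub>R (T1 *v v)) \<longlonglongrightarrow> T1 *v (R *v (R *v (T1 *v v)))" for v
  proof -
    have "T1 *v Q n (T1 *v v) = q n *\<^sub>R (T1 *v v)" for n
      by (simp add: Q_def q_def cmatrix_simps T1_mpow_T1 scaleR_left.sum del: hit.simps of_nat_Suc)
    then show ?thesis
      using bounded_linear.tendsto[OF bounded_linear_cmatrix[of T1] Q_lim[of "T1 *v v"]] by simp
  qed
  have h_lim: "(\<lambda>n. h n *\<^sub>R (T1 *v v)) \<longlonglongrightarrow> T1 *v v" for v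
  proof -
    have "T1 *v (\<Sum>j<n. mpow T0 j (T1 *v v)) = h n *\<^sub>R (T1 *v v)" for n
      by (simp add: h_def cmatrix_simps T1_mpow_T1 scaleR_left.sum del: hit.simps)
    then show ?thesis
      using bounded_linear.tendsto[OF bounded_linear_cmatrix[of T1] R_sum[of "T1 *v v"]]
      by (simp add: T1_R_T1)
  qed
  \<comment> \<open>Norms at one vector not annihilated by \<open>T1\<close> turn the two vector
    limits into limits of the scalars \<open>q n\<close> and \<open>h n\<close>.\<close>
  obtain v0 where v0: "T1 *v v0 \<noteq> 0" by (rule T1_nonzero_vec)
  define \<kappa> where "\<kappa> = norm (T1 *v (R *v (R *v (T1 *v v0)))) / norm (T1 *v v0)"
  have hit0: "0 \<le> hit \<alpha> n j" for n j using \<alpha> by (intro hit_nonneg) auto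
  have hq: "0 \<le> h n" "h n \<le> q n" for n
    unfolding h_def q_def
    by (auto intro!: sum_nonneg sum_mono simp: hit0 mult_le_cancel_right1 simp del: hit.simps)
       (metis hit0 not_less)
  have "(\<lambda>n. norm (q n *\<^sub>R (T1 *v v0)) / norm (T1 *v v0)) \<longlonglongrightarrow> \<kappa>"
    unfolding \<kappa>_def by (intro tendsto_divide tendsto_norm q_lim tendsto_const) (use v0 in auto)
  moreover have "norm (q n *\<^sub>R (T1 *v v0)) / norm (T1 *v v0) = q n" for n
    using v0 hq[of n] by simp
  ultimately have q: "q \<longlonglongrightarrow> \<kappa>" by (simp only:)
  have "(\<lambda>n. norm (h n *\<^sub>R (T1 *v v0)) / norm (T1 *v v0)) \<longlonglongrightarrow> norm (T1 *v v0) / norm (T1 *v v0)"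
    by (intro tendsto_divide tendsto_norm h_lim tendsto_const) (use v0 in auto)
  moreover have "norm (h n *\<^sub>R (T1 *v v0)) / norm (T1 *v v0) = h n" for n
    using v0 hq[of n] by simp
  ultimately have h: "h \<longlonglongrightarrow> 1" using v0 by simp
  have "1 \<le> \<kappa>" using hq by (intro LIMSEQ_le[OF h q]) auto
  moreover have "T1 *v (R *v (R *v (T1 *v v))) = \<kappa> *\<^sub>R (T1 *v v)" for v
    by (rule LIMSEQ_unique[OF q_lim]) (intro tendsto_scaleR q tendsto_const)
  ultimately show thesis by (rule that)
qed

end

section \<open>Convolution estimates and the renewal formula for the solution\<close>

lemma sum_geometric_le:
  fixes r :: real
  assumes "0 < r" "r < 1"
  shows "(\<Sum>i<n. r ^ i) \<le> 1 / (1 - r)"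
  using sum_le_suminf[of "\<lambda>i. r ^ i" "{..<n}"] assms by (simp add: suminf_geometric)

text \<open>Convolution with geometric weights preserves the rate \<open>n^(-1/2)\<close>: since
  \<open>n \<le> (i + 1) * (n - i)\<close>, looking back \<open>i\<close> steps costs at most a
  factor \<open>i + 1\<close>, which the weights absorb.\<close>

lemma sum_geometric_sqrt:
  assumes r: "0 < r" "r < 1" and n: "0 < n"
  shows "(\<Sum>i<n. r ^ i * (1 / sqrt (real (n - i)))) \<le> 1 / (1 - r)\<^sup>2 / sqrt (real n)"
proof -
  have "r ^ i * (1 / sqrt (real (n - i))) \<le> real (Suc i) * r ^ i / sqrt (real n)" if "i < n" for i
  proof -
    obtain d where d: "n = Suc (i + d)" using less_imp_Suc_add[OF \<open>i < n\<close>] by blast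
    have "real n \<le> real (Suc i) * real (n - i)"
      unfolding d by (simp add: algebra_simps)
    then have "sqrt (real n) \<le> sqrt (real (Suc i)) * sqrt (real (n - i))"
      by (simp add: real_sqrt_mult [symmetric])
    also have "\<dots> \<le> real (Suc i) * sqrt (real (n - i))"
      by (intro mult_right_mono real_le_lsqrt) (auto simp: power2_eq_square)
    finally have "1 / sqrt (real (n - i)) \<le> real (Suc i) / sqrt (real n)"
      using that by (simp add: field_simps del: of_nat_Suc)
    from mult_left_mono[OF this, of "r ^ i"] r show ?thesis by (simp add: mult_ac)
  qed
  then have "(\<Sum>i<n. r ^ i * (1 / sqrt (real (n - i)))) \<le> (\<Sum>i<n. real (Suc i) * r ^ i / sqrt (real n))"
    by (intro sum_mono) auto
  also have "\<dots> = (\<Sum>i<n. real (Suc i) * r ^ i) / sqrt (real n)" by (simp add: sum_divide_distrib)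
  also have "(\<Sum>i<n. real (Suc i) * r ^ i) \<le> 1 / (1 - r)\<^sup>2"
    using geometric_deriv_sums[of r] r
      sum_le_suminf[of "\<lambda>i. real (Suc i) * r ^ i" "{..<n}"]
    by (simp add: sums_iff del: of_nat_Suc)
  finally show ?thesis using r by (simp add: divide_right_mono)
qed

lemma lp_le_matrix:
  fixes A :: "complex^'m^'m" and x :: "int \<Rightarrow> complex^'m"
  assumes "1 \<le> p" "lp_le p x B" "0 \<le> C" "\<And>v. norm (A *v v) \<le> C * norm v"
  shows "lp_le p (\<lambda>j. A *v x j) (C * B)"
  using assms by (intro lp_le_dominated[where y = x]) auto

definition shift_sum :: "(nat \<Rightarrow> real) \<Rightarrow> nat \<Rightarrow> (int \<Rightarrow> complex^'m) \<Rightarrow> int \<Rightarrow> complex^'m" where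
  "shift_sum c N y = (\<lambda>j. \<Sum>l\<le>N. c l *\<^sub>R y (j - int l))"

text \<open>The shift is an isometry, so a polynomial in it is bounded by the absolute sum of its
  coefficients. This moves every estimate from the space to the weights, uniformly in
  \<open>p\<close>.\<close>

lemma lp_le_shift_sum:
  assumes p: "1 \<le> p" and y: "lp_le p y B" and c: "(\<Sum>l\<le>N. \<bar>c l\<bar>) \<le> K"
  shows "lp_le p (shift_sum c N y) (K * B)"
proof -
  have "lp_le p (shift_sum c N y) (\<Sum>l\<le>N. \<bar>c l\<bar> * B)"
    unfolding shift_sum_def by (intro lp_le_sum lp_le_scaleR lp_le_shift_n p y)
  then show ?thesis
    using mult_right_mono[OF c lp_leD(3)[OF y]] by (elim lp_le_mono) (simp add: sum_distrib_right)
qed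

lemma solution_0 [simp]: "solution T0 T1 x 0 = x"
  by (simp add: solution_def)

lemma solution_Suc: "solution T0 T1 x (Suc n) j = T0 *v solution T0 T1 x n j + T1 *v solution T0 T1 x n (j - 1)"
  by (simp add: solution_def T_op_def)

text \<open>Variation of constants, with the coupling to the left neighbour treated as
  forcing.\<close>

lemma solution_duhamel:
  "solution T0 T1 x n j = mpow T0 n (x j) + (\<Sum>i<n. mpow T0 (n - Suc i) (T1 *v solution T0 T1 x i (j - 1)))"
proof (induction n)
  case (Suc n)
  have "(\<Sum>i<n. T0 *v mpow T0 (n - Suc i) (T1 *v solution T0 T1 x i (j - 1)))
      = (\<Sum>i<n. mpow T0 (n - i) (T1 *v solution T0 T1 x i (j - 1)))"
  proof (intro sum.cong refl)
    fix i assume "i \<in> {..<n}"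
    then have "n - i = Suc (n - Suc i)" by auto
    then show "T0 *v mpow T0 (n - Suc i) (T1 *v solution T0 T1 x i (j - 1))
      = mpow T0 (n - i) (T1 *v solution T0 T1 x i (j - 1))" by simp
  qed
  then show ?case
    unfolding solution_Suc by (subst Suc.IH) (simp add: cmatrix_simps)
qed simp

text \<open>With the first forcing term split off, the remaining sum has the same kernel as the one
  for time \<open>n\<close>; subtracting the two leaves increments of the forcing.\<close>

lemma solution_duhamel_Suc:
  "solution T0 T1 x (Suc n) j = mpow T0 (Suc n) (x j) + mpow T0 n (T1 *v x (j - 1))
     + (\<Sum>i<n. mpow T0 (n - Suc i) (T1 *v solution T0 T1 x (Suc i) (j - 1)))"
  by (subst solution_duhamel) (simp only: sum.lessThan_Suc_shift solution_0 diff_Suc_Suc diff_zero add.assoc)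

context coupled_system
begin

abbreviation \<open>flow x n \<equiv> solution T0 T1 x n\<close>

definition renewal :: "nat \<Rightarrow> (int \<Rightarrow> complex^'m) \<Rightarrow> int \<Rightarrow> complex^'m" where
  "renewal n = shift_sum (\<lambda>l. hit \<alpha> n (k * l)) n"

lemma renewal_extend:
  assumes "n \<le> N"
  shows "renewal n = shift_sum (\<lambda>l. hit \<alpha> n (k * l)) N"
proof -
  have "hit \<alpha> n (k * l) = 0" if "n < l" for l
    using that k by (intro hit_eq_0) (metis less_le_trans mult_le_mono1 nat_mult_1)
  then show ?thesis unfolding renewal_def shift_sum_def using assms
    by (intro ext sum.mono_neutral_left) auto
qed

lemma renewal_0 [simp]: "renewal 0 y j = y j"
  by (simp add: renewal_def shift_sum_def)

text \<open>Splits off the last \<open>k\<close> of the \<open>k * l\<close> successes by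
  \<open>hit_add\<close>; each such block carries one shift. The summand \<open>i = n\<close> is
  absent because \<open>hit \<alpha> 0 k = 0\<close> for positive \<open>k\<close>, so only earlier
  times occur on the right.\<close>

lemma renewal_rec:
  assumes n: "0 < n"
  shows "renewal n y j = (\<Sum>i<n. hit \<alpha> (n - i) k *\<^sub>R renewal i y (j - 1))"
proof -
  obtain m where m: "n = Suc m" using n gr0_implies_Suc by blast
  have "hit \<alpha> n (k * Suc l) = (\<Sum>i<n. hit \<alpha> i (k * l) * hit \<alpha> (n - i) k)" for l
  proof -
    have "hit \<alpha> n (k * Suc l) = hit \<alpha> n (k * l + k)" by (simp add: add.commute)
    also have "\<dots> = (\<Sum>i\<le>n. hit \<alpha> i (k * l) * hit \<alpha> (n - i) k)" by (rule hit_add)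
    also have "\<dots> = (\<Sum>i<n. hit \<alpha> i (k * l) * hit \<alpha> (n - i) k)"
      using k by (simp add: lessThan_Suc_atMost[symmetric])
    finally show ?thesis .
  qed
  then have "renewal n y j = (\<Sum>l\<le>m. (\<Sum>i<n. hit \<alpha> i (k * l) * hit \<alpha> (n - i) k) *\<^sub>R y (j - 1 - int l))"
    unfolding renewal_def shift_sum_def m sum.atMost_Suc_shift by (simp add: algebra_simps)
  also have "\<dots> = (\<Sum>l\<le>m. \<Sum>i<n. hit \<alpha> (n - i) k *\<^sub>R (hit \<alpha> i (k * l) *\<^sub>R y (j - 1 - int l)))"
    by (simp add: scaleR_left.sum mult.commute)
  also have "\<dots> = (\<Sum>i<n. hit \<alpha> (n - i) k *\<^sub>R (\<Sum>l\<le>m. hit \<alpha> i (k * l) *\<^sub>R y (j - 1 - int l)))"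
    by (subst sum.swap) (simp only: scaleR_right.sum)
  also have "\<dots> = (\<Sum>i<n. hit \<alpha> (n - i) k *\<^sub>R renewal i y (j - 1))"
    by (intro sum.cong refl arg_cong2[where f = scaleR])
       (subst renewal_extend[of _ m], auto simp: m shift_sum_def)
  finally show ?thesis .
qed

lemma T1_flow_rec:
  "T1 *v flow x n j = T1 *v mpow T0 n (x j) + (\<Sum>i<n. hit \<alpha> (n - i) k *\<^sub>R (T1 *v flow x i (j - 1)))"
proof -
  have "T1 *v mpow T0 (n - Suc i) (T1 *v flow x i (j - 1)) = hit \<alpha> (n - i) k *\<^sub>R (T1 *v flow x i (j - 1))"
    if "i < n" for i
    using that by (simp only: T1_mpow_T1 Suc_diff_Suc)
  then show ?thesis
    by (subst solution_duhamel) (simp add: cmatrix_simps)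
qed

text \<open>Solves the renewal equation \<open>T1_flow_rec\<close> with sources
  \<open>T1 T0^i x\<close>. After the triangular double sum is reordered by the age of the source,
  each inner sum is an instance of \<open>renewal_rec\<close>.\<close>

lemma T1_flow:
  "T1 *v flow x n j = (\<Sum>i\<le>n. renewal (n - i) (\<lambda>j. T1 *v mpow T0 i (x j)) j)"
proof (induction n arbitrary: j rule: less_induct)
  case (less n)
  define g where "g = (\<lambda>i j. T1 *v mpow T0 i (x j))"
  have "T1 *v flow x n j = g n j + (\<Sum>m<n. hit \<alpha> (n - m) k *\<^sub>R (\<Sum>i\<le>m. renewal (m - i) (g i) (j - 1)))"
    unfolding T1_flow_rec[of x n j] g_def by (simp add: less.IH)
  also have "(\<Sum>m<n. hit \<alpha> (n - m) k *\<^sub>R (\<Sum>i\<le>m. renewal (m - i) (g i) (j - 1)))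
      = (\<Sum>m<n. \<Sum>i\<le>m. hit \<alpha> (n - i - (m - i)) k *\<^sub>R renewal (m - i) (g i) (j - 1))"
    by (simp add: scaleR_right.sum)
  also have "\<dots> = (\<Sum>(i, l)\<in>{(i, l). i + l < n}. hit \<alpha> (n - i - l) k *\<^sub>R renewal l (g i) (j - 1))"
    by (simp add: sum.triangle_reindex)
  also have "{(i, l). i + l < n} = Sigma {..<n} (\<lambda>i. {..<n - i})" by auto
  also have "(\<Sum>(i, l)\<in>Sigma {..<n} (\<lambda>i. {..<n - i}). hit \<alpha> (n - i - l) k *\<^sub>R renewal l (g i) (j - 1))
      = (\<Sum>i<n. \<Sum>l<n - i. hit \<alpha> (n - i - l) k *\<^sub>R renewal l (g i) (j - 1))"
    by (rule sum.Sigma[symmetric]) auto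
  also have "\<dots> = (\<Sum>i<n. renewal (n - i) (g i) j)"
    by (intro sum.cong refl renewal_rec[symmetric]) auto
  also have "g n j + \<dots> = (\<Sum>i\<le>n. renewal (n - i) (g i) j)"
    by (simp add: lessThan_Suc_atMost[symmetric])
  finally show ?case by (simp add: g_def)
qed

text \<open>Only every \<open>k\<close>-th weight occurs in \<open>renewal\<close>; passing to all
  of them merely adds nonnegative terms, so the mass and variation bounds of the full distribution
  apply.\<close>

lemma sum_hit_multiples:
  assumes "\<And>j. 0 \<le> f j"
  shows "(\<Sum>l\<le>N. f (k * l)) \<le> (\<Sum>j\<le>k * N. f j :: real)"
proof -
  have "(\<Sum>l\<le>N. f (k * l)) = (\<Sum>j\<in>(*) k ` {..N}. f j)"
    using k by (subst sum.reindex) (auto simp: inj_on_def)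
  also have "\<dots> \<le> (\<Sum>j\<le>k * N. f j)" using assms by (intro sum_mono2) auto
  finally show ?thesis .
qed

section \<open>Power boundedness and decay of the increments\<close>

lemma lp_le_renewal:
  assumes "lp_le p y B"
  shows "lp_le p (renewal n y) B"
proof -
  have pos: "0 \<le> hit \<alpha> n j" for n j using \<alpha> by (intro hit_nonneg) auto
  have "(\<Sum>l\<le>n. \<bar>hit \<alpha> n (k * l)\<bar>) \<le> 1"
    using sum_hit_multiples[of "hit \<alpha> n" n] sum_hit_le_1[of \<alpha> n "k * n"] \<alpha> pos by simp
  from lp_le_shift_sum[OF p assms this] show ?thesis by (simp add: renewal_def)
qed

lemma lp_le_renewal_diff:
  assumes "lp_le p y B"
  shows "lp_le p (\<lambda>j. renewal (Suc n) y j - renewal n y j) (2 / (1 - \<alpha>) / sqrt (real (Suc n)) * B)"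
proof -
  have c: "(\<Sum>l\<le>Suc n. \<bar>hit \<alpha> (Suc n) (k * l) - hit \<alpha> n (k * l)\<bar>) \<le> 2 / (1 - \<alpha>) / sqrt (real (Suc n))"
    using sum_hit_multiples[of "\<lambda>j. \<bar>hit \<alpha> (Suc n) j - hit \<alpha> n j\<bar>" "Suc n"]
      hit_variation[of \<alpha> n "k * Suc n"] \<alpha> by linarith
  have eq: "(\<lambda>j. renewal (Suc n) y j - renewal n y j)
      = shift_sum (\<lambda>l. hit \<alpha> (Suc n) (k * l) - hit \<alpha> n (k * l)) (Suc n) y"
    unfolding renewal_extend[of n "Suc n", OF le_SucI[OF order_refl]]
    unfolding renewal_def
    by (simp add: shift_sum_def scaleR_left_diff_distrib sum_subtractf del: sum.atMost_Suc)
  show ?thesis unfolding eq by (rule lp_le_shift_sum[OF p assms c])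
qed

text \<open>Only the component \<open>T1 T^n x\<close> satisfies a scalar renewal equation, so it is
  estimated first. The sources decay geometrically and \<open>renewal\<close> contributes mass at
  most 1, respectively variation of order \<open>n^(-1/2)\<close>.\<close>

lemma T1_flow_bounds:
  obtains K where "K \<ge> 0" "\<And>x B n. lp_le p x B \<Longrightarrow> lp_le p (\<lambda>j. T1 *v flow x n j) (K * B)"
    "\<And>x B n. lp_le p x B \<Longrightarrow>
      lp_le p (\<lambda>j. T1 *v flow x (Suc n) j - T1 *v flow x n j) (K / sqrt (real (Suc n)) * B)"
proof -
  obtain C r where C: "C \<ge> 0" "0 < r" "r < 1" "\<And>n v. norm (mpow T0 n v) \<le> C * r ^ n * norm v"
    by (rule mpow_T0_decay) blast
  obtain D where D: "D \<ge> 0" "\<And>v. norm (T1 *v v) \<le> D * norm v" using matrix_norm_bound by blast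
  define E where "E = D * C"
  have E: "E \<ge> 0" using C D by (simp add: E_def)
  have g: "lp_le p (\<lambda>j. T1 *v mpow T0 i (x j)) (E * r ^ i * B)" if "lp_le p x B" for x B i
  proof (rule lp_le_dominated[OF p that])
    show "norm (T1 *v mpow T0 i (x j)) \<le> E * r ^ i * norm (x j)" for j
      using order_trans[OF D(2) mult_left_mono[OF C(4)[of i "x j"] D(1)]] by (simp add: E_def mult_ac)
  qed (use E C in auto)
  define c where "c = 1 / (1 - r)\<^sup>2"
  have geo: "(\<Sum>i<n. r ^ i) \<le> 1 / (1 - r)" for n
    using C by (intro sum_geometric_le) auto
  \<comment> \<open>The power on the left is the summand \<open>i = n\<close> of the convolution
    sum.\<close>
  have rpow: "r ^ n \<le> c / sqrt (real (Suc n))" for n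
  proof -
    have "r ^ n * (1 / sqrt (real (Suc n - n))) \<le> (\<Sum>i<Suc n. r ^ i * (1 / sqrt (real (Suc n - i))))"
      using C by (intro member_le_sum) auto
    also have "\<dots> \<le> c / sqrt (real (Suc n))" unfolding c_def using C by (intro sum_geometric_sqrt) auto
    finally show ?thesis by simp
  qed
  define K1 where "K1 = E * (1 / (1 - r))"
  have b1: "lp_le p (\<lambda>j. T1 *v flow x n j) (K1 * B)" if x: "lp_le p x B" for x B n
  proof -
    have "lp_le p (\<lambda>j. T1 *v flow x n j) (\<Sum>i\<le>n. E * r ^ i * B)"
      unfolding T1_flow by (intro lp_le_sum p lp_le_renewal g x)
    moreover have "(\<Sum>i\<le>n. E * r ^ i * B) = E * (\<Sum>i<Suc n. r ^ i) * B"
      by (simp only: sum_distrib_left sum_distrib_right lessThan_Suc_atMost)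
    moreover have "\<dots> \<le> K1 * B"
      unfolding K1_def using geo[of "Suc n"] E lp_leD(3)[OF x] by (intro mult_right_mono mult_left_mono) auto
    ultimately show ?thesis by (elim lp_le_mono) simp
  qed
  define d where "d = 2 / (1 - \<alpha>)"
  have d: "d \<ge> 0" using \<alpha> by (simp add: d_def)
  define K2 where "K2 = E * c + E * d * c"
  have b2: "lp_le p (\<lambda>j. T1 *v flow x (Suc n) j - T1 *v flow x n j) (K2 / sqrt (real (Suc n)) * B)"
    if x: "lp_le p x B" for x B n
  proof -
    define G where "G = (\<lambda>i j. T1 *v mpow T0 i (x j))"
    have B: "B \<ge> 0" using lp_leD(3)[OF x] .
    \<comment> \<open>The newest source enters with age 0, where \<open>renewal\<close> is the
      identity; every older one contributes the difference of two consecutive renewal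
      operators.\<close>
    have eq: "(\<lambda>j. T1 *v flow x (Suc n) j - T1 *v flow x n j)
      = (\<lambda>j. G (Suc n) j + (\<Sum>i\<le>n. renewal (Suc (n - i)) (G i) j - renewal (n - i) (G i) j))"
      by (intro ext) (simp add: T1_flow G_def sum_subtractf Suc_diff_le)
    have "lp_le p (\<lambda>j. G (Suc n) j + (\<Sum>i\<le>n. renewal (Suc (n - i)) (G i) j - renewal (n - i) (G i) j))
      (E * r ^ Suc n * B + (\<Sum>i\<le>n. 2 / (1 - \<alpha>) / sqrt (real (Suc (n - i))) * (E * r ^ i * B)))"
      unfolding G_def by (intro lp_le_add lp_le_sum p lp_le_renewal_diff g x)
    moreover have "(\<Sum>i\<le>n. 2 / (1 - \<alpha>) / sqrt (real (Suc (n - i))) * (E * r ^ i * B))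
        = (E * d) * (\<Sum>i<Suc n. r ^ i * (1 / sqrt (real (Suc n - i)))) * B"
      unfolding sum_distrib_left sum_distrib_right lessThan_Suc_atMost
      by (intro sum.cong) (auto simp: Suc_diff_le d_def)
    moreover have "(E * d) * (\<Sum>i<Suc n. r ^ i * (1 / sqrt (real (Suc n - i)))) * B
        \<le> (E * d) * (c / sqrt (real (Suc n))) * B"
      unfolding c_def using E d B C
      by (intro mult_right_mono mult_left_mono sum_geometric_sqrt) auto
    moreover have "E * r ^ Suc n * B \<le> E * (c / sqrt (real (Suc n))) * B"
    proof -
      have "r ^ Suc n \<le> r ^ n" using C by (intro power_decreasing) auto
      with rpow[of n] show ?thesis using E B by (intro mult_right_mono mult_left_mono) auto
    qed
    ultimately show ?thesis unfolding eq
      by (elim lp_le_mono) (simp add: K2_def algebra_simps add_divide_distrib del: of_nat_Suc)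
  qed
  have c: "c \<ge> 0" by (simp add: c_def)
  have K: "K1 \<ge> 0" "K2 \<ge> 0" using E C d c by (simp_all add: K1_def K2_def)
  show thesis
  proof (rule that)
    show "K1 + K2 \<ge> 0" using K by simp
    show "lp_le p (\<lambda>j. T1 *v flow x n j) ((K1 + K2) * B)" if "lp_le p x B" for x B n
      by (rule lp_le_mono[OF b1[OF that]]) (use K lp_leD(3)[OF that] in \<open>simp add: mult_right_mono\<close>)
    show "lp_le p (\<lambda>j. T1 *v flow x (Suc n) j - T1 *v flow x n j) ((K1 + K2) / sqrt (real (Suc n)) * B)"
      if "lp_le p x B" for x B n
      by (rule lp_le_mono[OF b2[OF that]])
        (use K lp_leD(3)[OF that] in \<open>auto intro!: mult_right_mono divide_right_mono\<close>)
  qed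
qed

text \<open>Duhamel's formula convolves the bounds for \<open>T1 T^n x\<close> with the
  geometrically decaying powers of \<open>T0\<close>, which changes only the constants.\<close>

lemma flow_bounds:
  obtains K where "K \<ge> 0" "\<And>x B n. lp_le p x B \<Longrightarrow> lp_le p (flow x n) (K * B)"
    "\<And>x B n. lp_le p x B \<Longrightarrow>
      lp_le p (\<lambda>j. flow x (Suc n) j - flow x n j) (K / sqrt (real (Suc n)) * B)"
proof -
  obtain C r where C: "C \<ge> 0" "0 < r" "r < 1" "\<And>n v. norm (mpow T0 n v) \<le> C * r ^ n * norm v"
    by (rule mpow_T0_decay) blast
  obtain L where L: "L \<ge> 0" "\<And>x B n. lp_le p x B \<Longrightarrow> lp_le p (\<lambda>j. T1 *v flow x n j) (L * B)"
    "\<And>x B n. lp_le p x B \<Longrightarrow>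
      lp_le p (\<lambda>j. T1 *v flow x (Suc n) j - T1 *v flow x n j) (L / sqrt (real (Suc n)) * B)"
    by (rule T1_flow_bounds) blast
  have g: "lp_le p (\<lambda>j. mpow T0 i (y j)) (C * r ^ i * B)" if "lp_le p y B" for y B i
    by (rule lp_le_dominated[OF p that]) (use C in auto)
  define c where "c = 1 / (1 - r)\<^sup>2"
  have c: "c \<ge> 0" by (simp add: c_def)
  have geo: "(\<Sum>i<n. r ^ i) \<le> 1 / (1 - r)" for n
    using C by (intro sum_geometric_le) auto
  have rpow: "r ^ n \<le> c / sqrt (real (Suc n))" for n
  proof -
    have "r ^ n * (1 / sqrt (real (Suc n - n))) \<le> (\<Sum>i<Suc n. r ^ i * (1 / sqrt (real (Suc n - i))))"
      using C by (intro member_le_sum) auto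
    also have "\<dots> \<le> c / sqrt (real (Suc n))" unfolding c_def using C by (intro sum_geometric_sqrt) auto
    finally show ?thesis by simp
  qed
  define K1 where "K1 = C + C * (1 / (1 - r)) * L"
  have b1: "lp_le p (flow x n) (K1 * B)" if x: "lp_le p x B" for x B n
  proof -
    have B: "B \<ge> 0" using lp_leD(3)[OF x] .
    have eq: "flow x n = (\<lambda>j. mpow T0 n (x j) + (\<Sum>i<n. mpow T0 (n - Suc i) (T1 *v flow x i (j - 1))))"
      by (rule ext) (rule solution_duhamel)
    have "lp_le p (flow x n) (C * r ^ n * B + (\<Sum>i<n. C * r ^ (n - Suc i) * (L * B)))"
      unfolding eq
      by (intro lp_le_add lp_le_sum p g x lp_le_shift[of p "\<lambda>j. T1 *v flow x i j" for i] L)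
    moreover have "(\<Sum>i<n. C * r ^ (n - Suc i) * (L * B)) = C * (\<Sum>i<n. r ^ i) * (L * B)"
      unfolding sum_distrib_left sum_distrib_right using sum.nat_diff_reindex[of "\<lambda>i. C * r ^ i * (L * B)" n] .
    moreover have "C * (\<Sum>i<n. r ^ i) * (L * B) \<le> C * (1 / (1 - r)) * (L * B)"
      using geo[of n] C L B by (intro mult_right_mono mult_left_mono) auto
    moreover have "C * r ^ n * B \<le> C * 1 * B"
      using C B by (intro mult_right_mono mult_left_mono power_le_one) auto
    ultimately show ?thesis by (elim lp_le_mono) (simp add: K1_def algebra_simps)
  qed
  define K2 where "K2 = 2 * (C * c) + C * c * L + 2 * (C * L * c)"
  have b2: "lp_le p (\<lambda>j. flow x (Suc n) j - flow x n j) (K2 / sqrt (real (Suc n)) * B)"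
    if x: "lp_le p x B" for x B n
  proof -
    have B: "B \<ge> 0" using lp_leD(3)[OF x] .
    let ?s = "sqrt (real (Suc n))"
    let ?u = "\<lambda>i j. T1 *v flow x i j"
    have eq: "(\<lambda>j. flow x (Suc n) j - flow x n j) = (\<lambda>j. (mpow T0 (Suc n) (x j) - mpow T0 n (x j))
        + mpow T0 n (?u 0 (j - 1)) + (\<Sum>i<n. mpow T0 (n - Suc i) (?u (Suc i) (j - 1) - ?u i (j - 1))))"
    proof
      fix j
      show "flow x (Suc n) j - flow x n j = (mpow T0 (Suc n) (x j) - mpow T0 n (x j))
        + mpow T0 n (?u 0 (j - 1)) + (\<Sum>i<n. mpow T0 (n - Suc i) (?u (Suc i) (j - 1) - ?u i (j - 1)))"
        by (subst solution_duhamel_Suc, subst solution_duhamel[where n = n]) (simp add: mpow_diff sum_subtractf del: funpow.simps)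
    qed
    have "lp_le p (\<lambda>j. flow x (Suc n) j - flow x n j)
      ((C * r ^ Suc n * B + C * r ^ n * B) + C * r ^ n * (L * B)
        + (\<Sum>i<n. C * r ^ (n - Suc i) * (L / sqrt (real (Suc i)) * B)))"
      unfolding eq
      by (intro lp_le_add lp_le_diff lp_le_sum p g x L
          lp_le_shift[of p "?u i" for i] lp_le_shift[of p "\<lambda>j. ?u (Suc i) j - ?u i j" for i])
    moreover have "(\<Sum>i<n. C * r ^ (n - Suc i) * (L / sqrt (real (Suc i)) * B))
        = C * L * (\<Sum>i<n. r ^ i * (1 / sqrt (real (n - i)))) * B"
    proof -
      have "(\<Sum>i<n. C * r ^ (n - Suc i) * (L / sqrt (real (Suc i)) * B))
        = (\<Sum>i<n. C * L * (r ^ (n - Suc i) * (1 / sqrt (real (n - (n - Suc i))))) * B)"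
        by (intro sum.cong) auto
      also have "\<dots> = (\<Sum>i<n. C * L * (r ^ i * (1 / sqrt (real (n - i)))) * B)"
        by (rule sum.nat_diff_reindex[of "\<lambda>i. C * L * (r ^ i * (1 / sqrt (real (n - i)))) * B"])
      finally show ?thesis by (simp only: sum_distrib_left sum_distrib_right)
    qed
    \<comment> \<open>The convolution bound has \<open>sqrt n\<close> where
      \<open>sqrt (n + 1)\<close> is wanted; the factor 2 pays for this, and for
      \<open>n = 0\<close> the sum is empty.\<close>
    moreover have "(\<Sum>i<n. r ^ i * (1 / sqrt (real (n - i)))) \<le> 2 * c / ?s"
    proof (cases "n = 0")
      case False
      then have "(\<Sum>i<n. r ^ i * (1 / sqrt (real (n - i)))) \<le> c / sqrt (real n)"
        unfolding c_def using C by (intro sum_geometric_sqrt) auto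
      also have "\<dots> \<le> 2 * c / ?s"
      proof -
        have "?s \<le> sqrt (4 * real n)" using False by (intro real_sqrt_le_mono) auto
        then have "?s \<le> 2 * sqrt (real n)" by (simp add: real_sqrt_mult)
        then have "1 / sqrt (real n) \<le> 2 / ?s" using False by (simp add: field_simps del: of_nat_Suc)
        from mult_left_mono[OF this c] show ?thesis by (simp add: mult.commute)
      qed
      finally show ?thesis .
    qed (use c in simp)
    then have "C * L * (\<Sum>i<n. r ^ i * (1 / sqrt (real (n - i)))) * B \<le> C * L * (2 * c / ?s) * B"
      using C L B by (intro mult_right_mono mult_left_mono) auto
    moreover have "C * r ^ n * B \<le> C * (c / ?s) * B" "C * r ^ Suc n * B \<le> C * (c / ?s) * B"
      "C * r ^ n * (L * B) \<le> C * (c / ?s) * (L * B)"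
    proof -
      have "r ^ Suc n \<le> r ^ n" using C by (intro power_decreasing) auto
      then have "r ^ Suc n \<le> c / ?s" using rpow[of n] by (rule order_trans)
      then show "C * r ^ Suc n * B \<le> C * (c / ?s) * B"
        using C B by (intro mult_right_mono mult_left_mono)
      show "C * r ^ n * B \<le> C * (c / ?s) * B" "C * r ^ n * (L * B) \<le> C * (c / ?s) * (L * B)"
        using C B L by (intro mult_right_mono mult_left_mono rpow; simp)+
    qed
    moreover have "K2 / ?s * B = (C * (c / ?s) * B + C * (c / ?s) * B) + C * (c / ?s) * (L * B) + C * L * (2 * c / ?s) * B"
      by (simp add: K2_def algebra_simps add_divide_distrib del: of_nat_Suc)
    ultimately show ?thesis by (elim lp_le_mono) linarith
  qed
  have K: "K1 \<ge> 0" "K2 \<ge> 0" using C L c by (simp_all add: K1_def K2_def)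
  show thesis
  proof (rule that)
    show "K1 + K2 \<ge> 0" using K by simp
    show "lp_le p (flow x n) ((K1 + K2) * B)" if "lp_le p x B" for x B n
      by (rule lp_le_mono[OF b1[OF that]]) (use K lp_leD(3)[OF that] in \<open>simp add: mult_right_mono\<close>)
    show "lp_le p (\<lambda>j. flow x (Suc n) j - flow x n j) ((K1 + K2) / sqrt (real (Suc n)) * B)"
      if "lp_le p x B" for x B n
      by (rule lp_le_mono[OF b2[OF that]])
        (use K lp_leD(3)[OF that] in \<open>auto intro!: mult_right_mono divide_right_mono\<close>)
  qed
qed

end

subsection \<open>Ergodic theory of the shift\<close>

definition shifts :: "nat \<Rightarrow> (int \<Rightarrow> 'a::real_normed_vector) \<Rightarrow> int \<Rightarrow> 'a" where
  "shifts n w = (\<lambda>j. \<Sum>i=1..n. w (j - int i))"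

lemma shift_mean_eq: "shift_mean T0 T1 x n = (\<lambda>j. (1 / real n) *\<^sub>R shifts n (M_op T0 T1 x) j)"
  by (simp add: shift_mean_def shifts_def right_shift_funpow)

lemma shifts_coboundary: "shifts n (\<lambda>j. h j - h (j - 1)) j = h (j - 1) - h (j - 1 - int n)"
  by (induction n) (simp_all add: shifts_def algebra_simps)

text \<open>The decomposition behind the mean ergodic theorem: average
  \<open>w - S^n w = (1 - S) (w + ... + S^(n-1) w)\<close> over \<open>n\<close>. As
  \<open>shifts\<close> begins with \<open>S^1\<close>, the argument is moved to
  \<open>j + 1\<close>. If all \<open>shifts n w\<close> up to \<open>N\<close> have norm at most
  \<open>H\<close>, so does \<open>h\<close>.\<close>

lemma mean_coboundary:
  fixes w :: "int \<Rightarrow> 'a::real_normed_vector"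
  assumes N: "1 \<le> N" and h: "h = (\<lambda>j. (1 / real N) *\<^sub>R (\<Sum>n=1..N. shifts n w (j + 1)))"
  shows "w j - (1 / real N) *\<^sub>R shifts N w j = h j - h (j - 1)"
proof -
  have "shifts n w (j + 1) - shifts n w (j - 1 + 1) = w j - w (j - int n)" for n
    by (induction n) (simp_all add: shifts_def algebra_simps)
  then have "(\<Sum>n=1..N. shifts n w (j + 1) - shifts n w (j - 1 + 1)) = real N *\<^sub>R w j - shifts N w j"
    by (simp add: sum_subtractf shifts_def sum_constant_scaleR del: sum_constant)
  then have "h j - h (j - 1) = (1 / real N) *\<^sub>R (real N *\<^sub>R w j - shifts N w j)"
    by (simp add: h sum_subtractf flip: scaleR_right_diff_distrib)
  then show ?thesis using N by (simp add: scaleR_right_diff_distrib)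
qed

lemma T_op_diff: "T_op T0 T1 (\<lambda>j. x j - y j) = (\<lambda>j. T_op T0 T1 x j - T_op T0 T1 y j)"
  by (simp add: T_op_def cmatrix_simps algebra_simps)

lemma T_op_add: "T_op T0 T1 (\<lambda>j. x j + y j) = (\<lambda>j. T_op T0 T1 x j + T_op T0 T1 y j)"
  by (simp add: T_op_def cmatrix_simps algebra_simps)

lemma solution_diff: "solution T0 T1 (\<lambda>j. x j - y j) n = (\<lambda>j. solution T0 T1 x n j - solution T0 T1 y n j)"
  by (induction n) (simp_all add: solution_def T_op_diff)

lemma solution_add: "solution T0 T1 (\<lambda>j. x j + y j) n = (\<lambda>j. solution T0 T1 x n j + solution T0 T1 y n j)"
  by (induction n) (simp_all add: solution_def T_op_add)

lemma solution_T_op: "solution T0 T1 (T_op T0 T1 x) n = solution T0 T1 x (Suc n)"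
  by (simp add: solution_def funpow_swap1)

lemma solution_fixed: "T_op T0 T1 z = z \<Longrightarrow> solution T0 T1 z n = z"
  by (induction n) (simp_all add: solution_def)

text \<open>Treats all \<open>p\<close> at once: for finite \<open>p\<close> only the zero constant
  lies in the space, and domination then forces \<open>z = 0\<close> as well.\<close>

lemma lp_const_seq:
  assumes "1 \<le> p" "const_seq y \<in> lp_space p" "norm z \<le> C * norm y" "0 \<le> C"
  shows "const_seq z \<in> lp_space p"
  using lp_dominated(1)[OF assms(1,2,4), of "const_seq z"] assms(3) by (simp add: const_seq_def)

context coupled_system
begin

lemma M_op_eq: "M_op T0 T1 x j = T1 *v (R *v x j)"
  by (simp add: M_op_def matrix_vector_mul_assoc)

lemma M_op_diff: "M_op T0 T1 (\<lambda>j. x j - y j) j = M_op T0 T1 x j - M_op T0 T1 y j"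
  by (simp add: M_op_eq cmatrix_simps)

text \<open>\<open>R (1 - T) x = x - R T1 S x\<close>, and \<open>T1 R T1 = T1\<close> removes the
  resolvent between the two copies of \<open>T1\<close>.\<close>

lemma M_op_coboundary: "M_op T0 T1 (\<lambda>j. x j - T_op T0 T1 x j) j = T1 *v x j - T1 *v x (j - 1)"
proof -
  have "R *v (x j - T_op T0 T1 x j) = x j - R *v (T1 *v x (j - 1))"
    using R_left[of "x j"] by (simp add: T_op_def cmatrix_simps algebra_simps)
  then show ?thesis by (simp add: M_op_eq cmatrix_simps T1_R_T1)
qed

text \<open>\<open>T1 R\<close> is idempotent, hence the identity on the values of
  \<open>M\<close>.\<close>

lemma T1_R_M_op: "T1 *v (R *v M_op T0 T1 x j) = M_op T0 T1 x j"
  by (simp add: M_op_eq T1_R_T1)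

text \<open>Splitting \<open>w = M x\<close> as \<open>(1 - S) h\<close> plus a mean \<open>\<epsilon>\<close>, the vector \<open>x - (1 - T) R h - \<kappa>\<inverse> R \<epsilon>\<close>
  lies in the kernel of \<open>M\<close>, on which \<open>1 - T\<close> is inverted by \<open>R\<close>.\<close>

lemma flow_mean_bound:
  obtains K where "K \<ge> 0"
    "\<And>x B H E N n. lp_le p x B \<Longrightarrow> 1 \<le> N \<Longrightarrow> (\<And>i. 1 \<le> i \<Longrightarrow> i \<le> N \<Longrightarrow> lp_le p (shifts i (M_op T0 T1 x)) H) \<Longrightarrow>
      lp_le p (\<lambda>j. (1 / real N) *\<^sub>R shifts N (M_op T0 T1 x) j) E \<Longrightarrow>
      lp_le p (flow x n) (K / sqrt (real (Suc n)) * (B + H + E) + K * E)"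
proof -
  obtain K where K: "K \<ge> 0" "\<And>x B n. lp_le p x B \<Longrightarrow> lp_le p (flow x n) (K * B)"
    "\<And>x B n. lp_le p x B \<Longrightarrow>
      lp_le p (\<lambda>j. flow x (Suc n) j - flow x n j) (K / sqrt (real (Suc n)) * B)"
    by (rule flow_bounds) blast
  obtain \<kappa> where \<kappa>: "\<kappa> \<ge> 1" "\<And>v. T1 *v (R *v (R *v (T1 *v v))) = \<kappa> *\<^sub>R (T1 *v v)"
    by (rule T1_R_R_T1) blast
  obtain c where c: "c \<ge> 0" "\<And>v. norm (R *v v) \<le> c * norm v" by (rule matrix_norm_bound) blast
  define Z where "Z = 2 * c + c * (c + K * c) + c * c"
  have Z: "Z \<ge> 0" using c K by (simp add: Z_def)
  show thesis
  proof (rule that)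
    show "K * Z + K * c \<ge> 0" using Z c K by simp
    fix x B H E N n
    assume x: "lp_le p x B" and N: "1 \<le> (N::nat)"
      and H: "\<And>i. 1 \<le> i \<Longrightarrow> i \<le> N \<Longrightarrow> lp_le p (shifts i (M_op T0 T1 x)) H"
      and E: "lp_le p (\<lambda>j. (1 / real N) *\<^sub>R shifts N (M_op T0 T1 x) j) E"
    define w where "w = M_op T0 T1 x"
    define h where "h = (\<lambda>j. (1 / real N) *\<^sub>R (\<Sum>n=1..N. shifts n w (j + 1)))"
    define e where "e = (\<lambda>j. (1 / real N) *\<^sub>R shifts N w j)"
    have e: "lp_le p e E" using E by (simp add: e_def w_def)
    have h: "lp_le p h H"
    proof -
      have "lp_le p h (\<bar>1 / real N\<bar> * (\<Sum>n=1..N. H))"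
        unfolding h_def
      proof (intro lp_le_scaleR lp_le_sum p)
        fix i assume "i \<in> {1..N}"
        then have "lp_le p (shifts i w) H" using H by (simp add: w_def)
        then show "lp_le p (\<lambda>j. shifts i w (j + 1)) H"
          using lp_shift_int[where x = "shifts i w" and a = "-1" and p = p] by (simp add: lp_le_def)
      qed
      then show ?thesis using N by simp
    qed
    have nonneg: "B \<ge> 0" "H \<ge> 0" "E \<ge> 0" using x h e lp_leD(3) by blast+
    have fix_w: "T1 *v (R *v w j) = w j" for j unfolding w_def by (rule T1_R_M_op)
    have fix_shifts: "T1 *v (R *v shifts i w j) = shifts i w j" for i j
      by (simp add: shifts_def vec.sum fix_w)
    have fix_h: "T1 *v (R *v h j) = h j" for j
      by (simp add: h_def cmatrix_scaleR vec.sum fix_shifts)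
    have fix_e: "T1 *v (R *v e j) = e j" for j
      by (simp add: e_def cmatrix_scaleR fix_shifts)
    have RR: "T1 *v (R *v (R *v e j)) = \<kappa> *\<^sub>R e j" for j
      using \<kappa>(2)[of "R *v e j"] by (simp add: fix_e)
    \<comment> \<open>Since \<open>T1 R h = h\<close>, the coboundary identity gives
      \<open>M (1 - T) x1 = (1 - S) h\<close>. Since \<open>M R e = \<kappa> e\<close>, the factor
      \<open>1 / \<kappa>\<close> in \<open>x2\<close> gives \<open>M x2 = e\<close>. Together these
      account for all of \<open>M x\<close>.\<close>
    define x1 where "x1 = (\<lambda>j. R *v h j)"
    define x2 where "x2 = (\<lambda>j. (1 / \<kappa>) *\<^sub>R (R *v e j))"
    define x3 where "x3 = (\<lambda>j. x j - (x1 j - T_op T0 T1 x1 j) - x2 j)"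
    define y where "y = (\<lambda>j. x1 j + R *v x3 j)"
    have M3: "T1 *v (R *v x3 j) = 0" for j
    proof -
      have "T1 *v (R *v x3 j) = M_op T0 T1 x j - M_op T0 T1 (\<lambda>j. x1 j - T_op T0 T1 x1 j) j - T1 *v (R *v x2 j)"
        by (simp add: x3_def M_op_eq cmatrix_simps)
      also have "\<dots> = w j - (h j - h (j - 1)) - e j"
        unfolding M_op_coboundary using \<kappa>(1)
        by (simp add: w_def x1_def fix_h x2_def cmatrix_scaleR RR)
      also have "\<dots> = 0" using mean_coboundary[OF N h_def, of j] by (simp add: e_def algebra_simps)
      finally show ?thesis .
    qed
    have x_eq: "x = (\<lambda>j. (y j - T_op T0 T1 y j) + x2 j)"
    proof
      fix j
      have "T_op T0 T1 (\<lambda>j. R *v x3 j) j = T0 *v (R *v x3 j)" by (simp add: T_op_def M3)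
      then have "R *v x3 j - T_op T0 T1 (\<lambda>j. R *v x3 j) j = x3 j" using R_right[of "x3 j"] by simp
      moreover have "x j = x3 j + (x1 j - T_op T0 T1 x1 j) + x2 j" by (simp add: x3_def)
      ultimately have "x j = (R *v x3 j - T_op T0 T1 (\<lambda>j. R *v x3 j) j) + (x1 j - T_op T0 T1 x1 j) + x2 j"
        by (simp only:)
      then show "x j = (y j - T_op T0 T1 y j) + x2 j"
        unfolding y_def T_op_add by (simp add: algebra_simps)
    qed
    \<comment> \<open>The increments of \<open>y\<close> decay like \<open>n^(-1/2)\<close>, whereas
      the trajectory of \<open>x2\<close> is merely bounded; this is why \<open>E\<close> also
      enters the final bound without a decaying factor.\<close>
    have flow_eq: "flow x n = (\<lambda>j. - (flow y (Suc n) j - flow y n j) + flow x2 n j)"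
      by (subst x_eq) (simp add: solution_add solution_diff solution_T_op)
    have "lp_le p x1 (c * H)" unfolding x1_def by (intro lp_le_matrix p h c)
    moreover have "lp_le p (T_op T0 T1 x1) (K * (c * H))"
      using K(2)[OF calculation, of 1] by (simp add: solution_def)
    moreover have x2: "lp_le p x2 (c * E)"
    proof -
      have "lp_le p x2 (\<bar>1 / \<kappa>\<bar> * (c * E))"
        unfolding x2_def by (intro lp_le_scaleR lp_le_matrix p e c)
      moreover have "\<bar>1 / \<kappa>\<bar> * (c * E) \<le> 1 * (c * E)"
        using \<kappa> c nonneg by (intro mult_right_mono) auto
      ultimately show ?thesis by (elim lp_le_mono) simp
    qed
    ultimately have "lp_le p y (c * H + c * (B + (c * H + K * (c * H)) + c * E))"
      unfolding y_def x3_def using x by (intro lp_le_add lp_le_matrix lp_le_diff p c)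
    moreover have "c * H + c * (B + (c * H + K * (c * H)) + c * E) \<le> Z * (B + H + E)"
      using c K nonneg by (simp add: Z_def algebra_simps)
    ultimately have y: "lp_le p y (Z * (B + H + E))" by (rule lp_le_mono)
    have "lp_le p (flow x n) (K / sqrt (real (Suc n)) * (Z * (B + H + E)) + K * (c * E))"
      unfolding flow_eq by (intro lp_le_add lp_le_uminus K y x2 p)
    moreover have "K / sqrt (real (Suc n)) * (Z * (B + H + E)) + K * (c * E)
        \<le> (K * Z + K * c) / sqrt (real (Suc n)) * (B + H + E) + (K * Z + K * c) * E"
    proof (rule add_mono)
      have "(K * Z) / sqrt (real (Suc n)) * (B + H + E) \<le> (K * Z + K * c) / sqrt (real (Suc n)) * (B + H + E)"
        using K c nonneg by (intro mult_right_mono divide_right_mono) auto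
      then show "K / sqrt (real (Suc n)) * (Z * (B + H + E)) \<le> (K * Z + K * c) / sqrt (real (Suc n)) * (B + H + E)"
        by (simp add: mult.assoc)
      show "K * (c * E) \<le> (K * Z + K * c) * E"
        using K Z nonneg by (simp add: algebra_simps)
    qed
    ultimately show "lp_le p (flow x n) ((K * Z + K * c) / sqrt (real (Suc n)) * (B + H + E) + (K * Z + K * c) * E)"
      by (rule lp_le_mono)
  qed
qed

text \<open>The inverse is explicit, \<open>L y = (1 / \<kappa>) R y\<close> for \<open>y\<close> in
  the range of \<open>T1\<close>, because \<open>T1 R R T1 = \<kappa> T1\<close>. The constant
  sequence is fixed by \<open>T\<close> since \<open>(1 - T0) R y = y = T1 R y\<close> on that
  range.\<close>

lemma L_map_props:
  assumes y: "y \<in> mat_range T1"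
  obtains C where "C \<ge> 0" "norm (L_map T0 T1 y) \<le> C * norm y"
    "T1 *v (R *v L_map T0 T1 y) = y" "T_op T0 T1 (const_seq (L_map T0 T1 y)) = const_seq (L_map T0 T1 y)"
proof -
  obtain \<kappa> where \<kappa>: "\<kappa> \<ge> 1" "\<And>v. T1 *v (R *v (R *v (T1 *v v))) = \<kappa> *\<^sub>R (T1 *v v)"
    by (rule T1_R_R_T1) blast
  obtain c where c: "c \<ge> 0" "\<And>v. norm (R *v v) \<le> c * norm v" by (rule matrix_norm_bound) blast
  obtain v where v: "y = T1 *v v" using y by (auto simp: mat_range_def)
  define z where "z = (1 / \<kappa>) *\<^sub>R (R *v y)"
  let ?A = "mat_range (R ** T1)"
  have range: "u \<in> ?A \<longleftrightarrow> (\<exists>v. u = R *v (T1 *v v))" for u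
    by (auto simp: mat_range_def simp flip: matrix_vector_mul_assoc)
  have Tz: "T1 *v (R *v z) = y"
    using \<kappa> by (simp add: z_def v cmatrix_scaleR)
  have inj: "inj_on (\<lambda>v. (T1 ** R) *v v) ?A"
  proof (rule inj_onI)
    fix u u' assume "u \<in> ?A" "u' \<in> ?A" and eq: "(T1 ** R) *v u = (T1 ** R) *v u'"
    then obtain a b where ab: "u = R *v (T1 *v a)" "u' = R *v (T1 *v b)" by (auto simp: range)
    have "\<kappa> *\<^sub>R (T1 *v a) = \<kappa> *\<^sub>R (T1 *v b)"
      using eq by (simp add: ab \<kappa>(2) flip: matrix_vector_mul_assoc)
    then show "u = u'" using \<kappa>(1) by (simp add: ab)
  qed
  have "z \<in> ?A" unfolding range
    by (rule exI[of _ "(1 / \<kappa>) *\<^sub>R v"]) (simp add: z_def v cmatrix_scaleR)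
  then have "L_map T0 T1 ((T1 ** R) *v z) = z"
    unfolding L_map_def by (rule inv_into_f_f[OF inj])
  then have L: "L_map T0 T1 y = z" using Tz by (simp flip: matrix_vector_mul_assoc)
  show thesis
  proof (rule that[of "c / \<kappa>"])
    show "0 \<le> c / \<kappa>" using c \<kappa> by simp
    show "norm (L_map T0 T1 y) \<le> c / \<kappa> * norm y"
      unfolding L z_def using c(2)[of y] \<kappa>(1) by (simp add: divide_right_mono)
    show "T1 *v (R *v L_map T0 T1 y) = y" using Tz by (simp add: L)
    have "T0 *v z + T1 *v z = z"
    proof -
      have "T0 *v (R *v y) = R *v y - y" using R_right[of y] by (simp add: algebra_simps)
      moreover have "T1 *v (R *v y) = y" by (simp add: v T1_R_T1)
      ultimately show ?thesis by (simp add: z_def cmatrix_scaleR flip: scaleR_add_right)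
    qed
    then show "T_op T0 T1 (const_seq (L_map T0 T1 y)) = const_seq (L_map T0 T1 y)"
      by (simp add: L T_op_def const_seq_def)
  qed
qed

section \<open>From convergent means to convergent solutions and back\<close>

lemma flow_in_lp: "x \<in> lp_space p \<Longrightarrow> flow x n \<in> lp_space p"
  using lp_bounded_op_T[OF p, of T0 T1]
  by (induction n) (auto simp: solution_def lp_bounded_op_def)

lemma M_op_in_lp: "x \<in> lp_space p \<Longrightarrow> M_op T0 T1 x \<in> lp_space p"
  using lp_bounded_op_M[OF p, of T0 T1] by (auto simp: lp_bounded_op_def)

lemma lp_le_shifts: "lp_le p w B \<Longrightarrow> lp_le p (shifts n w) (real n * B)"
  using lp_le_sum[OF p, of "{1..n}" "\<lambda>i j. w (j - int i)" "\<lambda>_. B"] lp_le_shift_n[of p w B]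
  by (auto simp: shifts_def)

lemma lp_le_mean:
  assumes w: "lp_le p w B"
  shows "lp_le p (\<lambda>j. (1 / real n) *\<^sub>R shifts n w j) B"
proof -
  have "lp_le p (\<lambda>j. (1 / real n) *\<^sub>R shifts n w j) (\<bar>1 / real n\<bar> * (real n * B))"
    by (intro lp_le_scaleR lp_le_shifts p w)
  then show ?thesis using lp_leD(3)[OF w] by (elim lp_le_mono) auto
qed

lemma shift_mean_in_lp: "x \<in> lp_space p \<Longrightarrow> shift_mean T0 T1 x n \<in> lp_space p"
  unfolding shift_mean_eq by (rule lp_leD(1)[OF lp_le_mean[OF lp_le_self[OF M_op_in_lp]]])

text \<open>Apply \<open>flow_mean_bound\<close> to \<open>x - z\<close>, with \<open>z\<close> the
  constant fixed point: \<open>M z = y\<close> centres the means at their limit. The order of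
  quantifiers is the point, as \<open>B\<close> depends only on \<open>x\<close> and
  \<open>y\<close>, while \<open>H\<close>, \<open>N\<close> and \<open>n\<close> stay free.\<close>

lemma flow_limit_bound:
  obtains K where "K \<ge> 0" "\<And>x y. x \<in> lp_space p \<Longrightarrow> mean_limit p T0 T1 x y \<Longrightarrow>
      const_seq (L_map T0 T1 y) \<in> lp_space p \<and>
      (\<exists>B. \<forall>H N n. 1 \<le> N \<longrightarrow>
        (\<forall>i. 1 \<le> i \<and> i \<le> N \<longrightarrow> real i * lp_dist p (shift_mean T0 T1 x i) (const_seq y) \<le> H) \<longrightarrow>
        lp_dist p (flow x n) (const_seq (L_map T0 T1 y))
          \<le> K / sqrt (real (Suc n)) * (B + H + lp_dist p (shift_mean T0 T1 x N) (const_seq y))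
             + K * lp_dist p (shift_mean T0 T1 x N) (const_seq y))"
proof -
  obtain K where K: "K \<ge> 0"
    "\<And>x B H E N n. lp_le p x B \<Longrightarrow> 1 \<le> N \<Longrightarrow> (\<And>i. 1 \<le> i \<Longrightarrow> i \<le> N \<Longrightarrow> lp_le p (shifts i (M_op T0 T1 x)) H) \<Longrightarrow>
      lp_le p (\<lambda>j. (1 / real N) *\<^sub>R shifts N (M_op T0 T1 x) j) E \<Longrightarrow>
      lp_le p (flow x n) (K / sqrt (real (Suc n)) * (B + H + E) + K * E)"
    by (rule flow_mean_bound) blast
  show thesis
  proof (rule that[OF K(1)], intro conjI)
    fix x y assume x: "x \<in> lp_space p" and lim: "mean_limit p T0 T1 x y"
    have y: "y \<in> mat_range T1" "const_seq y \<in> lp_space p" using lim by (auto simp: mean_limit_def)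
    define z where "z = L_map T0 T1 y"
    obtain C where C: "C \<ge> 0" "norm z \<le> C * norm y" "T1 *v (R *v z) = y"
        "T_op T0 T1 (const_seq z) = const_seq z"
      using L_map_props[OF y(1)] unfolding z_def by metis
    show z: "const_seq (L_map T0 T1 y) \<in> lp_space p"
      using lp_const_seq[OF p y(2) C(2,1)] by (simp add: z_def)
    define d where "d = (\<lambda>n. lp_dist p (shift_mean T0 T1 x n) (const_seq y))"
    define x' where "x' = (\<lambda>j. x j - const_seq z j)"
    have x': "x' \<in> lp_space p"
      unfolding x'_def using lp_le_diff[OF p lp_le_self[OF x] lp_le_self[OF z]] by (auto simp: z_def dest: lp_leD)
    have Mx': "M_op T0 T1 x' = (\<lambda>j. M_op T0 T1 x j - y)"
      unfolding x'_def by (intro ext, subst M_op_diff) (simp add: M_op_eq const_seq_def C)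
    have sh: "shifts i (M_op T0 T1 x') j = real i *\<^sub>R (shift_mean T0 T1 x i j - const_seq y j)"
      if "1 \<le> i" for i j
      using that unfolding Mx'
      by (simp add: shifts_def shift_mean_eq const_seq_def sum_subtractf sum_constant_scaleR
          scaleR_right_diff_distrib del: sum_constant)
    have dn: "lp_le p (\<lambda>j. shift_mean T0 T1 x n j - const_seq y j) (d n)" for n
      using lp_le_diff[OF p lp_le_self[OF shift_mean_in_lp[OF x]] lp_le_self[OF y(2)]]
      by (auto simp: lp_le_def d_def lp_dist_def)
    have fl: "lp_dist p (flow x n) (const_seq z) = lp_norm p (flow x' n)" for n
      unfolding x'_def solution_diff solution_fixed[OF C(4)] lp_dist_def ..
    have "lp_dist p (flow x n) (const_seq z) \<le> K / sqrt (real (Suc n)) * (lp_norm p x' + H + d N) + K * d N"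
      if N: "1 \<le> N" and H: "\<And>i. 1 \<le> i \<Longrightarrow> i \<le> N \<Longrightarrow> real i * d i \<le> H" for N n H
      unfolding fl
    proof (rule lp_leD(2), rule K(2)[OF lp_le_self[OF x'] N])
      fix i assume i: "1 \<le> i" "i \<le> N"
      have "lp_le p (shifts i (M_op T0 T1 x')) (\<bar>real i\<bar> * d i)"
        unfolding ext[of "shifts i (M_op T0 T1 x')", OF sh[OF i(1)]] by (rule lp_le_scaleR[OF p dn])
      then show "lp_le p (shifts i (M_op T0 T1 x')) H" using H[OF i] by (elim lp_le_mono) simp
    next
      have "(\<lambda>j. (1 / real N) *\<^sub>R shifts N (M_op T0 T1 x') j) = (\<lambda>j. shift_mean T0 T1 x N j - const_seq y j)"
        using N by (simp add: sh[OF N])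
      then show "lp_le p (\<lambda>j. (1 / real N) *\<^sub>R shifts N (M_op T0 T1 x') j) (d N)"
        using dn[of N] by simp
    qed
    then show "\<exists>B. \<forall>H N n. 1 \<le> N \<longrightarrow>
        (\<forall>i. 1 \<le> i \<and> i \<le> N \<longrightarrow> real i * lp_dist p (shift_mean T0 T1 x i) (const_seq y) \<le> H) \<longrightarrow>
        lp_dist p (flow x n) (const_seq (L_map T0 T1 y))
          \<le> K / sqrt (real (Suc n)) * (B + H + lp_dist p (shift_mean T0 T1 x N) (const_seq y))
             + K * lp_dist p (shift_mean T0 T1 x N) (const_seq y)"
      unfolding d_def z_def by blast
  qed
qed


lemma inverse_sqrt_null: "(\<lambda>n. c / sqrt (real (Suc n)) :: real) \<longlonglongrightarrow> 0"
proof -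
  have "filterlim (\<lambda>n. sqrt (real (Suc n))) at_top sequentially"
    by (intro filterlim_compose[OF sqrt_at_top] filterlim_compose[OF filterlim_real_sequentially] filterlim_Suc)
  then show ?thesis
    by (intro tendsto_divide_0[OF tendsto_const] filterlim_at_top_imp_at_infinity)
qed

lemma lp_dist_nonneg: "x \<in> lp_space p \<Longrightarrow> y \<in> lp_space p \<Longrightarrow> 0 \<le> lp_dist p (x :: int \<Rightarrow> complex^'m) y"
  using lp_le_diff[OF p lp_le_self[of x] lp_le_self[of y]] by (auto simp: lp_dist_def lp_le_def intro: lp_norm_nonneg)

lemma mean_limitD:
  assumes "mean_limit p T0 T1 x y"
  shows "y \<in> mat_range T1" "const_seq y \<in> lp_space p"
    "(\<lambda>n. lp_dist p (shift_mean T0 T1 x n) (const_seq y)) \<longlonglongrightarrow> 0"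
    "\<And>n. 0 \<le> lp_dist p (shift_mean T0 T1 x n) (const_seq y)"
  using assms by (auto simp: mean_limit_def lp_tendsto_def intro!: lp_dist_nonneg)

text \<open>First \<open>N\<close> is chosen to make the undamped mean error small; then
  \<open>n\<close> is taken large enough to suppress the rest, in which \<open>H\<close> depends on
  \<open>N\<close> but not on \<open>n\<close>.\<close>

lemma flow_tendsto:
  assumes x: "x \<in> lp_space p" and lim: "mean_limit p T0 T1 x y"
  shows "lp_tendsto p (flow x) (const_seq (L_map T0 T1 y))"
proof -
  define d where "d = (\<lambda>n. lp_dist p (shift_mean T0 T1 x n) (const_seq y))"
  obtain K where K: "K \<ge> 0" "const_seq (L_map T0 T1 y) \<in> lp_space p"
      "\<exists>B. \<forall>H N n. 1 \<le> N \<longrightarrow> (\<forall>i. 1 \<le> i \<and> i \<le> N \<longrightarrow> real i * d i \<le> H) \<longrightarrow>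
        lp_dist p (flow x n) (const_seq (L_map T0 T1 y))
          \<le> K / sqrt (real (Suc n)) * (B + H + d N) + K * d N"
    using flow_limit_bound x lim unfolding d_def by metis
  then obtain B where B: "\<And>H N n. 1 \<le> N \<Longrightarrow> (\<And>i. 1 \<le> i \<Longrightarrow> i \<le> N \<Longrightarrow> real i * d i \<le> H) \<Longrightarrow>
        lp_dist p (flow x n) (const_seq (L_map T0 T1 y))
          \<le> K / sqrt (real (Suc n)) * (B + H + d N) + K * d N" by blast
  have d: "d \<longlonglongrightarrow> 0" "\<And>n. 0 \<le> d n" using mean_limitD[OF lim] by (simp_all add: d_def)
  let ?D = "\<lambda>n. lp_dist p (flow x n) (const_seq (L_map T0 T1 y))"
  have D: "0 \<le> ?D n" for n by (intro lp_dist_nonneg flow_in_lp x K)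
  have "?D \<longlonglongrightarrow> 0"
  proof (rule order_tendstoI)
    fix a :: real assume "0 < a"
    have "(\<lambda>n. K * d n) \<longlonglongrightarrow> 0" by (intro tendsto_mult_right_zero d)
    then have "\<forall>\<^sub>F n in sequentially. K * d n < a / 2"
      using \<open>0 < a\<close> by (intro order_tendstoD(2)[of _ 0]) auto
    then have "\<forall>\<^sub>F n in sequentially. K * d n < a / 2 \<and> 1 \<le> n"
      using eventually_ge_at_top[of 1] by eventually_elim simp
    then obtain N where N: "K * d N < a / 2" "1 \<le> N"
      by (auto simp: eventually_sequentially)
    define H where "H = (\<Sum>i\<le>N. real i * d i)"
    have H: "real i * d i \<le> H" if "i \<le> N" for i
      unfolding H_def using that d by (intro member_le_sum) auto
    have "\<forall>\<^sub>F n in sequentially. K * (B + H + d N) / sqrt (real (Suc n)) < a / 2"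
      using \<open>0 < a\<close> by (intro order_tendstoD(2)[OF inverse_sqrt_null]) auto
    then show "\<forall>\<^sub>F n in sequentially. ?D n < a"
    proof eventually_elim
      case (elim n)
      moreover have "?D n \<le> K * (B + H + d N) / sqrt (real (Suc n)) + K * d N"
        using B[OF N(2) H, of n] by simp
      ultimately show ?case using N(1) by linarith
    qed
  next
    fix a :: real assume "a < 0"
    then show "\<forall>\<^sub>F n in sequentially. a < ?D n"
      using D by (intro always_eventually allI) (rule less_le_trans)
  qed
  then show ?thesis using K x by (auto simp: lp_tendsto_def intro: flow_in_lp)
qed

text \<open>The rate \<open>O(1/n)\<close> says that the centred sums of shifts are bounded, so one
  \<open>H\<close> serves for every \<open>N\<close>. Letting \<open>N\<close> tend to infinity
  removes the mean error.\<close>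

lemma limit_rate_sqrt: "limit_rate p T0 T1 (\<lambda>n. real n powr (-1/2))"
  unfolding limit_rate_def
proof (intro ballI allI impI, elim conjE)
  fix x y assume x: "x \<in> lp_space p" and lim: "mean_limit p T0 T1 x y"
    and O: "(\<lambda>n. lp_dist p (shift_mean T0 T1 x n) (const_seq y)) \<in> O(\<lambda>n. 1 / real n)"
  define d where "d = (\<lambda>n. lp_dist p (shift_mean T0 T1 x n) (const_seq y))"
  have d: "d \<longlonglongrightarrow> 0" "\<And>n. 0 \<le> d n" using mean_limitD[OF lim] by (simp_all add: d_def)
  obtain K B where K: "K \<ge> 0" "const_seq (L_map T0 T1 y) \<in> lp_space p"
      and B: "\<And>H N n. 1 \<le> N \<Longrightarrow> (\<And>i. 1 \<le> i \<Longrightarrow> i \<le> N \<Longrightarrow> real i * d i \<le> H) \<Longrightarrow>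
        lp_dist p (flow x n) (const_seq (L_map T0 T1 y))
          \<le> K / sqrt (real (Suc n)) * (B + H + d N) + K * d N"
  proof -
    obtain K where K: "K \<ge> 0" "const_seq (L_map T0 T1 y) \<in> lp_space p"
      "\<exists>B. \<forall>H N n. 1 \<le> N \<longrightarrow> (\<forall>i. 1 \<le> i \<and> i \<le> N \<longrightarrow> real i * d i \<le> H) \<longrightarrow>
        lp_dist p (flow x n) (const_seq (L_map T0 T1 y))
          \<le> K / sqrt (real (Suc n)) * (B + H + d N) + K * d N"
      using flow_limit_bound x lim unfolding d_def by metis
    then show thesis using that by blast
  qed
  obtain c n0 where c: "c > 0" "\<And>n. n0 \<le> n \<Longrightarrow> norm (d n) \<le> c * norm (1 / real n)"
    using O unfolding d_def by (elim landau_o.bigE) (auto simp: eventually_sequentially)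
  \<comment> \<open>\<open>c\<close> covers the indices from \<open>n0\<close> on, the finite sum
    those before.\<close>
  define H where "H = c + (\<Sum>i<n0. real i * d i)"
  have H: "real i * d i \<le> H" if "1 \<le> i" for i
  proof (cases "n0 \<le> i")
    case True
    have "d i \<le> c / real i" using c(2)[OF True] d(2)[of i] by simp
    then have "real i * d i \<le> c" using that by (simp add: field_simps)
    also have "c \<le> H" unfolding H_def using d by (simp add: sum_nonneg)
    finally show ?thesis .
  next
    case False
    then have "real i * d i \<le> (\<Sum>i<n0. real i * d i)"
      using d by (intro member_le_sum) auto
    then show ?thesis using c by (simp add: H_def)
  qed
  let ?D = "\<lambda>n. lp_dist p (flow x n) (const_seq (L_map T0 T1 y))"
  have D: "?D n \<le> K / sqrt (real (Suc n)) * (B + H)" for n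
  proof (rule LIMSEQ_le_const)
    show "(\<lambda>N. K / sqrt (real (Suc n)) * (B + H + d N) + K * d N)
        \<longlonglongrightarrow> K / sqrt (real (Suc n)) * (B + H)"
      using d(1) by (auto intro!: tendsto_eq_intros)
    show "\<exists>N. \<forall>n'\<ge>N. ?D n \<le> K / sqrt (real (Suc n)) * (B + H + d n') + K * d n'"
      using B H by (intro exI[of _ 1]) auto
  qed
  show "?D \<in> O(\<lambda>n. real n powr (-1/2))"
  proof (rule bigoI[where c = "K * \<bar>B + H\<bar>"], rule eventually_mono[OF eventually_gt_at_top[of 0]])
    fix n :: nat assume n: "0 < n"
    have "?D n \<le> 1 / sqrt (real (Suc n)) * (K * (B + H))" using D[of n] by simp
    also have "\<dots> \<le> 1 / sqrt (real (Suc n)) * (K * \<bar>B + H\<bar>)"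
      using K by (intro mult_left_mono) auto
    also have "\<dots> \<le> 1 / sqrt (real n) * (K * \<bar>B + H\<bar>)"
      using n K by (intro mult_right_mono divide_left_mono real_sqrt_le_mono) auto
    also have "1 / sqrt (real n) = real n powr (-1/2)"
      using n by (simp add: powr_minus_divide powr_half_sqrt)
    finally show "norm (?D n) \<le> K * \<bar>B + H\<bar> * norm (real n powr (-1/2))"
      using lp_dist_nonneg[OF flow_in_lp[OF x, of n] K(2)] by (simp add: mult.commute)
  qed
qed

lemma L_map_0: "L_map T0 T1 0 = 0"
proof -
  have "0 \<in> mat_range T1" unfolding mat_range_def by (rule range_eqI[of _ _ 0]) simp
  from L_map_props[OF this] show ?thesis by (metis mult_zero_right norm_le_zero_iff norm_zero)
qed

text \<open>\<open>M\<close> maps \<open>x - T x\<close> to a coboundary, whose means are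
  \<open>O(1/n)\<close> with limit 0, and the trajectory of \<open>x - T x\<close> consists of the
  negated increments of \<open>x\<close>. Used directly for the increment rate, and contraposed for
  the optimality of the limit rate.\<close>

lemma increment_rate_if_limit_rate:
  assumes "limit_rate p T0 T1 r"
  shows "increment_rate p T0 T1 r"
  unfolding increment_rate_def
proof
  fix x :: "int \<Rightarrow> complex^'m" assume x: "x \<in> lp_space p"
  define x0 where "x0 = (\<lambda>j. x j - T_op T0 T1 x j)"
  have zero: "const_seq 0 \<in> lp_space p" "(0 :: complex^'m) \<in> mat_range T1"
    unfolding const_seq_def mat_range_def by (simp, rule range_eqI[of _ _ 0], simp)
  have Tx: "T_op T0 T1 x \<in> lp_space p" using flow_in_lp[OF x, of 1] by (simp add: solution_def)
  have x0: "x0 \<in> lp_space p"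
    unfolding x0_def by (rule lp_leD(1)[OF lp_le_diff[OF p lp_le_self[OF x] lp_le_self[OF Tx]]])
  obtain D where D: "D \<ge> 0" "\<And>v. norm (T1 *v v) \<le> D * norm v" by (rule matrix_norm_bound) blast
  define B where "B = D * lp_norm p x"
  have h: "lp_le p (\<lambda>j. T1 *v x j) B" unfolding B_def by (intro lp_le_matrix p lp_le_self x D)
  have M: "M_op T0 T1 x0 = (\<lambda>j. T1 *v x j - T1 *v x (j - 1))"
    unfolding x0_def by (rule ext) (rule M_op_coboundary)
  have "lp_le p (shift_mean T0 T1 x0 n) (1 / real n * (B + B))" for n
  proof -
    have "lp_le p (\<lambda>j. (1 / real n) *\<^sub>R shifts n (M_op T0 T1 x0) j) (\<bar>1 / real n\<bar> * (B + B))"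
      unfolding M shifts_coboundary[of n "\<lambda>j. T1 *v x j"]
      using lp_le_shift_n[OF lp_le_shift[OF h], of n]
      by (intro lp_le_scaleR lp_le_diff p lp_le_shift[OF h]) (simp add: algebra_simps)
    then show ?thesis by (simp add: shift_mean_eq)
  qed
  then have d: "lp_dist p (shift_mean T0 T1 x0 n) (const_seq 0) \<le> 1 / real n * (B + B)"
      "0 \<le> lp_dist p (shift_mean T0 T1 x0 n) (const_seq 0)" for n
    by (auto simp: lp_dist_def const_seq_def dest: lp_leD intro: lp_norm_nonneg)
  have "(\<lambda>n. lp_dist p (shift_mean T0 T1 x0 n) (const_seq 0)) \<longlonglongrightarrow> 0"
  proof (rule tendsto_sandwich[OF always_eventually always_eventually tendsto_const])
    show "(\<lambda>n. 1 / real n * (B + B)) \<longlonglongrightarrow> 0" by (intro tendsto_mult_left_zero lim_1_over_n)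
  qed (use d in auto)
  then have "mean_limit p T0 T1 x0 0"
    using zero x0 by (auto simp: mean_limit_def lp_tendsto_def intro: shift_mean_in_lp)
  moreover have "(\<lambda>n. lp_dist p (shift_mean T0 T1 x0 n) (const_seq 0)) \<in> O(\<lambda>n. 1 / real n)"
    by (rule bigoI[where c = "B + B"]) (use d in \<open>auto simp: mult.commute intro!: always_eventually\<close>)
  ultimately have "(\<lambda>n. lp_dist p (flow x0 n) (const_seq (L_map T0 T1 0))) \<in> O(r)"
    using assms x0 unfolding limit_rate_def by blast
  moreover have "lp_dist p (flow x0 n) (const_seq (L_map T0 T1 0)) = lp_dist p (flow x (Suc n)) (flow x n)" for n
  proof -
    have le: "lp_norm p (\<lambda>j. - y j) \<le> lp_norm p y" if "y \<in> lp_space p" for y :: "int \<Rightarrow> complex^'m"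
      using lp_leD(2)[OF lp_le_uminus[OF p lp_le_self[OF that]]] .
    have inc: "(\<lambda>j. flow x n j - flow x (Suc n) j) \<in> lp_space p" "(\<lambda>j. flow x (Suc n) j - flow x n j) \<in> lp_space p"
      by (rule lp_leD(1)[OF lp_le_diff[OF p lp_le_self[OF flow_in_lp[OF x]] lp_le_self[OF flow_in_lp[OF x]]]])+
    have "lp_norm p (\<lambda>j. flow x n j - flow x (Suc n) j) = lp_norm p (\<lambda>j. flow x (Suc n) j - flow x n j)"
      using le[OF inc(1)] le[OF inc(2)] by simp
    then show ?thesis
      by (simp add: lp_dist_def L_map_0 const_seq_def x0_def solution_diff solution_T_op)
  qed
  ultimately show "(\<lambda>n. lp_dist p (flow x (Suc n)) (flow x n)) \<in> O(r)" by simp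
qed

text \<open>The limit \<open>z\<close> is fixed by \<open>T\<close>, so \<open>z = R T1 S z\<close>;
  applying \<open>T1\<close> shows that \<open>T1 z\<close> is invariant under the shift, hence
  \<open>z\<close> is constant. For the means, \<open>M x - M T^N x\<close> telescopes to a
  coboundary, whose mean is \<open>O(1/n)\<close> for fixed \<open>N\<close>, while
  \<open>M (T^N x - z)\<close> is small for large \<open>N\<close> and averaging does not enlarge
  it.\<close>

lemma mean_limit_if_flow_tendsto:
  assumes x: "x \<in> lp_space p" and lim: "lp_tendsto p (flow x) z"
  shows "\<exists>y. mean_limit p T0 T1 x y"
proof -
  have z: "z \<in> lp_space p" and dist: "(\<lambda>n. lp_dist p (flow x n) z) \<longlonglongrightarrow> 0"
    using lim by (auto simp: lp_tendsto_def)
  have diff: "(\<lambda>j. flow x n j - z j) \<in> lp_space p" for n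
    by (rule lp_leD(1)[OF lp_le_diff[OF p lp_le_self[OF flow_in_lp[OF x]] lp_le_self[OF z]]])
  have pt: "(\<lambda>n. flow x n j) \<longlonglongrightarrow> z j" for j
  proof (rule Lim_transform_bound[OF _ dist, THEN LIM_zero_cancel])
    show "\<forall>\<^sub>F n in sequentially. norm (flow x n j - z j) \<le> norm (lp_dist p (flow x n) z)"
      using norm_le_lp_norm[OF p diff, where i = j] unfolding lp_dist_def
      by (intro always_eventually allI) (simp add: abs_of_nonneg[OF lp_norm_nonneg[OF diff]])
  qed
  have fixed: "z j = T0 *v z j + T1 *v z (j - 1)" for j
  proof (rule LIMSEQ_unique)
    show "(\<lambda>n. flow x (Suc n) j) \<longlonglongrightarrow> z j" by (rule LIMSEQ_Suc[OF pt])
    show "(\<lambda>n. flow x (Suc n) j) \<longlonglongrightarrow> T0 *v z j + T1 *v z (j - 1)"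
      unfolding solution_Suc
      by (intro tendsto_add bounded_linear.tendsto[OF bounded_linear_cmatrix] pt)
  qed
  have zR: "z j = R *v (T1 *v z (j - 1))" for j
  proof -
    have "z j - T0 *v z j = T1 *v z (j - 1)" using fixed[of j] by (simp only: diff_eq_eq add.commute)
    with R_left[of "z j"] show ?thesis by simp
  qed
  have T1z: "T1 *v z j = T1 *v z (j - 1)" for j
    by (subst zR) (rule T1_R_T1)
  have const_nat: "T1 *v z (j + int n) = T1 *v z j" for j :: int and n
  proof (induction n)
    case (Suc n)
    show ?case using T1z[of "j + int (Suc n)"] Suc by (simp add: algebra_simps)
  qed simp
  have T1z0: "T1 *v z j = T1 *v z 0" for j
    using const_nat[where j = j and n = "nat (- j)"] const_nat[where j = 0 and n = "nat j"] by (cases "0 \<le> j") auto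
  define v where "v = z 0"
  have zv: "z = const_seq v"
  proof
    fix j
    have "z i = R *v (T1 *v z 0)" for i
      using zR[of i] arg_cong[OF T1z0[of "i - 1"], of "(*v) R"] by (rule trans)
    from trans[OF this[of j] this[of 0, symmetric]] show "z j = const_seq v j"
      by (simp add: const_seq_def v_def)
  qed
  define y where "y = T1 *v (R *v v)"
  obtain c where c: "c \<ge> 0" "\<And>v. norm ((T1 ** R) *v v) \<le> c * norm v" by (rule matrix_norm_bound) blast
  have c': "norm (T1 *v (R *v v)) \<le> c * norm v" for v using c(2)[of v] by (simp flip: matrix_vector_mul_assoc)
  have y: "const_seq y \<in> lp_space p"
  proof (rule lp_const_seq[OF p _ _ c(1)])
    show "const_seq v \<in> lp_space p" using z zv by (rule subst[rotated])
    show "norm y \<le> c * norm v" unfolding y_def by (rule c')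
  qed
  obtain D where D: "D \<ge> 0" "\<And>v. norm (T1 *v v) \<le> D * norm v" by (rule matrix_norm_bound) blast
  define a where "a = (\<lambda>N. \<Sum>i<N. D * lp_norm p (flow x i))"
  have bound: "lp_dist p (shift_mean T0 T1 x n) (const_seq y)
      \<le> 1 / real n * (a N + a N) + c * lp_dist p (flow x N) z" if n: "1 \<le> n" for n N
  proof -
    define h where "h = (\<lambda>j. \<Sum>i<N. T1 *v flow x i j)"
    have h: "lp_le p h (a N)"
      unfolding h_def a_def by (intro lp_le_sum p lp_le_matrix lp_le_self flow_in_lp x D)
    have "M_op T0 T1 x j - M_op T0 T1 (flow x N) j
        = (\<Sum>i<N. T1 *v flow x i j) - (\<Sum>i<N. T1 *v flow x i (j - 1))" for j
    proof (induction N)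
      case (Suc N)
      have "M_op T0 T1 (flow x N) j - M_op T0 T1 (flow x (Suc N)) j = T1 *v flow x N j - T1 *v flow x N (j - 1)"
        using M_op_coboundary[of "flow x N" j] by (simp add: M_op_diff solution_def)
      with Suc show ?case by (simp add: algebra_simps)
    qed simp
    then have tele: "M_op T0 T1 x j - M_op T0 T1 (flow x N) j = h j - h (j - 1)" for j
      by (simp add: h_def)
    have "M_op T0 T1 x j - y = (h j - h (j - 1)) + M_op T0 T1 (\<lambda>j. flow x N j - z j) j" for j
      unfolding tele[symmetric] zv by (simp add: M_op_diff M_op_eq const_seq_def y_def)
    then have w: "(\<lambda>j. M_op T0 T1 x j - y) = (\<lambda>j. (h j - h (j - 1)) + M_op T0 T1 (\<lambda>j. flow x N j - z j) j)"
      by blast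
    have "(\<lambda>j. shift_mean T0 T1 x n j - const_seq y j) = (\<lambda>j. (1 / real n) *\<^sub>R shifts n (\<lambda>j. M_op T0 T1 x j - y) j)"
      using n by (simp add: shifts_def shift_mean_eq const_seq_def sum_subtractf sum_constant_scaleR
          scaleR_right_diff_distrib del: sum_constant)
    also have "\<dots> = (\<lambda>j. (1 / real n) *\<^sub>R (h (j - 1) - h (j - 1 - int n))
        + (1 / real n) *\<^sub>R shifts n (M_op T0 T1 (\<lambda>j. flow x N j - z j)) j)"
      unfolding w using shifts_coboundary[of n h]
      by (simp add: shifts_def sum.distrib scaleR_add_right)
    finally have eq: "(\<lambda>j. shift_mean T0 T1 x n j - const_seq y j) = \<dots>" .
    have "lp_le p (\<lambda>j. shift_mean T0 T1 x n j - const_seq y j)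
        (\<bar>1 / real n\<bar> * (a N + a N) + c * lp_dist p (flow x N) z)"
      unfolding eq
    proof (intro lp_le_add lp_le_scaleR lp_le_diff p lp_le_mean)
      show "lp_le p (\<lambda>j. h (j - 1)) (a N)" by (rule lp_le_shift[OF h])
      show "lp_le p (\<lambda>j. h (j - 1 - int n)) (a N)"
        using lp_le_shift_n[OF lp_le_shift[OF h], of n] by (simp add: algebra_simps)
      show "lp_le p (M_op T0 T1 (\<lambda>j. flow x N j - z j)) (c * lp_dist p (flow x N) z)"
        unfolding lp_dist_def using c' by (intro lp_le_dominated[OF p lp_le_self[OF diff] c(1)]) (simp add: M_op_eq)
    qed
    then show ?thesis by (simp add: lp_dist_def lp_le_def)
  qed
  have "(\<lambda>n. lp_dist p (shift_mean T0 T1 x n) (const_seq y)) \<longlonglongrightarrow> 0"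
  proof (rule order_tendstoI)
    fix b :: real assume "b < 0"
    then show "\<forall>\<^sub>F n in sequentially. b < lp_dist p (shift_mean T0 T1 x n) (const_seq y)"
      using lp_dist_nonneg[OF shift_mean_in_lp[OF x] y] by (intro always_eventually allI) (rule less_le_trans)
  next
    fix b :: real assume b: "0 < b"
    have "(\<lambda>n. c * lp_dist p (flow x n) z) \<longlonglongrightarrow> 0" by (intro tendsto_mult_right_zero dist)
    then have "\<forall>\<^sub>F n in sequentially. c * lp_dist p (flow x n) z < b / 2"
      using b by (intro order_tendstoD(2)[of _ 0]) auto
    then obtain N where N: "c * lp_dist p (flow x N) z < b / 2"
      by (auto simp: eventually_sequentially)
    have "(\<lambda>n. 1 / real n * (a N + a N)) \<longlonglongrightarrow> 0" by (intro tendsto_mult_left_zero lim_1_over_n)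
    then have "\<forall>\<^sub>F n in sequentially. 1 / real n * (a N + a N) < b / 2"
      using b by (intro order_tendstoD(2)[of _ 0]) auto
    then show "\<forall>\<^sub>F n in sequentially. lp_dist p (shift_mean T0 T1 x n) (const_seq y) < b"
      using eventually_ge_at_top[of 1]
    proof eventually_elim
      case (elim n)
      then show ?case using bound[of n N] N by linarith
    qed
  qed
  then have "mean_limit p T0 T1 x y"
    using y x by (auto simp: mean_limit_def lp_tendsto_def y_def mat_range_def intro: shift_mean_in_lp)
  then show ?thesis ..
qed

end

subsection \<open>Optimality of the rates\<close>

lemma lp_finite_support:
  fixes x :: "int \<Rightarrow> 'a::real_normed_vector"
  assumes "finite A" "\<And>j. j \<notin> A \<Longrightarrow> x j = 0"
  shows "x \<in> lp_space p"
proof (cases "p = \<infinity>")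
  case True
  have "range x \<subseteq> insert 0 (x ` A)" using assms(2) by auto
  then have "finite (range x)" by (rule finite_subset) (use assms(1) in auto)
  then show ?thesis using True by (simp add: lp_space_def finite_imp_bounded)
next
  case False
  have "(\<lambda>j. norm (x j) powr enn2real p) summable_on UNIV \<longleftrightarrow> (\<lambda>j. norm (x j) powr enn2real p) summable_on A"
    by (rule summable_on_cong_neutral) (use assms(2) in auto)
  then show ?thesis using False assms(1) by (simp add: lp_space_def)
qed

text \<open>Finite speed of propagation, to the right only. This is what hides a truncation from the
  far part of a window.\<close>

lemma solution_local:
  assumes "\<And>i. j - int n \<le> i \<Longrightarrow> i \<le> j \<Longrightarrow> x i = y i"
  shows "solution T0 T1 x n j = solution T0 T1 y n j"
  using assms
proof (induction n arbitrary: j)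
  case (Suc n)
  have "solution T0 T1 x n j = solution T0 T1 y n j" "solution T0 T1 x n (j - 1) = solution T0 T1 y n (j - 1)"
    by (rule Suc.IH, rule Suc.prems; simp)+
  then show ?case by (simp add: solution_Suc)
qed simp

lemma solution_translate: "solution T0 T1 (\<lambda>j. x (j - a)) n j = solution T0 T1 x n (j - a)"
  by (induction n arbitrary: j) (simp_all add: solution_Suc algebra_simps)

lemma solution_scaleR: "solution T0 T1 (\<lambda>j. c *\<^sub>R x j) n j = c *\<^sub>R solution T0 T1 x n j"
  by (induction n arbitrary: j) (simp_all add: solution_Suc cmatrix_scaleR scaleR_add_right)

text \<open>On the unit circle \<open>cmod (w - 1)^2 = 2 * (1 - Re w)\<close>, so the distance from
  1 determines the real part.\<close>

lemma unit_near_one: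
  assumes "1 \<le> n"
  obtains w where "cmod w = 1" "(cmod (w - 1))\<^sup>2 = 1 / real n" "Re w = 1 - 1 / (2 * real n)"
proof -
  define a where "a = 1 - 1 / (2 * real n)"
  have a: "0 \<le> a" "a \<le> 1" using assms by (simp_all add: a_def field_simps)
  then have sq: "(sqrt (1 - a\<^sup>2))\<^sup>2 = 1 - a\<^sup>2" by (simp add: power_le_one)
  define w where "w = Complex a (sqrt (1 - a\<^sup>2))"
  show thesis
  proof (rule that[of w])
    show "cmod w = 1" by (simp add: w_def cmod_def sq)
    have "(cmod (w - 1))\<^sup>2 = (a - 1)\<^sup>2 + (1 - a\<^sup>2)" by (simp add: w_def cmod_power2 sq)
    also have "\<dots> = 2 * (1 - a)" by (simp add: power2_eq_square algebra_simps)
    also have "\<dots> = 1 / real n" by (simp add: a_def)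
    finally show "(cmod (w - 1))\<^sup>2 = 1 / real n" .
  qed (simp add: w_def a_def)
qed

context coupled_system
begin

text \<open>On sequences with \<open>S f = w^k f\<close> the operator \<open>T\<close> acts as
  \<open>T0 + w^k T1\<close>. The vector \<open>v = R(l, T0) T1 u\<close> with
  \<open>l = 1 - \<alpha> + \<alpha> w\<close> is an eigenvector, because the characteristic
  function takes the value \<open>w^(-k)\<close> at \<open>l\<close>. Here
  \<open>cmod (l - 1)\<close> is of order \<open>n^(-1/2)\<close> but \<open>1 - (cmod l)^2\<close>
  only of order \<open>1/n\<close>, so Bernoulli's inequality keeps \<open>cmod l ^ n\<close> above
  1/2.\<close>

lemma approximate_eigenvalue:
  assumes n: "1 \<le> n"
  obtains w l v where "cmod w = 1" "v \<noteq> 0" "T0 *v v + w ^ k *s (T1 *v v) = l *s v"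
    "\<alpha> / 2 / sqrt (real n) \<le> cmod (l ^ n * (l - 1))"
proof -
  obtain w where w: "cmod w = 1" "(cmod (w - 1))\<^sup>2 = 1 / real n" "Re w = 1 - 1 / (2 * real n)"
    by (rule unit_near_one[OF n])
  have w0: "w \<noteq> 0" using w(1) by auto
  define l where "l = 1 - of_real \<alpha> + of_real \<alpha> * w"
  have l: "l \<noteq> 1 - of_real \<alpha>" using w0 \<alpha> by (simp add: l_def)
  obtain u where u: "T1 *v u \<noteq> 0" by (rule T1_nonzero_vec)
  define v where "v = resolvent l T0 *v (T1 *v u)"
  have "T1 *v v = (of_real \<alpha> ^ k / (of_real \<alpha> * w) ^ k) *s (T1 *v u)"
    unfolding v_def characteristic_vec[OF l] by (simp add: l_def)
  then have T1v: "w ^ k *s (T1 *v v) = T1 *v u"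
    using \<alpha> w0 by (simp add: power_mult_distrib)
  have "l *s v - T0 *v v = T1 *v u"
    unfolding v_def by (rule resolvent_right[OF not_spectrum[OF l]])
  then have eig: "T0 *v v + w ^ k *s (T1 *v v) = l *s v" unfolding T1v by (simp add: algebra_simps)
  have v0: "v \<noteq> 0" using T1v u by auto
  have im: "(Im w)\<^sup>2 = 1 - (Re w)\<^sup>2" using w(1) cmod_power2[of w] by simp
  have "(cmod l)\<^sup>2 = (1 - \<alpha> + \<alpha> * Re w)\<^sup>2 + \<alpha>\<^sup>2 * (Im w)\<^sup>2"
    by (simp add: l_def cmod_power2 power_mult_distrib)
  also have "\<dots> = 1 - 2 * \<alpha> * (1 - \<alpha>) * (1 - Re w)"
    unfolding im by (simp add: power2_eq_square algebra_simps)
  also have "\<dots> = 1 + - (\<alpha> * (1 - \<alpha>) / real n)" by (simp add: w(3))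
  finally have l2: "(cmod l)\<^sup>2 = 1 + - (\<alpha> * (1 - \<alpha>) / real n)" .
  \<comment> \<open>The value 3/4 is what leaves \<open>(1/2)^2\<close> after Bernoulli's
    inequality.\<close>
  have quarter: "\<alpha> * (1 - \<alpha>) \<le> 3 / 4"
    using zero_le_power2[of "\<alpha> - 1/2"] by (simp add: power2_eq_square algebra_simps)
  have "\<alpha> * (1 - \<alpha>) / real n \<le> \<alpha> * (1 - \<alpha>) / 1"
    using n \<alpha> by (intro divide_left_mono) auto
  then have "- 1 \<le> - (\<alpha> * (1 - \<alpha>) / real n)" using quarter by simp
  from Bernoulli_inequality[OF this, of n]
  have "1 - \<alpha> * (1 - \<alpha>) \<le> ((cmod l)\<^sup>2) ^ n" using n by (simp add: l2)
  then have "(1/2)\<^sup>2 \<le> (cmod l ^ n)\<^sup>2"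
    using quarter by (simp add: power2_eq_square power_mult_distrib)
  then have ln: "1 / 2 \<le> cmod l ^ n" by (rule power2_le_imp_le) simp
  have "cmod (w - 1) = sqrt (1 / real n)" using w(2) by (metis norm_ge_zero real_sqrt_abs abs_of_nonneg)
  moreover have "l - 1 = of_real \<alpha> * (w - 1)" by (simp add: l_def algebra_simps)
  ultimately have l1: "cmod (l - 1) = \<alpha> / sqrt (real n)" using \<alpha> by (simp add: norm_mult real_sqrt_divide)
  have "1 / 2 * (\<alpha> / sqrt (real n)) \<le> cmod l ^ n * (\<alpha> / sqrt (real n))"
    using ln \<alpha> by (intro mult_right_mono) auto
  then have "\<alpha> / 2 / sqrt (real n) \<le> cmod (l ^ n * (l - 1))"
    by (simp add: norm_mult norm_power l1)
  with w(1) v0 eig show thesis by (rule that)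
qed

text \<open>An approximate eigenvector cut off to a window twice as long as the time horizon: on the second
  half of the window the truncation is not felt, and the two halves have the same norm.\<close>

lemma hump:
  assumes n: "1 \<le> n"
  obtains h where "lp_le p h 1" "\<And>j. j < 0 \<or> 2 * int n + 2 \<le> j \<Longrightarrow> h j = 0"
    "\<And>y. y \<in> lp_space p \<Longrightarrow> (\<And>j. int n + 1 \<le> j \<Longrightarrow> j < 2 * int n + 2 \<Longrightarrow> y j = flow h (Suc n) j - flow h n j) \<Longrightarrow>
      \<alpha> / 4 / sqrt (real n) \<le> lp_norm p y"
proof -
  obtain w l v where w: "cmod w = 1" and v: "v \<noteq> 0" and eig: "T0 *v v + w ^ k *s (T1 *v v) = l *s v"
    and l: "\<alpha> / 2 / sqrt (real n) \<le> cmod (l ^ n * (l - 1))"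
    by (rule approximate_eigenvalue[OF n])
  define m where "m = int n + 1"
  have m: "m > 0" by (simp add: m_def)
  define f where "f = (\<lambda>j. cnj w ^ (k * nat j) *s v)"
  define g where "g = (\<lambda>j. if 0 \<le> j \<and> j < 2 * m then f j else 0)"
  have norm_f: "norm (f j) = norm v" for j by (simp add: f_def norm_cvec_mult norm_power w)
  have step: "T0 *v f j + T1 *v f (j - 1) = l *s f j" if "1 \<le> j" for j
  proof -
    have ww: "w * cnj w = 1" using w by (simp add: complex_norm_square[symmetric])
    have "nat j = Suc (nat (j - 1))" using that by simp
    then have "k * nat j = k + k * nat (j - 1)" by simp
    then have pw: "cnj w ^ (k * nat (j - 1)) = cnj w ^ (k * nat j) * w ^ k"
      using ww by (simp add: power_add mult.commute mult.left_commute power_mult_distrib[symmetric])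
    have "T0 *v f j + T1 *v f (j - 1) = cnj w ^ (k * nat j) *s (T0 *v v + w ^ k *s (T1 *v v))"
      by (simp only: f_def vec.scale pw vec.scale_right_distrib vec.scale_scale)
    also have "\<dots> = l *s f j" unfolding eig f_def by (simp add: mult.commute)
    finally show ?thesis .
  qed
  have flow_g: "flow g i j = l ^ i *s f j" if "int i \<le> j" "j < 2 * m" for i j
    using that
  proof (induction i arbitrary: j)
    case 0
    then show ?case by (simp add: g_def)
  next
    case (Suc i)
    then have "flow g (Suc i) j = l ^ i *s (T0 *v f j + T1 *v f (j - 1))"
      by (simp add: solution_Suc vec.scale vec.scale_right_distrib)
    also have "T0 *v f j + T1 *v f (j - 1) = l *s f j" using Suc.prems by (intro step) simp
    finally show ?case by (simp add: mult.commute)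
  qed
  \<comment> \<open>The hump is compared with two translates of the indicator of the second half.
    The norm \<open>s\<close> of this indicator is never computed: it cancels between normalisation
    and lower bound, so the argument is uniform in \<open>p\<close>. The second copy turns
    \<open>\<alpha> / 2\<close> into \<open>\<alpha> / 4\<close>.\<close>
  define ind :: "int \<Rightarrow> real" where "ind = (\<lambda>j. if m \<le> j \<and> j < 2 * m then 1 else 0)"
  have ind: "ind \<in> lp_space p" by (rule lp_finite_support[of "{m..<2 * m}"]) (auto simp: ind_def)
  define s where "s = lp_norm p ind"
  have s: "s > 0"
    using norm_le_lp_norm[OF p ind, of m] m by (simp add: s_def ind_def)
  have "lp_le p ind s" using ind by (simp add: lp_le_def s_def)
  moreover have "lp_le p (\<lambda>j. ind (j - (- m))) s"
    using ind lp_shift_int[where x = ind and a = "- m" and p = p] by (simp add: lp_le_def s_def)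
  ultimately have ind2: "lp_le p (\<lambda>j. ind j + ind (j - (- m))) (s + s)" by (rule lp_le_add[OF p])
  have g: "lp_le p g (norm v * (s + s))"
    by (rule lp_le_dominated[OF p ind2]) (auto simp: g_def norm_f ind_def)
  define c where "c = 1 / (norm v * (s + s))"
  have c: "c > 0" using v s by (simp add: c_def)
  show thesis
  proof (rule that[of "\<lambda>j. c *\<^sub>R g j"])
    show "lp_le p (\<lambda>j. c *\<^sub>R g j) 1"
      using lp_le_scaleR[OF p g, of c] c v s by (simp add: c_def)
    show "c *\<^sub>R g j = 0" if "j < 0 \<or> 2 * int n + 2 \<le> j" for j
      using that by (auto simp: g_def m_def)
    fix y assume y: "y \<in> lp_space p"
      and eq: "\<And>j. int n + 1 \<le> j \<Longrightarrow> j < 2 * int n + 2 \<Longrightarrow>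
        y j = flow (\<lambda>j. c *\<^sub>R g j) (Suc n) j - flow (\<lambda>j. c *\<^sub>R g j) n j"
    define q where "q = \<alpha> / 4 / sqrt (real n) / s"
    have q: "q > 0" using \<alpha> s n by (simp add: q_def)
    have lower: "q \<le> norm (y j)" if j: "m \<le> j" "j < 2 * m" for j
    proof -
      have "y j = c *\<^sub>R (l ^ Suc n *s f j - l ^ n *s f j)"
        using j by (subst eq) (auto simp: m_def solution_scaleR flow_g scaleR_right_diff_distrib)
      also have "l ^ Suc n *s f j - l ^ n *s f j = (l ^ n * (l - 1)) *s f j"
        by (simp add: vec.scale_left_diff_distrib algebra_simps)
      finally have "norm (y j) = c * (cmod (l ^ n * (l - 1)) * norm v)"
        using c by (simp add: norm_cvec_mult norm_f)
      also have "\<dots> \<ge> c * (\<alpha> / 2 / sqrt (real n) * norm v)"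
        using l c by (intro mult_left_mono mult_right_mono) auto
      also have "c * (\<alpha> / 2 / sqrt (real n) * norm v) = q"
        using v s by (simp add: c_def q_def)
      finally show ?thesis .
    qed
    have "norm (ind j) \<le> (1 / q) * norm (y j)" for j
      using lower[of j] q by (auto simp: ind_def field_simps)
    from lp_dominated(2)[OF p y _ this] q have "s \<le> 1 / q * lp_norm p y" by (simp add: s_def)
    then have "s * q \<le> lp_norm p y" using q by (simp add: field_simps)
    then show "\<alpha> / 4 / sqrt (real n) \<le> lp_norm p y" using s by (simp add: q_def)
  qed
qed

text \<open>At time \<open>N i\<close> the hump of amplitude \<open>2^(-i)\<close> contributes at
  least \<open>\<alpha> / 4 * 2^(-i) / sqrt (N i)\<close>, whereas the supposed rate allows only
  \<open>K * 4^(-i) / sqrt (N i)\<close>. This forces \<open>K\<close> to exceed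
  \<open>\<alpha> / 4 * 2^i\<close> for all large \<open>i\<close>. The condition
  \<open>i \<le> N i\<close> brings the times into the range where the asymptotic bound
  holds.\<close>

lemma increment_rate_optimal:
  assumes r: "\<And>n. 1 \<le> n \<Longrightarrow> 0 < r n" and small: "r \<in> o(\<lambda>n. real n powr (-1/2))"
  shows "\<not> increment_rate p T0 T1 r"
proof
  assume rate: "increment_rate p T0 T1 r"
  have "\<exists>n. 1 \<le> n \<and> i \<le> n \<and> r n \<le> (1/4) ^ i / sqrt (real n)" for i :: nat
  proof -
    have "\<forall>\<^sub>F n in sequentially. norm (r n) \<le> (1/4) ^ i * norm (real n powr (-1/2))"
      using landau_o.smallD[OF small, of "(1/4) ^ i"] by simp
    then have "\<forall>\<^sub>F n in sequentially. norm (r n) \<le> (1/4) ^ i * norm (real n powr (-1/2)) \<and> max 1 i \<le> n"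
      using eventually_ge_at_top[of "max 1 i"] by eventually_elim auto
    then obtain n where n: "norm (r n) \<le> (1/4) ^ i * norm (real n powr (-1/2))" "max 1 i \<le> n"
      by (auto simp: eventually_sequentially)
    moreover have "real n powr (-1/2) = 1 / sqrt (real n)"
      using n by (simp add: powr_minus_divide powr_half_sqrt)
    ultimately show ?thesis by (intro exI[of _ n]) auto
  qed
  then obtain N where N: "\<And>i. 1 \<le> N i" "\<And>i. i \<le> N i" "\<And>i. r (N i) \<le> (1/4) ^ i / sqrt (real (N i))"
    by metis
  define W where "W = (\<lambda>i. 2 * int (N i) + 2)"
  have W: "W i > 0" for i by (simp add: W_def)
  have "\<exists>h. lp_le p h 1 \<and> (\<forall>j. j < 0 \<or> W i \<le> j \<longrightarrow> h j = 0) \<and>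
      (\<forall>y. y \<in> lp_space p \<longrightarrow> (\<forall>j. int (N i) + 1 \<le> j \<and> j < W i \<longrightarrow> y j = flow h (Suc (N i)) j - flow h (N i) j) \<longrightarrow>
        \<alpha> / 4 / sqrt (real (N i)) \<le> lp_norm p y)" for i
    unfolding W_def by (rule hump[OF N(1)[of i]]) blast
  then obtain h where h: "\<And>i. lp_le p (h i) 1" "\<And>i j. j < 0 \<or> W i \<le> j \<Longrightarrow> h i j = 0"
    "\<And>i y. y \<in> lp_space p \<Longrightarrow> (\<And>j. int (N i) + 1 \<le> j \<Longrightarrow> j < W i \<Longrightarrow> y j = flow (h i) (Suc (N i)) j - flow (h i) (N i) j) \<Longrightarrow>
      \<alpha> / 4 / sqrt (real (N i)) \<le> lp_norm p y"
    by metis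
  \<comment> \<open>Windows are laid out from right to left, each ending where its predecessor
    begins, so they are disjoint.\<close>
  define a where "a = rec_nat (0::int) (\<lambda>i b. b - W (Suc i))"
  have a_Suc: "a (Suc i) + W (Suc i) = a i" for i by (simp add: a_def)
  have separated: "i < l \<Longrightarrow> a l + W l \<le> a i" for i l
  proof (induction l)
    case (Suc l)
    then show ?case using a_Suc[of l] W[of l] by (cases "i = l") auto
  qed simp
  define H where "H = (\<lambda>i j. h i (j - a i))"
  have H: "lp_le p (H i) 1" for i
    using h(1)[of i] lp_shift_int[where x = "h i" and a = "a i" and p = p] by (simp add: lp_le_def H_def)
  define t where "t = (\<lambda>j i. (1/2) ^ i *\<^sub>R H i j)"
  define x where "x = (\<lambda>j. suminf (t j))"
  have summable: "summable (t j)" for j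
  proof (rule summable_comparison_test'[of "\<lambda>i. (1/2) ^ i" 0])
    show "norm (t j i) \<le> (1/2) ^ i" for i
      using norm_le_lp_norm[OF p lp_leD(1)[OF H], of i j] lp_leD(2)[OF H, of i] by (simp add: t_def)
  qed (simp add: summable_geometric)
  have "lp_le p x 2"
  proof (rule lp_le_pointwise_limit[OF p])
    show "lp_le p (\<lambda>j. \<Sum>i<M. t j i) 2" for M
    proof -
      have "lp_le p (\<lambda>j. \<Sum>i<M. t j i) (\<Sum>i<M. \<bar>(1/2) ^ i\<bar> * 1)"
        unfolding t_def by (intro lp_le_sum lp_le_scaleR p H)
      moreover have "(\<Sum>i<M. \<bar>(1/2) ^ i\<bar> * 1) \<le> (2::real)"
        using sum_geometric_le[of "1/2" M] by simp
      ultimately show ?thesis by (rule lp_le_mono)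
    qed
    show "(\<lambda>M. \<Sum>i<M. t j i) \<longlonglongrightarrow> x j" for j
      unfolding x_def by (rule summable_LIMSEQ[OF summable])
  qed
  then have x: "x \<in> lp_space p" by (rule lp_leD)
  have x_window: "x j = (1/2) ^ i *\<^sub>R H i j" if "a i \<le> j" "j < a i + W i" for i j
  proof -
    have "t j l = 0" if "l \<notin> {i}" for l
    proof (cases "i < l")
      case True
      then show ?thesis using separated[OF True] \<open>a i \<le> j\<close> by (simp add: t_def H_def h(2))
    next
      case False
      then have "l < i" using that by simp
      then show ?thesis using separated[of l i] \<open>j < a i + W i\<close> by (simp add: t_def H_def h(2))
    qed
    then have "suminf (t j) = sum (t j) {i}" by (intro suminf_finite) auto
    then show ?thesis by (simp add: x_def t_def)
  qed
  obtain K n0 where K: "K > 0"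
      "\<And>n. n0 \<le> n \<Longrightarrow> norm (lp_dist p (flow x (Suc n)) (flow x n)) \<le> K * norm (r n)"
    using rate x unfolding increment_rate_def
    by (elim ballE landau_o.bigE) (auto simp: eventually_sequentially)
  have bound: "\<alpha> / 4 * 2 ^ i \<le> K" if i: "n0 \<le> i" for i
  proof -
    define y where "y = (\<lambda>j. flow x (Suc (N i)) j - flow x (N i) j)"
    have y: "y \<in> lp_space p"
      unfolding y_def by (rule lp_leD(1)[OF lp_le_diff[OF p lp_le_self[OF flow_in_lp[OF x]] lp_le_self[OF flow_in_lp[OF x]]]])
    \<comment> \<open>Up to time \<open>n\<close> the solution at offset \<open>j \<ge> n\<close>
      depends only on sites inside the window, where \<open>x\<close> is the scaled hump
      \<open>i\<close> alone.\<close>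
    have win: "flow x n (j + a i) = (1/2) ^ i *\<^sub>R flow (h i) n j" if "int n \<le> j" "j < W i" for n j
    proof -
      have "flow x n (j + a i) = flow (\<lambda>j. (1/2) ^ i *\<^sub>R H i j) n (j + a i)"
        using that by (intro solution_local x_window) auto
      also have "\<dots> = (1/2) ^ i *\<^sub>R flow (h i) n (j + a i - a i)"
        unfolding solution_scaleR H_def solution_translate ..
      finally show ?thesis by simp
    qed
    have "lp_le p (\<lambda>j. y (j - (- a i))) (lp_norm p y)"
      using y lp_shift_int[where x = y and a = "- a i" and p = p] by (simp add: lp_le_def)
    from lp_le_scaleR[OF p this, of "2 ^ i"]
    have y': "lp_le p (\<lambda>j. 2 ^ i *\<^sub>R y (j + a i)) (2 ^ i * lp_norm p y)" by simp
    have "\<alpha> / 4 / sqrt (real (N i)) \<le> lp_norm p (\<lambda>j. 2 ^ i *\<^sub>R y (j + a i))"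
    proof (rule h(3)[OF lp_leD(1)[OF y']])
      fix j assume j: "int (N i) + 1 \<le> j" "j < W i"
      then show "2 ^ i *\<^sub>R y (j + a i) = flow (h i) (Suc (N i)) j - flow (h i) (N i) j"
        unfolding y_def by (subst (1 2) win) (auto simp: scaleR_right_diff_distrib power_one_over)
    qed
    also have "\<dots> \<le> 2 ^ i * lp_norm p y" by (rule lp_leD(2)[OF y'])
    also have "lp_norm p y \<le> K * ((1/4) ^ i / sqrt (real (N i)))"
    proof -
      have "lp_norm p y \<le> K * norm (r (N i))"
        using K(2)[of "N i"] N(2)[of i] i by (auto simp: lp_dist_def y_def)
      also have "\<dots> \<le> K * ((1/4) ^ i / sqrt (real (N i)))"
        using K(1) N(3)[of i] r[OF N(1)[of i]] by (intro mult_left_mono) auto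
      finally show ?thesis .
    qed
    finally have "\<alpha> / 4 / sqrt (real (N i)) \<le> 2 ^ i * (K * ((1/4) ^ i / sqrt (real (N i))))" by simp
    also have "\<dots> = K * (1/2) ^ i / sqrt (real (N i))"
      by (simp add: power_mult_distrib[symmetric])
    finally have "\<alpha> / 4 \<le> K * (1/2) ^ i"
      unfolding divide_le_cancel using N(1)[of i] by simp
    then show ?thesis by (simp add: power_one_over field_simps)
  qed
  obtain i where i: "K / (\<alpha> / 4) < 2 ^ i" using real_arch_pow[of 2 "K / (\<alpha> / 4)"] by auto
  have "(2::real) ^ i \<le> 2 ^ (i + n0)" by (intro power_increasing) auto
  with i have "K / (\<alpha> / 4) < 2 ^ (i + n0)" by linarith
  then have "K < \<alpha> / 4 * 2 ^ (i + n0)" using \<alpha> by (simp add: field_simps)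
  with bound[of "i + n0"] show False by simp
qed

end

subsection \<open>Convergence of all solutions\<close>

lemma const_seq_in_lp_eq_0:
  assumes p: "1 \<le> p" "p \<noteq> \<infinity>" and y: "const_seq (y :: 'a::real_normed_vector) \<in> lp_space p"
  shows "y = 0"
proof (rule ccontr)
  assume "y \<noteq> 0"
  have "(\<lambda>_::int. norm y powr enn2real p) summable_on UNIV"
    using y p by (simp add: lp_space_def const_seq_def)
  from finite_sum_le_infsum[OF this, of "{1..int n}" for n]
  have le: "real n * norm y powr enn2real p \<le> infsum (\<lambda>_::int. norm y powr enn2real p) UNIV" for n
    by simp
  have "0 < norm y powr enn2real p" using \<open>y \<noteq> 0\<close> by simp
  then obtain n where "infsum (\<lambda>_::int. norm y powr enn2real p) UNIV < real n * norm y powr enn2real p"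
    using ex_less_of_nat_mult by blast
  with le[of n] show False by simp
qed

lemma lp_le_block:
  fixes u :: "'a::real_normed_vector"
  assumes p: "1 \<le> p" "p \<noteq> \<infinity>" and A: "finite A" and x: "x = (\<lambda>j. if j \<in> A then u else 0)"
  shows "lp_le p x (real (card A) powr (1 / enn2real p) * norm u)"
proof -
  define q where "q = enn2real p"
  have q: "q \<ge> 1" unfolding q_def using p by (rule enn2real_ge_1)
  have "infsum (\<lambda>j. norm (x j) powr q) UNIV = infsum (\<lambda>j. norm u powr q) A"
    by (rule infsum_cong_neutral) (auto simp: x)
  also have "\<dots> = real (card A) * norm u powr q" using A by simp
  finally have "lp_norm p x = real (card A) powr (1 / q) * norm u"
    using p q by (simp add: lp_norm_def powr_mult powr_powr flip: q_def)
  moreover have "x \<in> lp_space p" using A by (rule lp_finite_support) (simp add: x)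
  ultimately show ?thesis by (simp add: lp_le_def q_def)
qed

text \<open>Density of finitely supported sequences, available for finite \<open>p\<close>.\<close>

lemma lp_tail:
  fixes w :: "int \<Rightarrow> 'a::real_normed_vector"
  assumes p: "1 \<le> p" "p \<noteq> \<infinity>" and w: "w \<in> lp_space p" and e: "0 < e"
  obtains F where "finite F" "lp_le p (\<lambda>j. if j \<in> F then 0 else w j) e"
proof -
  define q where "q = enn2real p"
  have q: "q \<ge> 1" unfolding q_def using p by (rule enn2real_ge_1)
  define f where "f = (\<lambda>j. norm (w j) powr q)"
  have f: "f summable_on UNIV" using w p by (simp add: lp_space_def f_def q_def)
  have "(sum f \<longlongrightarrow> infsum f UNIV) (finite_subsets_at_top UNIV)"
    using f by (simp add: has_sum_def [symmetric] has_sum_infsum)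
  moreover have "infsum f UNIV - e powr q < infsum f UNIV" using e by simp
  ultimately have "\<forall>\<^sub>F F in finite_subsets_at_top UNIV. infsum f UNIV - e powr q < sum f F"
    by (rule order_tendstoD)
  then obtain F where F: "finite F" "infsum f UNIV - e powr q < sum f F"
    by (auto simp: eventually_finite_subsets_at_top)
  let ?t = "\<lambda>j. if j \<in> F then 0 else w j"
  have "infsum (\<lambda>j. norm (?t j) powr q) UNIV = infsum f (UNIV - F)"
    by (rule infsum_cong_neutral) (auto simp: f_def)
  also have "\<dots> = infsum f UNIV - sum f F"
    using F f by (subst infsum_Diff) auto
  also have "\<dots> \<le> e powr q" using F by simp
  finally have "infsum (\<lambda>j. norm (?t j) powr q) UNIV powr (1 / q) \<le> (e powr q) powr (1 / q)"
    using q by (intro powr_mono2 infsum_nonneg) auto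
  then have "lp_norm p ?t \<le> e" using p q e by (simp add: lp_norm_def powr_powr flip: q_def)
  moreover have "?t \<in> lp_space p"
    by (rule lp_dominated(1)[OF p(1) w, of 1]) auto
  ultimately show thesis using that F(1) by (auto simp: lp_le_def)
qed

context coupled_system
begin

text \<open>The mean spreads a point mass over \<open>n\<close> sites with height \<open>1/n\<close>
  each, whence the exponent \<open>1/p - 1\<close>, negative exactly when
  \<open>p > 1\<close>.\<close>

lemma lp_le_mean_point:
  fixes u :: "complex^'m"
  assumes "p \<noteq> \<infinity>"
  shows "lp_le p (\<lambda>j. (1 / real n) *\<^sub>R shifts n (\<lambda>j. if j = a then u else 0) j)
      (real n powr (1 / enn2real p - 1) * norm u)"
proof (cases "n = 0")
  case True
  then show ?thesis using lp_le_zero[of p] by simp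
next
  case False
  have "(\<lambda>j. (1 / real n) *\<^sub>R shifts n (\<lambda>j. if j = a then u else 0) j)
      = (\<lambda>j. if j \<in> {a + 1..a + int n} then (1 / real n) *\<^sub>R u else 0)"
  proof
    fix j
    have "shifts n (\<lambda>j. if j = a then u else 0) j = (\<Sum>i\<in>{1..n}. if nat (j - a) = i then (if a < j then u else 0) else 0)"
      unfolding shifts_def by (intro sum.cong) auto
    also have "\<dots> = (if j \<in> {a + 1..a + int n} then u else 0)"
      by (subst sum.delta') auto
    finally show "(1 / real n) *\<^sub>R shifts n (\<lambda>j. if j = a then u else 0) j
      = (if j \<in> {a + 1..a + int n} then (1 / real n) *\<^sub>R u else 0)" by simp
  qed
  from lp_le_block[OF p assms _ this]
  have "lp_le p (\<lambda>j. (1 / real n) *\<^sub>R shifts n (\<lambda>j. if j = a then u else 0) j)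
      (real n powr (1 / enn2real p) * (norm u / real n))" by simp
  moreover have "real n powr (1 / enn2real p) * (norm u / real n) = real n powr (1 / enn2real p - 1) * norm u"
    using False by (simp add: powr_diff)
  ultimately show ?thesis by simp
qed

text \<open>Off a finite set \<open>w\<close> is small and its means remain so; on the finite set
  the means of the point masses tend to 0 because \<open>p > 1\<close>.\<close>

lemma mean_limit_reflexive:
  assumes p1: "1 < p" "p < \<infinity>" and x: "x \<in> lp_space p"
  shows "mean_limit p T0 T1 x 0"
proof -
  have pinf: "p \<noteq> \<infinity>" using p1 by auto
  define w where "w = M_op T0 T1 x"
  have w: "w \<in> lp_space p" unfolding w_def by (rule M_op_in_lp[OF x])
  have q: "1 < enn2real p"
  proof -
    obtain r where r: "p = ennreal r" "0 \<le> r" using pinf by (cases p) auto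
    then have "ennreal 1 < ennreal r" using p1(1) by simp
    then have "1 < r" using r(2) by (subst (asm) ennreal_less_iff) auto
    then show ?thesis using r by simp
  qed
  have "(\<lambda>n. lp_dist p (shift_mean T0 T1 x n) (const_seq 0)) \<longlonglongrightarrow> 0"
  proof (rule order_tendstoI)
    fix b :: real assume "b < 0"
    then show "\<forall>\<^sub>F n in sequentially. b < lp_dist p (shift_mean T0 T1 x n) (const_seq 0)"
      by (intro always_eventually allI, elim less_le_trans)
        (auto simp: const_seq_def intro!: lp_dist_nonneg shift_mean_in_lp[OF x])
  next
    fix b :: real assume b: "0 < b"
    obtain F where F: "finite F" "lp_le p (\<lambda>j. if j \<in> F then 0 else w j) (b / 2)"
      using lp_tail[OF p pinf w, of "b / 2"] b by auto
    have bound: "lp_dist p (shift_mean T0 T1 x n) (const_seq 0)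
        \<le> real n powr (1 / enn2real p - 1) * (\<Sum>a\<in>F. norm (w a)) + b / 2" for n
    proof -
      have "w j = (\<Sum>a\<in>F. if j = a then w a else 0) + (if j \<in> F then 0 else w j)" for j
        using F(1) by (simp add: sum.delta)
      then have "shifts n w j = shifts n (\<lambda>j. (\<Sum>a\<in>F. if j = a then w a else 0) + (if j \<in> F then 0 else w j)) j" for j
        by (metis (no_types, lifting) ext)
      also have "\<dots> j = (\<Sum>a\<in>F. shifts n (\<lambda>j. if j = a then w a else 0) j) + shifts n (\<lambda>j. if j \<in> F then 0 else w j) j" for j
        unfolding shifts_def sum.distrib by (subst sum.swap) simp
      finally have eq: "shift_mean T0 T1 x n = (\<lambda>j. (\<Sum>a\<in>F. (1 / real n) *\<^sub>R shifts n (\<lambda>j. if j = a then w a else 0) j)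
          + (1 / real n) *\<^sub>R shifts n (\<lambda>j. if j \<in> F then 0 else w j) j)"
        by (simp add: shift_mean_eq w_def[symmetric] scaleR_add_right scaleR_right.sum)
      have "lp_le p (shift_mean T0 T1 x n) ((\<Sum>a\<in>F. real n powr (1 / enn2real p - 1) * norm (w a)) + b / 2)"
        unfolding eq by (intro lp_le_add lp_le_sum lp_le_mean lp_le_mean_point pinf p F)
      then show ?thesis by (simp add: lp_dist_def const_seq_def lp_le_def sum_distrib_left)
    qed
    have "(\<lambda>n. real n powr (1 / enn2real p - 1) * (\<Sum>a\<in>F. norm (w a))) \<longlonglongrightarrow> 0"
      using q by (intro tendsto_mult_left_zero tendsto_neg_powr filterlim_real_sequentially) (simp add: field_simps)
    then have "\<forall>\<^sub>F n in sequentially. real n powr (1 / enn2real p - 1) * (\<Sum>a\<in>F. norm (w a)) < b / 2"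
      using b by (intro order_tendstoD(2)[of _ 0]) auto
    then show "\<forall>\<^sub>F n in sequentially. lp_dist p (shift_mean T0 T1 x n) (const_seq 0) < b"
    proof eventually_elim
      case (elim n)
      then show ?case using bound[of n] by linarith
    qed
  qed
  moreover have "(0 :: complex^'m) \<in> mat_range T1" unfolding mat_range_def by (rule range_eqI[of _ _ 0]) simp
  ultimately show ?thesis
    using x by (auto simp: mean_limit_def lp_tendsto_def const_seq_def intro: shift_mean_in_lp)
qed

text \<open>\<open>M\<close> attains every scalar profile times a fixed nonzero vector, so failures
  of mean ergodicity of the scalar shift carry over to the system.\<close>

lemma profile:
  obtains v where "v \<noteq> 0" "\<And>s. \<exists>u. M_op T0 T1 (\<lambda>j. s j *\<^sub>R u) = (\<lambda>j. s j *\<^sub>R v)"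
proof -
  obtain \<kappa> where \<kappa>: "\<kappa> \<ge> 1" "\<And>v. T1 *v (R *v (R *v (T1 *v v))) = \<kappa> *\<^sub>R (T1 *v v)"
    by (rule T1_R_R_T1) blast
  obtain u where u: "T1 *v u \<noteq> 0" by (rule T1_nonzero_vec)
  have "M_op T0 T1 (\<lambda>j. s j *\<^sub>R (R *v (T1 *v u))) = (\<lambda>j. s j *\<^sub>R (\<kappa> *\<^sub>R (T1 *v u)))" for s
    by (rule ext) (simp add: M_op_eq cmatrix_scaleR \<kappa>(2) mult.commute)
  then show thesis using u \<kappa>(1) by (intro that[of "\<kappa> *\<^sub>R (T1 *v u)"]) auto
qed

text \<open>The means of a point mass keep their norm for \<open>p = 1\<close>, although the only
  constant available as a limit is 0.\<close>

lemma no_mean_limit_1: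
  assumes p1: "p = 1"
  obtains x where "x \<in> lp_space p" "\<And>y. \<not> mean_limit p T0 T1 x y"
proof -
  obtain v where v: "v \<noteq> 0" "\<And>s. \<exists>u. M_op T0 T1 (\<lambda>j. s j *\<^sub>R u) = (\<lambda>j. s j *\<^sub>R v)"
    by (rule profile) blast
  define s :: "int \<Rightarrow> real" where "s = (\<lambda>j. if j = 0 then 1 else 0)"
  obtain u where M: "M_op T0 T1 (\<lambda>j. s j *\<^sub>R u) = (\<lambda>j. s j *\<^sub>R v)" using v(2) by blast
  let ?x = "\<lambda>j. s j *\<^sub>R u"
  have x: "?x \<in> lp_space p" by (rule lp_finite_support[of "{0}"]) (auto simp: s_def)
  have "\<not> mean_limit p T0 T1 ?x y" for y
  proof
    assume lim: "mean_limit p T0 T1 ?x y"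
    then have "y = 0" using mean_limitD(2)[OF lim] p1 by (intro const_seq_in_lp_eq_0[of p]) auto
    have "norm v \<le> lp_dist p (shift_mean T0 T1 ?x n) (const_seq y)" if n: "1 \<le> n" for n
    proof -
      have val: "shift_mean T0 T1 ?x n j = (1 / real n) *\<^sub>R v" if "j \<in> {1..int n}" for j
      proof -
        have "shifts n (\<lambda>j. s j *\<^sub>R v) j = (\<Sum>i\<in>{1..n}. if nat j = i then v else 0)"
          unfolding shifts_def using that by (intro sum.cong) (auto simp: s_def)
        also have "\<dots> = v" using that by (subst sum.delta') auto
        finally show ?thesis by (simp add: shift_mean_eq M)
      qed
      have "norm v = (\<Sum>j\<in>{1..int n}. norm (shift_mean T0 T1 ?x n j))"
        using n by (simp add: val)
      also have "\<dots> \<le> infsum (\<lambda>j. norm (shift_mean T0 T1 ?x n j)) UNIV"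
        using shift_mean_in_lp[OF x, of n] p1
        by (intro finite_sum_le_infsum) (auto simp: lp_space_def)
      also have "\<dots> = lp_dist p (shift_mean T0 T1 ?x n) (const_seq y)"
        using p1 \<open>y = 0\<close> by (simp add: lp_dist_def lp_norm_def const_seq_def infsum_nonneg)
      finally show ?thesis .
    qed
    then have "norm v \<le> 0"
      by (intro LIMSEQ_le_const[OF mean_limitD(3)[OF lim]]) blast
    then show False using v(1) by simp
  qed
  with x show thesis by (rule that)
qed

text \<open>For the indicator of the negative integers the \<open>n\<close>-th mean is
  \<open>v\<close> at site 0 and 0 at site \<open>n\<close>, so no constant is a uniform
  limit.\<close>

lemma no_mean_limit_infinity:
  assumes p1: "p = \<infinity>"
  obtains x where "x \<in> lp_space p" "\<And>y. \<not> mean_limit p T0 T1 x y"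
proof -
  obtain v where v: "v \<noteq> 0" "\<And>s. \<exists>u. M_op T0 T1 (\<lambda>j. s j *\<^sub>R u) = (\<lambda>j. s j *\<^sub>R v)"
    by (rule profile) blast
  define s :: "int \<Rightarrow> real" where "s = (\<lambda>j. if j < 0 then 1 else 0)"
  obtain u where M: "M_op T0 T1 (\<lambda>j. s j *\<^sub>R u) = (\<lambda>j. s j *\<^sub>R v)" using v(2) by blast
  let ?x = "\<lambda>j. s j *\<^sub>R u"
  have x: "?x \<in> lp_space p"
    using p1 by (auto simp: lp_space_def s_def bounded_iff intro!: exI[of _ "norm u"])
  have "\<not> mean_limit p T0 T1 ?x y" for y
  proof
    assume lim: "mean_limit p T0 T1 ?x y"
    have diff: "(\<lambda>j. shift_mean T0 T1 ?x n j - const_seq y j) \<in> lp_space p" for n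
      by (rule lp_leD(1)[OF lp_le_diff[OF p lp_le_self[OF shift_mean_in_lp[OF x]] lp_le_self[OF mean_limitD(2)[OF lim]]]])
    have le: "norm (shift_mean T0 T1 ?x n j - y) \<le> lp_dist p (shift_mean T0 T1 ?x n) (const_seq y)" for n j
      using norm_le_lp_norm[OF p diff, where i = j] by (simp add: lp_dist_def const_seq_def)
    have "norm (v - y) \<le> lp_dist p (shift_mean T0 T1 ?x n) (const_seq y)" if n: "1 \<le> n" for n
    proof -
      have "shifts n (\<lambda>j. s j *\<^sub>R v) 0 = real n *\<^sub>R v"
        unfolding shifts_def by (subst sum.cong[OF refl, of _ _ "\<lambda>_. v"])
          (auto simp: s_def sum_constant_scaleR simp del: sum_constant)
      then have "shift_mean T0 T1 ?x n 0 = v" using n by (simp add: shift_mean_eq M)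
      then show ?thesis using le[of n 0] by simp
    qed
    then have 1: "norm (v - y) \<le> 0"
      by (intro LIMSEQ_le_const[OF mean_limitD(3)[OF lim]]) blast
    have "norm (0 - y) \<le> lp_dist p (shift_mean T0 T1 ?x n) (const_seq y)" for n
    proof -
      have "shifts n (\<lambda>j. s j *\<^sub>R v) (int n) = 0"
        unfolding shifts_def by (intro sum.neutral) (auto simp: s_def)
      then have "shift_mean T0 T1 ?x n (int n) = 0" by (simp add: shift_mean_eq M)
      then show ?thesis using le[of n "int n"] by simp
    qed
    then have "norm (0 - y) \<le> 0"
      by (intro LIMSEQ_le_const[OF mean_limitD(3)[OF lim]]) blast
    with 1 v(1) show False by simp
  qed
  with x show thesis by (rule that)
qed

lemma Y_space_iff:
  assumes "x \<in> lp_space p"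
  shows "x \<in> Y_space p T0 T1 \<longleftrightarrow> (\<exists>y. mean_limit p T0 T1 x y)"
  unfolding Y_space_def using assms mean_limit_if_flow_tendsto[OF assms] flow_tendsto[OF assms] by blast

lemma Y_space_full_iff: "Y_space p T0 T1 = lp_space p \<longleftrightarrow> 1 < p \<and> p < \<infinity>"
proof
  assume full: "Y_space p T0 T1 = lp_space p"
  have "p \<noteq> 1"
  proof
    assume "p = 1"
    then obtain x where "x \<in> lp_space p" "\<And>y. \<not> mean_limit p T0 T1 x y" by (rule no_mean_limit_1) blast
    then show False using Y_space_iff full by blast
  qed
  moreover have "p \<noteq> \<infinity>"
  proof
    assume "p = \<infinity>"
    then obtain x where "x \<in> lp_space p" "\<And>y. \<not> mean_limit p T0 T1 x y" by (rule no_mean_limit_infinity) blast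
    then show False using Y_space_iff full by blast
  qed
  ultimately show "1 < p \<and> p < \<infinity>" using p by (metis infinity_ennreal_def order_le_less top.not_eq_extremum)
next
  assume "1 < p \<and> p < \<infinity>"
  then have "x \<in> Y_space p T0 T1" if "x \<in> lp_space p" for x
    using that mean_limit_reflexive[of x] Y_space_iff[OF that] by blast
  then show "Y_space p T0 T1 = lp_space p" by (auto simp: Y_space_def)
qed

lemma const_limits_trivial:
  assumes "p < \<infinity>" "const_seq y \<in> lp_space p"
  shows "const_seq y = (\<lambda>_. 0) \<and> const_seq (L_map T0 T1 y) = (\<lambda>_. 0)"
proof -
  have "y = 0" using assms p by (intro const_seq_in_lp_eq_0[of p]) auto
  then show ?thesis by (simp add: const_seq_def L_map_0)
qed

end

theorem theorem2p7:
  fixes T0 T1 :: "complex^'m^'m" and p :: ennreal and \<alpha> :: real and k :: nat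
  assumes "1 \<le> p"
    and "T1 \<noteq> 0"
    and "0 < \<alpha>" and "\<alpha> < 1" and "1 \<le> k"
    and "mat_spectrum T0 = {1 - complex_of_real \<alpha>}"
    and "\<forall>\<mu>. \<mu> \<noteq> 1 - complex_of_real \<alpha> \<longrightarrow>
           T1 ** resolvent \<mu> T0 ** T1
             = mat (complex_of_real \<alpha> ^ k / (\<mu> - 1 + complex_of_real \<alpha>) ^ k) ** T1"
  shows
    "\<comment> \<open>(a)\<close>
     (\<forall>x0\<in>lp_space p. x0 \<in> Y_space p T0 T1 \<longleftrightarrow> (\<exists>y0. mean_limit p T0 T1 x0 y0)) \<and>
     (\<forall>x0\<in>lp_space p. \<forall>y0. mean_limit p T0 T1 x0 y0 \<longrightarrow>
        lp_tendsto p (solution T0 T1 x0) (const_seq (L_map T0 T1 y0))) \<and>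
     (Y_space p T0 T1 = lp_space p \<longleftrightarrow> 1 < p \<and> p < \<infinity>) \<and>
     (p < \<infinity> \<longrightarrow> (\<forall>y0\<in>mat_range T1. const_seq y0 \<in> lp_space p \<longrightarrow>
        const_seq y0 = (\<lambda>_. 0) \<and> const_seq (L_map T0 T1 y0) = (\<lambda>_. 0))) \<and>
     \<comment> \<open>(b)\<close>
     limit_rate p T0 T1 (\<lambda>n. real n powr (-1/2)) \<and>
     \<comment> \<open>(c)\<close>
     increment_rate p T0 T1 (\<lambda>n. real n powr (-1/2)) \<and>
     \<comment> \<open>optimality of the rates\<close>
     (\<forall>r. (\<forall>n\<ge>1. 0 < r n) \<and> r \<in> o(\<lambda>n. real n powr (-1/2)) \<longrightarrow>
        \<not> limit_rate p T0 T1 r \<and> \<not> increment_rate p T0 T1 r)"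
proof -
  interpret coupled_system p T0 T1 \<alpha> k
    by (unfold_locales) (fact assms)+
  \<comment> \<open>A faster limit rate would entail an equally fast increment rate, so the
    counterexample for increments refutes both.\<close>
  have optimal: "\<not> limit_rate p T0 T1 r \<and> \<not> increment_rate p T0 T1 r"
    if "(\<forall>n\<ge>1. 0 < r n) \<and> r \<in> o(\<lambda>n. real n powr (-1/2))" for r
    using increment_rate_optimal[of r] increment_rate_if_limit_rate[of r] that by blast
  show ?thesis
    by (intro conjI[OF _ conjI[OF _ conjI[OF _ conjI[OF _ conjI[OF _ conjI]]]]] ballI allI impI
        Y_space_iff flow_tendsto Y_space_full_iff const_limits_trivial limit_rate_sqrt
        increment_rate_if_limit_rate[OF limit_rate_sqrt] optimal)
qed

end
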